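(* Let $\Sigma_{\mathbf{A}}$ be a countable Markov shift as in the context (irreducible incidence matrix $\mathbf{A}$, with columns eventually constant). Consider a potential $\phi : \Sigma_{\mathbf{A}} \to \mathbb{R}$ of the form $\phi = \varphi + \log(p \circ \pi_1)$, with $\varphi \in \mathcal{H}_{\alpha}(\Sigma_{\mathbf{A}})$ and $p : M_0 \to [0, 1]$ satisfying $p(b_k) > 0$ for each $k \in \mathbb{N}$ and $\sum_{k = 1}^{\infty}p(b_k) = 1$. Then the Ruelle operator $L_{\phi}$ is well defined on $\mathcal{H}_\alpha(\Sigma_{\mathbf{A}})$ and the following hold: (1) There are $\lambda_{\phi} > 0$ and a strictly positive function $f_{\phi} \in \mathcal{H}_{\alpha}(\Sigma_{\mathbf{A}})$ such that $L_{\phi}(f_{\phi}) = \lambda_{\phi}f_{\phi}$. Moreover, the eigenvalue $\lambda_{\phi}$ is simple and maximal. (2) There exists a Borel probability measure $\rho_{\phi}$ on $\Sigma_{\mathbf{A}}$ satisfying $L^*_{\phi}(\rho_{\phi}) = \lambda_{\phi}\rho_{\phi}$. (3) For $\overline{\phi} = \phi + \log(f_{\phi}) - \log(f_{\phi} \circ \sigma) - \log(\lambda_{\phi})$, there is a unique Borel probability measure $\mu_{\phi}$ on $\Sigma_{\mathbf{A}}$ that is a fixed point of the operator $L^*_{\overline{\phi}}$. Moreover, $\mu_\phi$ is $\sigma$-invariant and can be expressed in the form $d\mu_{\phi} = f_{\phi}\,d\rho_{\phi}$, with $f_{\phi}$ satisfying (1) and $\rho_{\phi}$ satisfying (2). (4)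 If the incidence matrix $\mathbf{A}$ is aperiodic, then for any $\psi \in \mathcal{H}_{\alpha}(\Sigma_{\mathbf{A}})$ we have $$\lim_{n \to \infty}L^n_{\overline{\phi}}(\psi) = \int_{\Sigma_{\mathbf{A}}}\psi\,d\mu_{\phi}$$ uniformly in the norm $\|\cdot\|_{\infty}$. Furthermore, in this case the eigenvalue $\lambda_\phi$ is isolated, that is, the remainder of the spectrum of $L_\phi$ is contained in a disk centered at zero with radius strictly smaller than $\lambda_\phi$.
   Context: $\mathbb{N}=\{1,2,\dots\}$. $M=\{b_k:k\in\mathbb{N}\}\cup\{b_\infty\}\subset[0,1]$ is compact, with $b_k<b_{k+1}$ for all $k$, and $b_\infty=1$ is the unique accumulation point of $M$. $M_0=\{b_k:k\in\mathbb{N}\}$, and $\mathbf{A}$ is an $M_0\times M_0$ matrix with entries in $\{0,1\}$. The countable Markov shift is $\Sigma_{\mathbf{A}}=\{x=(x_n)_{n\in\mathbb{N}}\in M_0^{\mathbb{N}}:\mathbf{A}_{x_n,x_{n+1}}=1\ \forall n\}$, with metric $d(x,y)=\sum_{n\ge1}2^{-n}|x_n-y_n|$ and shift $\sigma((x_n)_n)=(x_{n+1})_n$; $\pi_1(x)=x_1$. Standing assumptions: $\mathbf{A}$ is irreducible (for all $i,j$ there is $k\in\mathbb{N}$ such that the $(b_i,b_j)$ entry of $\mathbf{A}^k$ is positive), and there is $j_0\in\mathbb{N}$ such that for every $j\ge j_0$, $\mathbf{A}_{b_i,b_j}=\mathbf{A}_{b_i,b_{j_0}}$ for all $i\in\mathbb{N}$.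 $\mathbf{A}$ is aperiodic if there is $k\in\mathbb{N}$ such that all entries of $\mathbf{A}^k$ are positive. $\mathcal{H}_\alpha(\Sigma_{\mathbf{A}})$ is the Banach space of $\alpha$-Hölder continuous functions on $\Sigma_{\mathbf{A}}$ with norm $\|\varphi\|_\alpha=\|\varphi\|_\infty+\sup_{x\neq y}|\varphi(x)-\varphi(y)|/d(x,y)^\alpha$. The classical Ruelle operator is $L_\phi(\xi)(x)=\sum_{a\in M_0,\ \mathbf{A}_{a,x_1}=1}e^{\phi(ax)}\xi(ax)$, where $ax=(a,x_1,x_2,\dots)$; "well defined" means that the sum is finite for every $\xi\in\mathcal{H}_\alpha(\Sigma_{\mathbf{A}})$ and $x\in\Sigma_{\mathbf{A}}$. The dual $L_\phi^*$ acts on Borel measures on $\Sigma_{\mathbf{A}}$ by $\int\psi\,dL_\phi^*(\mu)=\int L_\phi(\psi)\,d\mu$ for all $\psi\in\mathcal{H}_\alpha(\Sigma_{\mathbf{A}})$. Spectral statements refer to $L_\phi$ acting on $\mathcal{H}_\alpha(\Sigma_{\mathbf{A}})$ (complexified where needed). "Simple" means that the eigenspace is one-dimensional; "maximal" means that every eigenvalue $\lambda$ satisfies $|\lambda|\le\lambda_\phi$. *)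

theory Defs
  imports "HOL-Probability.Probability"
begin

text \<open>
  Sequences are indexed from 0: the symbol \<open>b\<^sub>k\<close> is \<open>b (k - 1)\<close>, the coordinate \<open>x\<^sub>n\<close> of
  a point is \<open>x (n - 1)\<close>, so \<open>\<pi>\<^sub>1 x = x 0\<close>. The alphabet \<open>M\<^sub>0\<close> is \<open>range b\<close>, and
  \<open>M = insert 1 (range b)\<close>, with \<open>1\<close> in the role of \<open>b\<^sub>\<infinity>\<close>. A matrix is a function of two
  symbols; only its values on \<open>M\<^sub>0 \<times> M\<^sub>0\<close> matter.
\<close>

text \<open>
  The entries of a power of an infinite 0-1 matrix may be infinite, hence the values in \<^typ>\<open>ennreal\<close>.
\<close>

primrec matrix_power :: "real set \<Rightarrow> (real \<Rightarrow> real \<Rightarrow> nat) \<Rightarrow> nat \<Rightarrow> real \<Rightarrow> real \<Rightarrow> ennreal" where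
  "matrix_power M0 A 0 i j = (if i = j then 1 else 0)"
| "matrix_power M0 A (Suc k) i j = (\<Sum>\<^sub>\<infinity>l\<in>M0. matrix_power M0 A k i l * of_nat (A l j))"

definition irreducible_matrix :: "real set \<Rightarrow> (real \<Rightarrow> real \<Rightarrow> nat) \<Rightarrow> bool" where
  "irreducible_matrix M0 A \<longleftrightarrow> (\<forall>i\<in>M0. \<forall>j\<in>M0. \<exists>k\<ge>1. matrix_power M0 A k i j > 0)"

definition aperiodic_matrix :: "real set \<Rightarrow> (real \<Rightarrow> real \<Rightarrow> nat) \<Rightarrow> bool" where
  "aperiodic_matrix M0 A \<longleftrightarrow> (\<exists>k\<ge>1. \<forall>i\<in>M0. \<forall>j\<in>M0. matrix_power M0 A k i j > 0)"

locale countable_markov_shift =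
  fixes b :: "nat \<Rightarrow> real" and A :: "real \<Rightarrow> real \<Rightarrow> nat"
  assumes alphabet_subset: "insert 1 (range b) \<subseteq> {0..1}"
    and alphabet_compact: "compact (insert 1 (range b))"
    and alphabet_increasing: "strict_mono b"
    and alphabet_limpt: "\<And>z. z islimpt insert 1 (range b) \<longleftrightarrow> z = 1"
    and matrix_entries: "\<And>i j. A (b i) (b j) \<in> {0, 1}"
    and matrix_irreducible: "irreducible_matrix (range b) A"
    and columns_eventually_constant: "\<exists>j0. \<forall>j\<ge>j0. \<forall>i. A (b i) (b j) = A (b i) (b j0)"

definition shift_space :: "real set \<Rightarrow> (real \<Rightarrow> real \<Rightarrow> nat) \<Rightarrow> (nat \<Rightarrow> real) set" where
  "shift_space M0 A = {x. \<forall>n. x n \<in> M0 \<and> A (x n) (x (Suc n)) = 1}"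

text \<open>
  An unconditional sum agrees with the series wherever the latter converges, and is \<open>0\<close> elsewhere,
  so that the distance is nonnegative on the whole type, as \<^locale>\<open>Metric_space\<close> demands.
\<close>

definition seq_dist :: "(nat \<Rightarrow> real) \<Rightarrow> (nat \<Rightarrow> real) \<Rightarrow> real" where
  "seq_dist x y = (\<Sum>\<^sub>\<infinity>n. \<bar>x n - y n\<bar> / 2 ^ Suc n)"

definition shift :: "(nat \<Rightarrow> real) \<Rightarrow> nat \<Rightarrow> real" where
  "shift x = (\<lambda>n. x (Suc n))"

definition prepend :: "real \<Rightarrow> (nat \<Rightarrow> real) \<Rightarrow> nat \<Rightarrow> real" where
  "prepend a x = case_nat a x"

lemma seq_dist_summable:
  assumes "\<And>n. x n \<in> {0..1::real}" "\<And>n. y n \<in> {0..1}"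
  shows "(\<lambda>n. \<bar>x n - y n\<bar> / 2 ^ Suc n) summable_on UNIV"
proof (rule norm_summable_imp_summable_on, rule summable_comparison_test')
  show "summable (\<lambda>n. (1 / 2) ^ n :: real)"
    by (rule summable_geometric) simp
  fix n :: nat
  have "\<bar>x n - y n\<bar> \<le> 1"
    using assms(1)[of n] assms(2)[of n] by auto
  then show "norm (norm (\<bar>x n - y n\<bar> / 2 ^ Suc n)) \<le> (1 / 2) ^ n"
    by (simp add: field_simps)
qed

lemma Metric_space_seq_dist:
  assumes "M0 \<subseteq> {0..1}"
  shows "Metric_space (shift_space M0 A) seq_dist"
proof -
  have S: "(\<lambda>n. \<bar>x n - y n\<bar> / 2 ^ Suc n) summable_on UNIV"
    if "x \<in> shift_space M0 A" "y \<in> shift_space M0 A" for x y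
    using that assms by (intro seq_dist_summable) (auto simp: shift_space_def subset_iff)
  show ?thesis
  proof
    show "0 \<le> seq_dist x y" for x y
      unfolding seq_dist_def by (intro infsum_nonneg) auto
  next
    show "seq_dist x y = seq_dist y x" for x y
      by (simp add: seq_dist_def abs_minus_commute)
  next
    fix x y assume xy: "x \<in> shift_space M0 A" "y \<in> shift_space M0 A"
    show "seq_dist x y = 0 \<longleftrightarrow> x = y"
    proof
      assume *: "seq_dist x y = 0"
      show "x = y"
      proof
        fix n
        have "\<bar>x n - y n\<bar> / 2 ^ Suc n = 0"
          using nonneg_infsum_le_0D[OF _ S[OF xy], of n] * by (auto simp: seq_dist_def)
        then show "x n = y n"
          by simp
      qed
    qed (simp add: seq_dist_def)
  next
    fix x y z
    assume x: "x \<in> shift_space M0 A" and y: "y \<in> shift_space M0 A" and z: "z \<in> shift_space M0 A"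
    have "\<bar>x n - z n\<bar> / 2 ^ Suc n \<le> \<bar>x n - y n\<bar> / 2 ^ Suc n + \<bar>y n - z n\<bar> / 2 ^ Suc n" for n
      by (simp add: divide_right_mono flip: add_divide_distrib)
    then have "seq_dist x z \<le> (\<Sum>\<^sub>\<infinity>n. \<bar>x n - y n\<bar> / 2 ^ Suc n + \<bar>y n - z n\<bar> / 2 ^ Suc n)"
      unfolding seq_dist_def by (intro infsum_mono S summable_on_add x y z)
    also have "\<dots> = seq_dist x y + seq_dist y z"
      unfolding seq_dist_def by (intro infsum_add S x y z)
    finally show "seq_dist x z \<le> seq_dist x y + seq_dist y z" .
  qed
qed

definition shift_borel :: "real set \<Rightarrow> (real \<Rightarrow> real \<Rightarrow> nat) \<Rightarrow> (nat \<Rightarrow> real) measure" where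
  "shift_borel M0 A =
     sigma (shift_space M0 A) {U. openin (Metric_space.mtopology (shift_space M0 A) seq_dist) U}"

definition borel_probability ::
    "real set \<Rightarrow> (real \<Rightarrow> real \<Rightarrow> nat) \<Rightarrow> (nat \<Rightarrow> real) measure \<Rightarrow> bool" where
  "borel_probability M0 A \<mu> \<longleftrightarrow> prob_space \<mu> \<and> sets \<mu> = sets (shift_borel M0 A)"

definition shift_invariant :: "(nat \<Rightarrow> real) measure \<Rightarrow> bool" where
  "shift_invariant \<mu> \<longleftrightarrow> shift \<in> measurable \<mu> \<mu> \<and>
     (\<forall>B\<in>sets \<mu>. emeasure \<mu> (shift -` B \<inter> space \<mu>) = emeasure \<mu> B)"

text \<open>
  A function on the set \<open>X\<close> is represented by its extension by \<open>0\<close> to the whole type, so that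
  equality of functions is equality on \<open>X\<close>. The real and the complex Hoelder space are the
  instances of one definition. Points of the shift space are at distance at most \<open>1\<close>, so
  Hoelder functions are bounded and the suprema below are finite.
\<close>

definition holder_space ::
    "(nat \<Rightarrow> real) set \<Rightarrow> real \<Rightarrow> ((nat \<Rightarrow> real) \<Rightarrow> 'v::real_normed_vector) set" where
  "holder_space X \<alpha> = {g. (\<forall>x. x \<notin> X \<longrightarrow> g x = 0) \<and>
     (\<exists>C. \<forall>x\<in>X. \<forall>y\<in>X. norm (g x - g y) \<le> C * seq_dist x y powr \<alpha>)}"

definition holder_norm ::
    "(nat \<Rightarrow> real) set \<Rightarrow> real \<Rightarrow> ((nat \<Rightarrow> real) \<Rightarrow> 'v::real_normed_vector) \<Rightarrow> real" where
  "holder_norm X \<alpha> g = (SUP x\<in>X. norm (g x)) +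
     (SUP (x, y)\<in>{(x, y). x \<in> X \<and> y \<in> X \<and> x \<noteq> y}. norm (g x - g y) / seq_dist x y powr \<alpha>)"

definition ruelle_well_defined ::
    "real set \<Rightarrow> (real \<Rightarrow> real \<Rightarrow> nat) \<Rightarrow> real \<Rightarrow> ((nat \<Rightarrow> real) \<Rightarrow> real) \<Rightarrow> bool" where
  "ruelle_well_defined M0 A \<alpha> \<phi> \<longleftrightarrow>
     (\<forall>\<xi> \<in> holder_space (shift_space M0 A) \<alpha> :: ((nat \<Rightarrow> real) \<Rightarrow> real) set. \<forall>x \<in> shift_space M0 A.
        (\<lambda>a. exp (\<phi> (prepend a x)) * \<xi> (prepend a x)) summable_on {a \<in> M0. A a (x 0) = 1})"

definition ruelle ::
    "real set \<Rightarrow> (real \<Rightarrow> real \<Rightarrow> nat) \<Rightarrow> ((nat \<Rightarrow> real) \<Rightarrow> real) \<Rightarrow>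
      ((nat \<Rightarrow> real) \<Rightarrow> 'v::real_normed_vector) \<Rightarrow> (nat \<Rightarrow> real) \<Rightarrow> 'v" where
  "ruelle M0 A \<phi> \<xi> x =
     (if x \<in> shift_space M0 A
      then \<Sum>\<^sub>\<infinity>a\<in>{a \<in> M0. A a (x 0) = 1}. exp (\<phi> (prepend a x)) *\<^sub>R \<xi> (prepend a x)
      else 0)"

text \<open>
  The relation \<open>L\<^sub>\<phi>\<^sup>* \<mu> = \<nu>\<close> between Borel measures. Integrability is required explicitly because
  the Bochner integral of a non-integrable function is \<open>0\<close>.
\<close>

definition dual_ruelle_rel ::
    "real set \<Rightarrow> (real \<Rightarrow> real \<Rightarrow> nat) \<Rightarrow> real \<Rightarrow> ((nat \<Rightarrow> real) \<Rightarrow> real) \<Rightarrow>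
      (nat \<Rightarrow> real) measure \<Rightarrow> (nat \<Rightarrow> real) measure \<Rightarrow> bool" where
  "dual_ruelle_rel M0 A \<alpha> \<phi> \<mu> \<nu> \<longleftrightarrow>
     (\<forall>\<psi> \<in> holder_space (shift_space M0 A) \<alpha> :: ((nat \<Rightarrow> real) \<Rightarrow> real) set.
        integrable \<nu> \<psi> \<and> integrable \<mu> (ruelle M0 A \<phi> \<psi>) \<and>
        (\<integral>x. \<psi> x \<partial>\<nu>) = (\<integral>x. ruelle M0 A \<phi> \<psi> x \<partial>\<mu>))"

definition normalized_potential ::
    "((nat \<Rightarrow> real) \<Rightarrow> real) \<Rightarrow> real \<Rightarrow> ((nat \<Rightarrow> real) \<Rightarrow> real) \<Rightarrow> (nat \<Rightarrow> real) \<Rightarrow> real" where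
  "normalized_potential \<phi> l f x = \<phi> x + ln (f x) - ln (f (shift x)) - ln l"

definition eigenspace ::
    "real set \<Rightarrow> (real \<Rightarrow> real \<Rightarrow> nat) \<Rightarrow> real \<Rightarrow> ((nat \<Rightarrow> real) \<Rightarrow> real) \<Rightarrow> complex \<Rightarrow>
      ((nat \<Rightarrow> real) \<Rightarrow> complex) set" where
  "eigenspace M0 A \<alpha> \<phi> z =
     {g \<in> holder_space (shift_space M0 A) \<alpha>. ruelle M0 A \<phi> g = (\<lambda>x. z * g x)}"

definition is_eigenvalue ::
    "real set \<Rightarrow> (real \<Rightarrow> real \<Rightarrow> nat) \<Rightarrow> real \<Rightarrow> ((nat \<Rightarrow> real) \<Rightarrow> real) \<Rightarrow> complex \<Rightarrow> bool" where
  "is_eigenvalue M0 A \<alpha> \<phi> z \<longleftrightarrow> (\<exists>g \<in> eigenspace M0 A \<alpha> \<phi> z. g \<noteq> (\<lambda>_. 0))"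

definition simple_eigenvalue ::
    "real set \<Rightarrow> (real \<Rightarrow> real \<Rightarrow> nat) \<Rightarrow> real \<Rightarrow> ((nat \<Rightarrow> real) \<Rightarrow> real) \<Rightarrow> complex \<Rightarrow> bool" where
  "simple_eigenvalue M0 A \<alpha> \<phi> z \<longleftrightarrow>
     (\<exists>g. g \<noteq> (\<lambda>_. 0) \<and> eigenspace M0 A \<alpha> \<phi> z = range (\<lambda>c x. c * g x))"

text \<open>
  The estimate of the norm of \<open>g\<close> by that of \<open>T g\<close> is the boundedness of the inverse of \<open>T = z - L\<^sub>\<phi>\<close>.
\<close>

definition ruelle_resolvent ::
    "real set \<Rightarrow> (real \<Rightarrow> real \<Rightarrow> nat) \<Rightarrow> real \<Rightarrow> ((nat \<Rightarrow> real) \<Rightarrow> real) \<Rightarrow> complex set" where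
  "ruelle_resolvent M0 A \<alpha> \<phi> =
     {z. let X = shift_space M0 A;
             H = holder_space X \<alpha> :: ((nat \<Rightarrow> real) \<Rightarrow> complex) set;
             T = (\<lambda>g x. z * g x - ruelle M0 A \<phi> g x)
         in bij_betw T H H \<and> (\<exists>C. \<forall>g\<in>H. holder_norm X \<alpha> g \<le> C * holder_norm X \<alpha> (T g))}"

definition ruelle_spectrum ::
    "real set \<Rightarrow> (real \<Rightarrow> real \<Rightarrow> nat) \<Rightarrow> real \<Rightarrow> ((nat \<Rightarrow> real) \<Rightarrow> real) \<Rightarrow> complex set" where
  "ruelle_spectrum M0 A \<alpha> \<phi> = - ruelle_resolvent M0 A \<alpha> \<phi>"

end

theory Submission
  imports Defs
begin

text \<open>
The shift space \<open>X\<close> is not compact, but two facts take the place of compactness: the weights \<open>p\<close> are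
summable, and, the columns of \<open>A\<close> being eventually constant, the set of symbols that may precede a point
\<open>x\<close> takes only finitely many values. The latter splits \<open>X\<close> into finitely many types. The preimages
of two points of the same type come in pairs \<open>a x, a y\<close> at half the distance, while points of
different types are a definite distance apart. So everything can be done with the cone of nonnegative functions
with \<open>h x \<le> exp (B * d(x,y)^\<alpha>) * h y\<close> for \<open>x, y\<close> of the same type: for a suitable \<open>B\<close> the Ruelle
operator \<open>L\<close> maps it into the narrower cone with \<open>B - 1\<close> (\<open>L_cone\<close>), and its differences are exactly the
Hoelder functions, with an equivalent norm (\<open>holder_imp_cbound\<close>, \<open>cbound_imp_holder\<close>).

Irreducibility yields a finite set \<open>S\<close> of path lengths that connect any two types; it is a singleton
when \<open>A\<close> is aperiodic. The operator \<open>Q\<close>, the sum of \<open>L^k\<close> over \<open>k \<in> S\<close>, narrows the cone and in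
addition produces functions whose values at any two points are comparable (\<open>cone_contraction_Q\<close>). For
such an operator Birkhoff's contraction principle is elementary: if \<open>a g \<le> h \<le> b g\<close> in the order of the
cone, then \<open>a' Q g \<le> Q h \<le> b' Q g\<close> with \<open>b' - a'\<close> smaller than \<open>b - a\<close> by a fixed factor
(\<open>pinched_step\<close>), since at a given point one of \<open>Q h - a Q g\<close> and \<open>b Q g - Q h\<close> is at least half of their sum. So
ratios \<open>Q^n h / Q^n g\<close> converge exponentially fast to constants. For \<open>h = Q 1\<close>, \<open>g = 1\<close> this gives a
positive eigenfunction \<open>f\<close> (\<open>eigenfunction\<close>), and for \<open>g = f\<close> it gives a number \<open>c h\<close> such that
\<open>Q^n h\<close> is \<open>c h * W^n * f\<close> up to an error \<open>O(r^n W^n)\<close> in the Hoelder norm, with \<open>W\<close> the eigenvalue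
of \<open>Q\<close> and \<open>r < 1\<close> (\<open>spectral_gap\<close>). As \<open>L\<close> commutes with \<open>Q\<close>, it has the same eigenfunction,
\<open>L f = l f\<close>, and \<open>c (L h) = l * c h\<close> (\<open>spectral_data\<close>, \<open>c_L\<close>). Any eigenfunction for \<open>l\<close> is its own
limit, hence a multiple of \<open>f\<close>, and \<open>f\<close> dominates all Hoelder functions, which bounds every eigenvalue by \<open>l\<close>.
In the aperiodic case the estimate holds for the powers of \<open>L\<close> itself, and the resolvent
is given by the functional \<open>c\<close> and a geometric series (\<open>resolvent_solves\<close>).

The functional \<open>c\<close> is linear and positive with \<open>c 1 = 1\<close>, and it is integration against the measure
\<open>\<rho>\<close> of part (2). The measure must be shown not to lose mass at infinity: \<open>c\<close> of the
set where the \<open>i\<close>-th symbol has index at least \<open>n\<close> tends to \<open>0\<close>, by the eigenvalue equation for \<open>c\<close>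
and the summability of \<open>p\<close> (\<open>tail_limit\<close>). Therefore the values of \<open>c\<close> on cylinders are consistent
probability distributions on words, Kolmogorov's theorem extends them to a measure on sequences, and this
measure represents \<open>c\<close> on all Hoelder functions because these are approximated by combinations of finitely many
cylinders (\<open>functional_eq_c\<close>). The measure \<open>\<mu>\<close> is \<open>f \<rho>\<close>. If \<open>\<nu>\<close> is another fixed point of the
normalized dual operator, then \<open>h \<mapsto> \<integral> h / f d\<nu>\<close> is a positive functional with the same eigenvalue
equation as \<open>c\<close>, hence a multiple of \<open>c\<close> (\<open>eigenfunctional_eq_c\<close>).
\<close>

section \<open>Cones of locally Hoelder functions\<close>

text \<open>
Functions on \<open>X\<close> are extended by \<open>0\<close>, as in the definition of Hoelder spaces, so that identities
between them are identities of functions on the whole type.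
\<close>

definition bounded_on :: "'a set \<Rightarrow> ('a \<Rightarrow> real) set" where
  "bounded_on X = {h. (\<forall>x. x \<notin> X \<longrightarrow> h x = 0) \<and> (\<exists>C. \<forall>x\<in>X. \<bar>h x\<bar> \<le> C)}"

text \<open>
The condition says that \<open>ln h\<close> is Lipschitz with constant \<open>B\<close> within each type \<open>ty\<close>, with the value
\<open>0\<close> allowed. In the application \<open>D\<close> is the \<open>\<alpha>\<close>-th power of the distance, hence need not satisfy a triangle
inequality.
\<close>

definition holder_cone :: "'a set \<Rightarrow> ('a \<Rightarrow> 't) \<Rightarrow> ('a \<Rightarrow> 'a \<Rightarrow> real) \<Rightarrow> real \<Rightarrow> ('a \<Rightarrow> real) set" where
  "holder_cone X ty D B = {h. (\<forall>x. x \<notin> X \<longrightarrow> h x = 0) \<and> (\<forall>x\<in>X. 0 \<le> h x) \<and>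
     (\<forall>x\<in>X. \<forall>y\<in>X. ty x = ty y \<longrightarrow> h x \<le> exp (B * D x y) * h y)}"

text \<open>
The infimum of such \<open>\<epsilon>\<close> is a norm on the span of the cone. It turns out to be equivalent to the Hoelder norm, and
it is the norm in which positive operators are easy to estimate.
\<close>

definition cone_bound :: "'a set \<Rightarrow> ('a \<Rightarrow> 't) \<Rightarrow> ('a \<Rightarrow> 'a \<Rightarrow> real) \<Rightarrow> real \<Rightarrow> ('a \<Rightarrow> real) \<Rightarrow> real \<Rightarrow> bool" where
  "cone_bound X ty D B h \<epsilon> \<longleftrightarrow> (\<exists>u\<in>holder_cone X ty D B. \<exists>v\<in>holder_cone X ty D B.
     h = (\<lambda>x. u x - v x) \<and> (\<forall>x\<in>X. u x \<le> \<epsilon> \<and> v x \<le> \<epsilon>))"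

lemma bounded_on_add:
  assumes "f \<in> bounded_on X" "g \<in> bounded_on X"
  shows "(\<lambda>x. f x + g x) \<in> bounded_on X"
proof -
  from assms obtain C C' where "\<forall>x\<in>X. \<bar>f x\<bar> \<le> C" "\<forall>x\<in>X. \<bar>g x\<bar> \<le> C'"
    by (auto simp: bounded_on_def)
  then have "\<forall>x\<in>X. \<bar>f x + g x\<bar> \<le> C + C'"
    by (meson abs_triangle_ineq add_mono order_trans)
  with assms show ?thesis
    by (auto simp: bounded_on_def)
qed

lemma bounded_on_scale:
  assumes "f \<in> bounded_on X"
  shows "(\<lambda>x. k * f x) \<in> bounded_on X"
proof -
  from assms obtain C where "\<forall>x\<in>X. \<bar>f x\<bar> \<le> C"
    by (auto simp: bounded_on_def)
  then have "\<forall>x\<in>X. \<bar>k * f x\<bar> \<le> \<bar>k\<bar> * C"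
    by (simp add: abs_mult mult_left_mono)
  with assms show ?thesis
    by (auto simp: bounded_on_def)
qed

lemma bounded_on_diff:
  assumes "f \<in> bounded_on X" "g \<in> bounded_on X"
  shows "(\<lambda>x. f x - g x) \<in> bounded_on X"
  using bounded_on_add[OF assms(1) bounded_on_scale[OF assms(2), of "-1"]] by simp

lemma bounded_on_indicator: "indicat_real X \<in> bounded_on X"
  by (auto simp: bounded_on_def indicator_def intro: exI[of _ 1])

lemma holder_coneD:
  assumes "h \<in> holder_cone X ty D B"
  shows "x \<notin> X \<Longrightarrow> h x = 0" "x \<in> X \<Longrightarrow> 0 \<le> h x"
    "x \<in> X \<Longrightarrow> y \<in> X \<Longrightarrow> ty x = ty y \<Longrightarrow> h x \<le> exp (B * D x y) * h y"
  using assms by (auto simp: holder_cone_def)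

lemma holder_cone_add:
  assumes "f \<in> holder_cone X ty D B" "g \<in> holder_cone X ty D B"
  shows "(\<lambda>x. f x + g x) \<in> holder_cone X ty D B"
proof -
  have "f x + g x \<le> exp (B * D x y) * (f y + g y)" if "x \<in> X" "y \<in> X" "ty x = ty y" for x y
    using add_mono[OF holder_coneD(3)[OF assms(1) that] holder_coneD(3)[OF assms(2) that]]
    by (simp add: distrib_left)
  with assms show ?thesis
    by (auto simp: holder_cone_def)
qed

lemma holder_cone_scale:
  assumes "f \<in> holder_cone X ty D B" "0 \<le> k"
  shows "(\<lambda>x. k * f x) \<in> holder_cone X ty D B"
proof -
  have "k * f x \<le> exp (B * D x y) * (k * f y)" if "x \<in> X" "y \<in> X" "ty x = ty y" for x y
    using mult_left_mono[OF holder_coneD(3)[OF assms(1) that] assms(2)] by (simp add: mult_ac)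
  with assms show ?thesis
    by (auto simp: holder_cone_def)
qed

lemma holder_cone_sum:
  assumes "finite S" "\<And>k. k \<in> S \<Longrightarrow> f k \<in> holder_cone X ty D B"
  shows "(\<lambda>x. \<Sum>k\<in>S. f k x) \<in> holder_cone X ty D B"
  using assms
proof (induction S rule: finite_induct)
  case (insert s S)
  then show ?case
    using holder_cone_add[of "f s" X ty D B "\<lambda>x. \<Sum>k\<in>S. f k x"] by simp
qed (auto simp: holder_cone_def)

text \<open>
Finitely many types suffice to bound a function of the cone globally, in spite of the cone
condition being local.
\<close>

locale type_space =
  fixes X :: "'a set" and ty :: "'a \<Rightarrow> 't" and D :: "'a \<Rightarrow> 'a \<Rightarrow> real" and B :: real
  assumes nonempty: "X \<noteq> {}"
    and D_nonneg: "\<And>x y. x \<in> X \<Longrightarrow> y \<in> X \<Longrightarrow> 0 \<le> D x y"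
    and D_le_1: "\<And>x y. x \<in> X \<Longrightarrow> y \<in> X \<Longrightarrow> D x y \<le> 1"
    and D_sym: "\<And>x y. x \<in> X \<Longrightarrow> y \<in> X \<Longrightarrow> D x y = D y x"
    and finite_types: "finite (ty ` X)"
    and B_ge_1: "1 \<le> B"
begin

abbreviation "hcone \<equiv> holder_cone X ty D"
abbreviation "cbound \<equiv> cone_bound X ty D B"

lemma cone_indicator: "0 \<le> b \<Longrightarrow> indicat_real X \<in> hcone b"
  using D_nonneg by (auto simp: holder_cone_def indicator_def)

lemma cone_mono:
  assumes "h \<in> hcone b" "b \<le> b'"
  shows "h \<in> hcone b'"
proof -
  have "h x \<le> exp (b' * D x y) * h y" if xy: "x \<in> X" "y \<in> X" "ty x = ty y" for x y
  proof -
    have "h x \<le> exp (b * D x y) * h y"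
      using holder_coneD(3)[OF assms(1) xy] .
    also have "\<dots> \<le> exp (b' * D x y) * h y"
      using assms D_nonneg[OF xy(1,2)] xy(2) by (intro mult_right_mono) (auto simp: holder_cone_def mult_right_mono)
    finally show ?thesis .
  qed
  with assms show ?thesis
    by (auto simp: holder_cone_def)
qed

lemma cone_le_same_type:
  assumes "h \<in> hcone b" "0 \<le> b" "x \<in> X" "y \<in> X" "ty x = ty y"
  shows "h x \<le> exp b * h y"
proof -
  have "h x \<le> exp (b * D x y) * h y"
    using holder_coneD(3)[OF assms(1,3-5)] .
  also have "\<dots> \<le> exp b * h y"
    using assms D_le_1[OF assms(3,4)] by (intro mult_right_mono) (auto simp: holder_cone_def mult_left_le)
  finally show ?thesis .
qed

text \<open>
A function of the cone varies by at most the factor \<open>exp b\<close> within a type, so its maximum over a set of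
representatives of the types bounds it everywhere.
\<close>

lemma cone_bounded_by_representatives:
  assumes h: "h \<in> hcone b" "0 \<le> b"
    and Z: "finite Z" "Z \<subseteq> X" "\<And>x. x \<in> X \<Longrightarrow> \<exists>z\<in>Z. ty z = ty x"
  obtains z where "z \<in> Z" "\<And>x. x \<in> X \<Longrightarrow> h x \<le> exp b * h z"
proof -
  have "Z \<noteq> {}"
    using nonempty Z(3) by auto
  then have "Max (h ` Z) \<in> h ` Z"
    using Z(1) by (intro Max_in) auto
  then obtain z where "z \<in> Z" "h z = Max (h ` Z)"
    by auto
  then have z: "z \<in> Z" "\<forall>y\<in>Z. h y \<le> h z"
    using Z(1) by auto
  have "h x \<le> exp b * h z" if x: "x \<in> X" for x
  proof -
    obtain y where y: "y \<in> Z" "ty y = ty x"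
      using Z(3) x by blast
    then have "h x \<le> exp b * h y"
      using cone_le_same_type[OF h x] Z(2) by auto
    also have "\<dots> \<le> exp b * h z"
      using y z by simp
    finally show ?thesis .
  qed
  with z that show ?thesis by blast
qed

lemma cone_bounded:
  assumes "h \<in> hcone b"
  shows "h \<in> bounded_on X"
proof -
  define Z where "Z = (\<lambda>t. SOME x. x \<in> X \<and> ty x = t) ` ty ` X"
  have *: "(SOME y. y \<in> X \<and> ty y = ty x) \<in> X \<and> ty (SOME y. y \<in> X \<and> ty y = ty x) = ty x" if "x \<in> X" for x
    by (rule someI[of "\<lambda>y. y \<in> X \<and> ty y = ty x" x]) (use that in auto)
  have "h \<in> hcone (max b 0)"
    by (rule cone_mono[OF assms]) simp
  then obtain z where "\<And>x. x \<in> X \<Longrightarrow> h x \<le> exp (max b 0) * h z"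
    by (rule cone_bounded_by_representatives[of _ _ Z])
      (use finite_types * in \<open>auto simp: Z_def\<close>)
  with assms show ?thesis
    by (auto simp: bounded_on_def holder_cone_def intro!: exI[of _ "exp (max b 0) * h z"])
qed

lemma cbound_bounded: "cbound h \<epsilon> \<Longrightarrow> h \<in> bounded_on X"
  unfolding cone_bound_def using bounded_on_diff cone_bounded by blast

lemma cbound_abs:
  assumes "cbound h \<epsilon>" "x \<in> X"
  shows "\<bar>h x\<bar> \<le> \<epsilon>"
proof -
  from assms(1) obtain u v where "u \<in> hcone B" "v \<in> hcone B"
    "h = (\<lambda>x. u x - v x)" "\<forall>x\<in>X. u x \<le> \<epsilon> \<and> v x \<le> \<epsilon>"
    unfolding cone_bound_def by blast
  then show ?thesis
    using assms(2) holder_coneD(2)[of u X ty D B x] holder_coneD(2)[of v X ty D B x] by (fastforce simp: abs_le_iff)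
qed

lemma cbound_nonneg: "cbound h \<epsilon> \<Longrightarrow> 0 \<le> \<epsilon>"
  using cbound_abs nonempty by (metis abs_ge_zero all_not_in_conv order_trans)

lemma cbound_mono: "cbound h \<epsilon> \<Longrightarrow> \<epsilon> \<le> \<epsilon>' \<Longrightarrow> cbound h \<epsilon>'"
  unfolding cone_bound_def by (meson order_trans)

lemma cbound_cone:
  assumes "h \<in> hcone B" "\<And>x. x \<in> X \<Longrightarrow> h x \<le> \<epsilon>"
  shows "cbound h \<epsilon>"
proof -
  have "(\<lambda>_. 0) \<in> hcone B"
    by (auto simp: holder_cone_def)
  with assms show ?thesis
    unfolding cone_bound_def by (intro bexI[of _ h] bexI[of _ "\<lambda>_. 0"]) (auto intro: order_trans[OF holder_coneD(2)])
qed

lemma cbound_add: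
  assumes "cbound g \<epsilon>" "cbound h \<epsilon>'"
  shows "cbound (\<lambda>x. g x + h x) (\<epsilon> + \<epsilon>')"
proof -
  from assms obtain u v u' v' where uv: "u \<in> hcone B" "v \<in> hcone B" "u' \<in> hcone B" "v' \<in> hcone B"
    "g = (\<lambda>x. u x - v x)" "h = (\<lambda>x. u' x - v' x)"
    "\<forall>x\<in>X. u x \<le> \<epsilon> \<and> v x \<le> \<epsilon>" "\<forall>x\<in>X. u' x \<le> \<epsilon>' \<and> v' x \<le> \<epsilon>'"
    unfolding cone_bound_def by blast
  show ?thesis
    unfolding cone_bound_def
    by (intro bexI[OF _ holder_cone_add[OF uv(1,3)]] bexI[OF _ holder_cone_add[OF uv(2,4)]])
      (use uv in \<open>auto intro: add_mono\<close>)
qed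

lemma cbound_scale:
  assumes "cbound h \<epsilon>"
  shows "cbound (\<lambda>x. k * h x) (\<bar>k\<bar> * \<epsilon>)"
proof -
  from assms obtain u v where uv: "u \<in> hcone B" "v \<in> hcone B"
    "h = (\<lambda>x. u x - v x)" "\<forall>x\<in>X. u x \<le> \<epsilon> \<and> v x \<le> \<epsilon>"
    unfolding cone_bound_def by blast
  have u: "(\<lambda>x. \<bar>k\<bar> * u x) \<in> hcone B" and v: "(\<lambda>x. \<bar>k\<bar> * v x) \<in> hcone B"
    using uv by (auto intro: holder_cone_scale)
  have le: "\<bar>k\<bar> * u x \<le> \<bar>k\<bar> * \<epsilon> \<and> \<bar>k\<bar> * v x \<le> \<bar>k\<bar> * \<epsilon>" if "x \<in> X" for x
    using uv(4) that by (simp add: mult_left_mono)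
  show ?thesis
  proof (cases "0 \<le> k")
    case True
    then have "(\<lambda>x. k * h x) = (\<lambda>x. \<bar>k\<bar> * u x - \<bar>k\<bar> * v x)"
      by (simp add: uv(3) right_diff_distrib)
    with le show ?thesis
      unfolding cone_bound_def by (intro bexI[OF _ u] bexI[OF _ v]) simp
  next
    case False
    then have "(\<lambda>x. k * h x) = (\<lambda>x. \<bar>k\<bar> * v x - \<bar>k\<bar> * u x)"
      by (simp add: uv(3) right_diff_distrib)
    with le show ?thesis
      unfolding cone_bound_def by (intro bexI[OF _ v] bexI[OF _ u]) simp
  qed
qed

text \<open>
The largest multiple of one function of the narrow cone that may be subtracted from a comparable one without
leaving the wide cone; its value comes from \<open>margin_estimate\<close>.
\<close>

definition margin :: real where "margin = 1 / ((2 * B - 1) * exp (2 * B - 1))"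

lemma margin_pos: "0 < margin" and margin_le_1: "margin \<le> 1"
proof -
  have "1 \<le> (2 * B - 1) * exp (2 * B - 1)"
    using B_ge_1 one_le_exp_iff[of "2 * B - 1"] mult_mono[of 1 "2 * B - 1" 1 "exp (2 * B - 1)"] by simp
  then show "0 < margin" "margin \<le> 1"
    by (auto simp: margin_def)
qed

text \<open>
The two differences of exponentials vanish at \<open>d = 0\<close>, with slopes \<open>2 B - 1\<close> and \<open>1\<close>. The exponential
factor in \<open>margin\<close> accounts for the convexity of the exponential function on \<open>{0..1}\<close>.
\<close>

lemma margin_estimate:
  assumes "0 \<le> d" "d \<le> 1"
  shows "margin * (exp (B * d) - exp (- ((B - 1) * d))) \<le> exp (B * d) - exp ((B - 1) * d)"
proof -
  define m where "m = 2 * B - 1"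
  have m: "1 \<le> m"
    using B_ge_1 by (simp add: m_def)
  have "exp (m * d) - 1 \<le> m * d * exp (m * d)"
  proof -
    \<comment> \<open>Convexity in the form \<open>exp t - 1 \<le> t * exp t\<close>.\<close>
    have "1 - m * d \<le> exp (- (m * d))"
      using exp_ge_add_one_self[of "- (m * d)"] by simp
    then have "exp (m * d) * (1 - m * d) \<le> exp (m * d) * exp (- (m * d))"
      by (intro mult_left_mono) auto
    also have "\<dots> = 1"
      by (simp flip: exp_add)
    finally show ?thesis
      by (simp add: algebra_simps)
  qed
  also have "\<dots> \<le> m * d * exp m"
    using m assms by (intro mult_left_mono) (auto simp: mult_left_le)
  finally have "exp (m * d) - 1 \<le> d * (m * exp m)"
    by (simp add: mult_ac)
  then have 1: "margin * (exp (m * d) - 1) \<le> d"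
    using m by (simp add: margin_def m_def[symmetric] pos_divide_le_eq)
  have "exp (B * d) - exp (- ((B - 1) * d)) = exp (- ((B - 1) * d)) * (exp (m * d) - 1)"
    by (simp add: algebra_simps m_def flip: exp_add)
  also have "\<dots> \<le> 1 * (exp (m * d) - 1)"
    using m assms B_ge_1 by (intro mult_right_mono) auto
  finally have "margin * (exp (B * d) - exp (- ((B - 1) * d))) \<le> margin * (exp (m * d) - 1)"
    using margin_pos by simp
  also note 1
  also have "d \<le> exp d - 1"
    using exp_ge_add_one_self[of d] by linarith
  also have "\<dots> = 1 * (exp d - 1)"
    by simp
  also have "\<dots> \<le> exp ((B - 1) * d) * (exp d - 1)"
    using B_ge_1 assms by (intro mult_right_mono) auto
  also have "\<dots> = exp (B * d) - exp ((B - 1) * d)"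
    by (simp add: algebra_simps flip: exp_add)
  finally show ?thesis by simp
qed

text \<open>
Functions in the cone with constant \<open>B - 1\<close> are interior to the cone with constant \<open>B\<close>: the slack
between the two exponentials pays for the subtraction.
\<close>

lemma cone_subtract:
  assumes u: "u \<in> hcone (B - 1)" and g: "g \<in> hcone (B - 1)" and s: "0 \<le> s"
    and le: "\<And>x. x \<in> X \<Longrightarrow> s * g x \<le> margin * u x"
  shows "(\<lambda>x. u x - s * g x) \<in> hcone B"
proof -
  have "u x - s * g x \<le> exp (B * D x y) * (u y - s * g y)"
    if xy: "x \<in> X" "y \<in> X" "ty x = ty y" for x y
  proof -
    define d where "d = D x y"
    have d: "0 \<le> d" "d \<le> 1" "D y x = d"
      using D_nonneg[OF xy(1,2)] D_le_1[OF xy(1,2)] D_sym[OF xy(1,2)] by (auto simp: d_def)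
    have gy: "exp (- ((B - 1) * d)) * g y \<le> g x"
    proof -
      have "exp (- ((B - 1) * d)) * g y \<le> exp (- ((B - 1) * d)) * (exp ((B - 1) * d) * g x)"
        using holder_coneD(3)[OF g xy(2,1)] xy(3) d by (intro mult_left_mono) auto
      then show ?thesis
        by (simp add: mult.assoc[symmetric] flip: exp_add)
    qed
    have "exp (B * d) * (s * g y) - s * g x \<le> exp (B * d) * (s * g y) - s * (exp (- ((B - 1) * d)) * g y)"
      using mult_left_mono[OF gy s] by simp
    also have "\<dots> = (exp (B * d) - exp (- ((B - 1) * d))) * (s * g y)"
      by (simp add: algebra_simps)
    also have "\<dots> \<le> (exp (B * d) - exp (- ((B - 1) * d))) * (margin * u y)"
    proof (rule mult_left_mono[OF le[OF xy(2)]])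
      have "- ((B - 1) * d) \<le> 0" "0 \<le> B * d"
        using B_ge_1 d by auto
      then show "0 \<le> exp (B * d) - exp (- ((B - 1) * d))"
        by simp
    qed
    also have "\<dots> = margin * (exp (B * d) - exp (- ((B - 1) * d))) * u y"
      by (simp add: algebra_simps)
    also have "\<dots> \<le> (exp (B * d) - exp ((B - 1) * d)) * u y"
      by (intro mult_right_mono margin_estimate d holder_coneD(2)[OF u] xy)
    also have "\<dots> \<le> exp (B * d) * u y - u x"
      using holder_coneD(3)[OF u xy] by (simp add: algebra_simps d_def)
    finally show ?thesis
      by (simp add: algebra_simps d_def)
  qed
  moreover have "0 \<le> u x - s * g x" if "x \<in> X" for x
    using le[OF that] mult_right_mono[OF margin_le_1 holder_coneD(2)[OF u that]] by simp
  ultimately show ?thesis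
    using u g by (auto simp: holder_cone_def)
qed

end

section \<open>Contraction of ratios under a positive operator\<close>

text \<open>
An operator \<open>Q\<close> that improves the constant of the cone by \<open>1\<close> and makes values at points of different
types comparable. Together these properties imply that the image of the cone has finite diameter in Hilbert's
projective metric, which is what Birkhoff's contraction theorem asks for.
\<close>

locale cone_contraction = type_space X ty D B
  for X :: "'a set" and ty :: "'a \<Rightarrow> 't" and D B +
  fixes Q :: "('a \<Rightarrow> real) \<Rightarrow> 'a \<Rightarrow> real" and K :: real
  assumes K_ge_1: "1 \<le> K"
    and Q_add: "\<And>f g. f \<in> bounded_on X \<Longrightarrow> g \<in> bounded_on X \<Longrightarrow> Q (\<lambda>x. f x + g x) = (\<lambda>x. Q f x + Q g x)"
    and Q_scale: "\<And>f k. f \<in> bounded_on X \<Longrightarrow> Q (\<lambda>x. k * f x) = (\<lambda>x. k * Q f x)"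
    and Q_bounded: "\<And>f. f \<in> bounded_on X \<Longrightarrow> Q f \<in> bounded_on X"
    and Q_nonneg: "\<And>f x. f \<in> bounded_on X \<Longrightarrow> (\<And>y. y \<in> X \<Longrightarrow> 0 \<le> f y) \<Longrightarrow> x \<in> X \<Longrightarrow> 0 \<le> Q f x"
    and Q_cone: "\<And>h. h \<in> holder_cone X ty D B \<Longrightarrow> Q h \<in> holder_cone X ty D (B - 1)"
    and Q_comparable: "\<And>h x y. h \<in> holder_cone X ty D B \<Longrightarrow> x \<in> X \<Longrightarrow> y \<in> X \<Longrightarrow> Q h x \<le> K * Q h y"
    and Q_pos: "\<And>x. x \<in> X \<Longrightarrow> 0 < Q (indicat_real X) x"
begin

lemma Q_diff: "f \<in> bounded_on X \<Longrightarrow> g \<in> bounded_on X \<Longrightarrow> Q (\<lambda>x. f x - k * g x) = (\<lambda>x. Q f x - k * Q g x)"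
  using Q_add[of f "\<lambda>x. (-k) * g x"] Q_scale[of g "-k"] bounded_on_scale[of g X "-k"] by simp

lemma Q_mono:
  assumes "f \<in> bounded_on X" "g \<in> bounded_on X" "\<And>y. y \<in> X \<Longrightarrow> f y \<le> g y" "x \<in> X"
  shows "Q f x \<le> Q g x"
  using Q_nonneg[of "\<lambda>x. g x - 1 * f x" x] assms Q_diff[of g f 1]
    bounded_on_diff[of g X f] by simp

lemma Q_cone': "h \<in> hcone B \<Longrightarrow> Q h \<in> hcone B"
  using Q_cone cone_mono by fastforce

lemma iter_cone: "h \<in> hcone B \<Longrightarrow> (Q ^^ n) h \<in> hcone B"
  by (induction n) (auto intro: Q_cone')

lemma iter_bounded: "h \<in> bounded_on X \<Longrightarrow> (Q ^^ n) h \<in> bounded_on X"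
  by (induction n) (auto intro: Q_bounded)

lemma iter_diff:
  "f \<in> bounded_on X \<Longrightarrow> g \<in> bounded_on X \<Longrightarrow>
    (Q ^^ n) (\<lambda>x. f x - k * g x) = (\<lambda>x. (Q ^^ n) f x - k * (Q ^^ n) g x)"
  by (induction n) (auto simp: Q_diff iter_bounded)

text \<open>
The factor \<open>K^2\<close> is lost when a comparison of two functions at one point is carried over to all points, and
the factor \<open>2\<close> by taking the larger of two summands.
\<close>

definition rate :: real where "rate = 1 - margin / (2 * K\<^sup>2)"

lemma rate: "0 \<le> rate" "rate < 1" "0 < rate"
proof -
  have "1 \<le> K\<^sup>2"
    using K_ge_1 by (simp add: one_le_power)
  then have "margin / (2 * K\<^sup>2) \<le> 1 / 2"
    using margin_pos margin_le_1 by (intro frac_le) auto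
  then show "0 \<le> rate" "rate < 1" "0 < rate"
    using margin_pos K_ge_1 by (auto simp: rate_def)
qed

lemma pinch_one_side:
  assumes u: "u \<in> hcone B" and g: "g \<in> hcone B" and t: "0 \<le> t" and x0: "x0 \<in> X"
    and le: "t / 2 * Q g x0 \<le> Q u x0"
  shows "(\<lambda>x. Q u x - (1 - rate) * t * Q g x) \<in> hcone B"
proof (rule cone_subtract)
  show "Q u \<in> hcone (B - 1)" "Q g \<in> hcone (B - 1)"
    using u g Q_cone by auto
  show "0 \<le> (1 - rate) * t"
    using rate t by simp
  fix x assume x: "x \<in> X"
  have "(1 - rate) * t * Q g x \<le> (1 - rate) * t * (K * Q g x0)"
    using Q_comparable[OF g x x0] rate t by (intro mult_left_mono) auto
  also have "\<dots> = margin / K * (t / 2 * Q g x0)"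
    using K_ge_1 by (simp add: rate_def power2_eq_square)
  also have "\<dots> \<le> margin / K * Q u x0"
    using le margin_pos K_ge_1 by (intro mult_left_mono) auto
  also have "\<dots> \<le> margin / K * (K * Q u x)"
    using Q_comparable[OF u x0 x] margin_pos K_ge_1 by (intro mult_left_mono) auto
  also have "\<dots> = margin * Q u x"
    using K_ge_1 by simp
  finally show "(1 - rate) * t * Q g x \<le> margin * Q u x" .
qed

text \<open>
Bounds on the ratio \<open>h / g\<close> in the order defined by the cone rather than pointwise; only
such bounds can be iterated.
\<close>

definition pinched :: "('a \<Rightarrow> real) \<Rightarrow> ('a \<Rightarrow> real) \<Rightarrow> real \<Rightarrow> real \<Rightarrow> bool" where
  "pinched h g a b \<longleftrightarrow> a \<le> b \<and> (\<lambda>x. h x - a * g x) \<in> hcone B \<and> (\<lambda>x. b * g x - h x) \<in> hcone B"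

text \<open>
Birkhoff's contraction: \<open>h - a g\<close> and \<open>b g - h\<close> add up to \<open>(b - a) g\<close>, so at a given point one
of their images carries at least half of \<open>(b - a) Q g\<close>. By comparability it dominates a
multiple of \<open>Q g\<close> everywhere, and the bound on that side can be improved.
\<close>

lemma pinched_step:
  assumes h: "h \<in> hcone B" and g: "g \<in> hcone B" and p: "pinched h g a b"
  shows "\<exists>a' b'. pinched (Q h) (Q g) a' b' \<and> a \<le> a' \<and> b' \<le> b \<and> b' - a' \<le> rate * (b - a)"
proof -
  define u where "u = (\<lambda>x. h x - a * g x)"
  define v where "v = (\<lambda>x. b * g x - h x)"
  have u: "u \<in> hcone B" and v: "v \<in> hcone B" and ab: "a \<le> b"
    using p by (auto simp: pinched_def u_def v_def)
  have hb: "h \<in> bounded_on X" and gb: "g \<in> bounded_on X" "(\<lambda>x. b * g x) \<in> bounded_on X"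
    using cone_bounded[OF h] cone_bounded[OF g] bounded_on_scale[OF cone_bounded[OF g]] by auto
  have Qu: "Q u = (\<lambda>x. Q h x - a * Q g x)"
    unfolding u_def by (rule Q_diff[OF hb gb(1)])
  have Qv: "Q v = (\<lambda>x. b * Q g x - Q h x)"
    using Q_diff[OF gb(2) hb, of 1] Q_scale[OF gb(1), of b] by (simp add: v_def)
  obtain x0 where x0: "x0 \<in> X"
    using nonempty by blast
  have r: "(1 - rate) * (b - a) \<le> b - a"
    using mult_nonneg_nonneg[OF rate(1), of "b - a"] ab by (simp add: left_diff_distrib)
  have rr: "0 \<le> (1 - rate) * (b - a)" "(1 - rate) * (b - a) = (b - a) - rate * (b - a)"
    using mult_nonneg_nonneg[of "1 - rate" "b - a"] ab rate by (simp_all only: left_diff_distrib) simp_all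
  have "Q u x0 + Q v x0 = (b - a) * Q g x0"
    by (simp add: Qu Qv algebra_simps)
  then consider "(b - a) / 2 * Q g x0 \<le> Q u x0" | "(b - a) / 2 * Q g x0 \<le> Q v x0"
    unfolding times_divide_eq_left by linarith
  then show ?thesis
  proof cases
    case 1
    have "(\<lambda>x. Q h x - (a + (1 - rate) * (b - a)) * Q g x) \<in> hcone B"
      using pinch_one_side[OF u g _ x0 1] ab by (simp add: Qu left_diff_distrib distrib_right diff_diff_eq)
    with Q_cone'[OF v] r ab have "pinched (Q h) (Q g) (a + (1 - rate) * (b - a)) b"
      by (simp add: pinched_def Qv)
    moreover have "0 \<le> (1 - rate) * (b - a)" "b - (a + (1 - rate) * (b - a)) \<le> rate * (b - a)"
      using rr by linarith+
    ultimately show ?thesis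
      by (metis le_add_same_cancel1 order_refl)
  next
    case 2
    have *: "(\<lambda>x. (b - (1 - rate) * (b - a)) * Q g x - Q h x) = (\<lambda>x. Q v x - (1 - rate) * (b - a) * Q g x)"
      by (intro ext) (simp add: Qv algebra_simps)
    have "(\<lambda>x. (b - (1 - rate) * (b - a)) * Q g x - Q h x) \<in> hcone B"
      unfolding * using pinch_one_side[OF v g _ x0 2] ab by simp
    with Q_cone'[OF u] r ab have "pinched (Q h) (Q g) a (b - (1 - rate) * (b - a))"
      by (simp add: pinched_def Qu)
    moreover have "b - (1 - rate) * (b - a) \<le> b" "b - (1 - rate) * (b - a) - a \<le> rate * (b - a)"
      using rr by linarith+
    ultimately show ?thesis
      by (metis order_refl)
  qed
qed

text \<open>
The nested intervals of \<open>pinched_step\<close> shrink to a point \<open>c\<close>. The error is exhibited as a difference of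
two functions of the cone, not merely bounded pointwise, so that the convergence also holds in
the norm of the cone.
\<close>

lemma ratio_converges:
  assumes h: "h \<in> hcone B" and g: "g \<in> hcone B" and b0: "0 \<le> b0" "(\<lambda>x. b0 * g x - h x) \<in> hcone B"
  obtains c where "0 \<le> c" "c \<le> b0"
    "\<And>n. \<exists>u\<in>hcone B. \<exists>v\<in>hcone B. (\<lambda>x. (Q ^^ n) h x - c * (Q ^^ n) g x) = (\<lambda>x. u x - v x) \<and>
      (\<forall>x\<in>X. u x \<le> b0 * rate ^ n * (Q ^^ n) g x \<and> v x \<le> b0 * rate ^ n * (Q ^^ n) g x)"
proof -
  let ?P = "\<lambda>n ab. pinched ((Q ^^ n) h) ((Q ^^ n) g) (fst ab) (snd ab)"
  \<comment> \<open>The intervals are chosen recursively, starting from \<open>(0, b0)\<close>.\<close>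
  let ?R = "\<lambda>n ab ab'. fst ab \<le> fst ab' \<and> snd ab' \<le> snd ab \<and> snd ab' - fst ab' \<le> rate * (snd ab - fst ab)"
  have "\<exists>ab. \<forall>n. (?P n (ab n) \<and> (n = 0 \<longrightarrow> ab n = (0, b0))) \<and> ?R n (ab n) (ab (Suc n))"
  proof (rule dependent_nat_choice)
    show "\<exists>ab. ?P 0 ab \<and> (0 = (0::nat) \<longrightarrow> ab = (0, b0))"
      using h b0 by (intro exI[of _ "(0, b0)"]) (auto simp: pinched_def)
  next
    fix ab n assume "?P n ab \<and> (n = 0 \<longrightarrow> ab = (0, b0))"
    then obtain a' b' where "pinched (Q ((Q ^^ n) h)) (Q ((Q ^^ n) g)) a' b'" "fst ab \<le> a'" "b' \<le> snd ab"
      "b' - a' \<le> rate * (snd ab - fst ab)"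
      using pinched_step[OF iter_cone[OF h] iter_cone[OF g]] by blast
    then show "\<exists>ab'. (?P (Suc n) ab' \<and> (Suc n = 0 \<longrightarrow> ab' = (0, b0))) \<and> ?R n ab ab'"
      by (intro exI[of _ "(a', b')"]) simp
  qed
  then obtain ab where ab: "\<forall>n. (?P n (ab n) \<and> (n = 0 \<longrightarrow> ab n = (0, b0))) \<and> ?R n (ab n) (ab (Suc n))"
    by (rule exE)
  have pn: "?P n (ab n)" and step: "fst (ab n) \<le> fst (ab (Suc n))" "snd (ab (Suc n)) \<le> snd (ab n)"
    "snd (ab (Suc n)) - fst (ab (Suc n)) \<le> rate * (snd (ab n) - fst (ab n))" for n
    using ab[rule_format, of n] by simp_all
  have z: "fst (ab 0) = 0" "snd (ab 0) = b0"
    using ab[rule_format, of 0] by simp_all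
  have width: "snd (ab n) - fst (ab n) \<le> b0 * rate ^ n" for n
  proof (induction n)
    case (Suc n)
    have "rate * (snd (ab n) - fst (ab n)) \<le> b0 * rate ^ Suc n"
      using mult_left_mono[OF Suc.IH rate(1)] by (simp add: mult_ac)
    with step(3)[of n] show ?case
      by linarith
  qed (simp add: z)
  have le: "fst (ab n) \<le> snd (ab n)" for n
    using pn[of n] by (simp add: pinched_def)
  have lim0: "(\<lambda>n. b0 * rate ^ n) \<longlonglongrightarrow> 0"
    by (rule tendsto_mult_right_zero[OF LIMSEQ_power_zero]) (use rate in simp)
  have "\<forall>n. norm (fst (ab n) - snd (ab n)) \<le> b0 * rate ^ n"
  proof
    show "norm (fst (ab n) - snd (ab n)) \<le> b0 * rate ^ n" for n
      using le[of n] width[of n] by simp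
  qed
  then have lim: "(\<lambda>n. fst (ab n) - snd (ab n)) \<longlonglongrightarrow> 0"
    by (rule Lim_null_comparison[OF always_eventually lim0])
  have "\<exists>c. ((\<forall>n. fst (ab n) \<le> c) \<and> (\<lambda>n. fst (ab n)) \<longlonglongrightarrow> c) \<and> ((\<forall>n. c \<le> snd (ab n)) \<and> (\<lambda>n. snd (ab n)) \<longlonglongrightarrow> c)"
    by (rule nested_sequence_unique) (use step le lim in simp_all)
  then obtain c where "\<forall>n. fst (ab n) \<le> c" "\<forall>n. c \<le> snd (ab n)"
    by (elim exE conjE)
  then have c: "fst (ab n) \<le> c" "c \<le> snd (ab n)" for n
    by simp_all
  show ?thesis
  proof (rule that)
    show "0 \<le> c" "c \<le> b0"
      using c[of 0] z by auto
    fix n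
    define u where "u = (\<lambda>x. (Q ^^ n) h x - fst (ab n) * (Q ^^ n) g x)"
    define v where "v = (\<lambda>x. (c - fst (ab n)) * (Q ^^ n) g x)"
    have "u \<in> hcone B"
      using pn[of n] by (simp add: pinched_def u_def)
    moreover have "v \<in> hcone B"
      unfolding v_def by (intro holder_cone_scale iter_cone[OF g]) (use c[of n] in simp)
    moreover have "u x \<le> b0 * rate ^ n * (Q ^^ n) g x \<and> v x \<le> b0 * rate ^ n * (Q ^^ n) g x" if "x \<in> X" for x
    proof -
      have g0: "0 \<le> (Q ^^ n) g x"
        using holder_coneD(2)[OF iter_cone[OF g] that] .
      have "(\<lambda>x. snd (ab n) * (Q ^^ n) g x - (Q ^^ n) h x) \<in> hcone B"
        using pn[of n] by (simp add: pinched_def)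
      from holder_coneD(2)[OF this that] have "0 \<le> snd (ab n) * (Q ^^ n) g x - (Q ^^ n) h x" .
      then have "u x \<le> (snd (ab n) - fst (ab n)) * (Q ^^ n) g x"
        by (simp add: u_def algebra_simps)
      moreover have "v x \<le> (snd (ab n) - fst (ab n)) * (Q ^^ n) g x"
        unfolding v_def using c[of n] g0 by (intro mult_right_mono) auto
      ultimately show ?thesis
        using mult_right_mono[OF width[of n] g0] by linarith
    qed
    ultimately show "\<exists>u\<in>hcone B. \<exists>v\<in>hcone B. (\<lambda>x. (Q ^^ n) h x - c * (Q ^^ n) g x) = (\<lambda>x. u x - v x) \<and>
      (\<forall>x\<in>X. u x \<le> b0 * rate ^ n * (Q ^^ n) g x \<and> v x \<le> b0 * rate ^ n * (Q ^^ n) g x)"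
      by (intro bexI[of _ u] bexI[of _ v] conjI ballI) (simp_all add: u_def v_def left_diff_distrib)
  qed
qed

text \<open>
The statement \<open>cone_subtract\<close> seen from the other side: a function with a positive lower bound dominates, in the
order of the cone, every bounded function of the narrow cone. This supplies the initial intervals for
\<open>ratio_converges\<close>.
\<close>

lemma dominate:
  assumes u: "u \<in> hcone (B - 1)" "\<And>x. x \<in> X \<Longrightarrow> a \<le> u x" "0 < a"
    and g: "g \<in> hcone (B - 1)" "\<And>x. x \<in> X \<Longrightarrow> g x \<le> G" "0 \<le> G"
  shows "(\<lambda>x. G / (margin * a) * u x - g x) \<in> hcone B"
proof (cases "G = 0")
  case True
  with g have "g = (\<lambda>_. 0)"
    by (intro ext) (metis holder_coneD(1,2) order_antisym)
  with True show ?thesis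
    by (simp add: holder_cone_def)
next
  case False
  with g have G: "0 < G"
    by simp
  define s where "s = margin * a / G"
  have s: "0 < s"
    using G u margin_pos by (simp add: s_def)
  have "(\<lambda>x. u x - s * g x) \<in> hcone B"
  proof (rule cone_subtract[OF u(1) g(1)])
    fix x assume x: "x \<in> X"
    have "s * g x \<le> s * G"
      using g(2)[OF x] s by simp
    also have "\<dots> \<le> margin * u x"
      using G margin_pos u(2)[OF x] by (simp add: s_def)
    finally show "s * g x \<le> margin * u x" .
  qed (use s in simp)
  from holder_cone_scale[OF this, of "1 / s"] s have "(\<lambda>x. 1 / s * (u x - s * g x)) \<in> hcone B"
    by simp
  also have "(\<lambda>x. 1 / s * (u x - s * g x)) = (\<lambda>x. G / (margin * a) * u x - g x)"
    using s by (simp add: right_diff_distrib) (simp add: s_def mult.commute)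
  finally show ?thesis .
qed

lemma iter_mono:
  assumes "f \<in> bounded_on X" "g \<in> bounded_on X" "\<And>y. y \<in> X \<Longrightarrow> f y \<le> g y" "x \<in> X"
  shows "(Q ^^ n) f x \<le> (Q ^^ n) g x"
  using assms(4) by (induction n arbitrary: x) (auto intro!: Q_mono iter_bounded assms)

lemma iter_scale: "f \<in> bounded_on X \<Longrightarrow> (Q ^^ n) (\<lambda>x. k * f x) = (\<lambda>x. k * (Q ^^ n) f x)"
  by (induction n) (auto simp: Q_scale iter_bounded)

lemma Q_abs_le:
  assumes h: "h \<in> bounded_on X" "\<And>y. y \<in> X \<Longrightarrow> \<bar>h y\<bar> \<le> t" and x: "x \<in> X"
  shows "\<bar>Q h x\<bar> \<le> t * Q (indicat_real X) x"
proof -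
  have "Q h x \<le> Q (\<lambda>x. t * indicat_real X x) x"
    using h x by (intro Q_mono bounded_on_scale bounded_on_indicator) (auto simp: abs_le_iff)
  moreover have "Q (\<lambda>x. - t * indicat_real X x) x \<le> Q h x"
  proof (intro Q_mono bounded_on_scale bounded_on_indicator h x)
    show "- t * indicat_real X y \<le> h y" if "y \<in> X" for y
      using h(2)[OF that] that by (simp add: abs_le_iff)
  qed
  ultimately show ?thesis
    using Q_scale[OF bounded_on_indicator, of t] Q_scale[OF bounded_on_indicator, of "- t"] by (simp add: abs_le_iff)
qed

end

lemma geometric_increments:
  fixes e :: "nat \<Rightarrow> real"
  assumes r: "0 \<le> r" "r < 1" and step: "\<And>n. \<bar>e (Suc n) - e n\<bar> \<le> c * r ^ n"
  shows "e \<longlonglongrightarrow> lim e" "\<bar>e n - lim e\<bar> \<le> c / (1 - r) * r ^ n"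
proof -
  have c: "0 \<le> c"
    using step[of 0] by simp
  have "summable (\<lambda>n. e (Suc n) - e n)"
    by (rule summable_comparison_test[of _ "\<lambda>n. c * r ^ n"])
      (use step r in \<open>auto intro!: summable_mult summable_geometric\<close>)
  then have "convergent (\<lambda>n. \<Sum>i<n. e (Suc i) - e i)"
    by (simp add: summable_iff_convergent)
  then have "convergent (\<lambda>n. e n - e 0)"
    by (simp add: sum_lessThan_telescope)
  then show lim: "e \<longlonglongrightarrow> lim e"
    by (simp add: convergent_diff_const_right_iff convergent_LIMSEQ_iff)
  have part: "\<bar>e (n + k) - e n\<bar> \<le> c / (1 - r) * r ^ n * (1 - r ^ k)" for k
  proof (induction k)
    case (Suc k)
    have "q * r ^ n * (1 - r ^ Suc k) = q * r ^ n * (1 - r ^ k) + q * (1 - r) * r ^ (n + k)" for q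
      by (simp add: algebra_simps power_add)
    from this[of "c / (1 - r)"] have "c / (1 - r) * r ^ n * (1 - r ^ Suc k) = c / (1 - r) * r ^ n * (1 - r ^ k) + c * r ^ (n + k)"
      using r by simp
    with Suc step[of "n + k"] show ?case
      unfolding add_Suc_right by linarith
  qed simp
  have "\<bar>e (n + k) - e n\<bar> \<le> c / (1 - r) * r ^ n" for k
  proof -
    have "c / (1 - r) * r ^ n * (1 - r ^ k) \<le> c / (1 - r) * r ^ n * 1"
      using r c by (intro mult_left_mono) auto
    with part[of k] show ?thesis
      by simp
  qed
  moreover have "(\<lambda>k. \<bar>e (n + k) - e n\<bar>) \<longlonglongrightarrow> \<bar>lim e - e n\<bar>"
    using LIMSEQ_ignore_initial_segment[OF lim, of n] by (intro tendsto_intros) (simp add: add.commute)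
  ultimately have "\<bar>lim e - e n\<bar> \<le> c / (1 - r) * r ^ n"
    by (intro LIMSEQ_le_const2) auto
  then show "\<bar>e n - lim e\<bar> \<le> c / (1 - r) * r ^ n"
    by (simp add: abs_minus_commute)
qed

text \<open>
The product of the factors \<open>1 + c * r^n\<close> converges.
\<close>

lemma exp_growth:
  fixes e :: "nat \<Rightarrow> real"
  assumes r: "0 \<le> r" "r < 1" and c: "0 \<le> c" and pos: "\<And>n. 0 \<le> e n"
    and step: "\<And>n. e (Suc n) \<le> (1 + c * r ^ n) * e n"
  shows "e n \<le> exp (c / (1 - r)) * e 0"
proof -
  have *: "e n \<le> exp (c * (\<Sum>i<n. r ^ i)) * e 0"
  proof (induction n)
    case (Suc n)
    have "e (Suc n) \<le> exp (c * r ^ n) * e n"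
      using step[of n] mult_right_mono[OF exp_ge_add_one_self[of "c * r ^ n"] pos[of n]] by linarith
    also have "\<dots> \<le> exp (c * r ^ n) * (exp (c * (\<Sum>i<n. r ^ i)) * e 0)"
      using Suc by (intro mult_left_mono) auto
    also have "\<dots> = exp (c * (\<Sum>i<Suc n. r ^ i)) * e 0"
      by (simp add: distrib_left exp_add mult_ac)
    finally show ?case .
  qed simp
  have "(\<Sum>i<n. r ^ i) \<le> (\<Sum>i. r ^ i)"
    using r by (intro sum_le_suminf summable_geometric) auto
  also have "\<dots> = 1 / (1 - r)"
    using r by (simp add: suminf_geometric)
  finally have "c * (\<Sum>i<n. r ^ i) \<le> c / (1 - r)"
    using c mult_left_mono by fastforce
  then have "exp (c * (\<Sum>i<n. r ^ i)) * e 0 \<le> exp (c / (1 - r)) * e 0"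
    using pos[of 0] by (intro mult_right_mono) auto
  with * show ?thesis
    by linarith
qed

context type_space
begin

lemma cbound_diff:
  assumes "cbound g \<epsilon>" "cbound h \<epsilon>'"
  shows "cbound (\<lambda>x. g x - h x) (\<epsilon> + \<epsilon>')"
  using cbound_add[OF assms(1) cbound_scale[OF assms(2), of "-1"]] by simp

end

context cone_contraction
begin

lemma Q_one_bounds:
  obtains m M where "0 < m" "0 < M" "\<And>x. x \<in> X \<Longrightarrow> m \<le> Q (indicat_real X) x" "\<And>x. x \<in> X \<Longrightarrow> Q (indicat_real X) x \<le> M"
proof -
  let ?one = "indicat_real X"
  obtain x0 where x0: "x0 \<in> X"
    using nonempty by blast
  have one: "?one \<in> hcone B"
    using B_ge_1 by (intro cone_indicator) simp
  show thesis
  proof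
    show "0 < Q ?one x0 / K" "0 < K * Q ?one x0"
      using Q_pos[OF x0] K_ge_1 by auto
    show "Q ?one x0 / K \<le> Q ?one x" if "x \<in> X" for x
      using Q_comparable[OF one x0 that] K_ge_1 by (simp add: pos_divide_le_eq mult.commute)
    show "Q ?one x \<le> K * Q ?one x0" if "x \<in> X" for x
      using Q_comparable[OF one that x0] .
  qed
qed

text \<open>
The ratio of \<open>Q^(n+1) 1\<close> to \<open>Q^n 1\<close> converges to a constant \<open>l\<close> exponentially fast and uniformly, so
that \<open>Q^n 1 / l^n\<close> changes by a factor \<open>1 + O(r^n)\<close> in each step. Hence it stays between two positive
constants and converges uniformly.
\<close>

lemma eigenfunction:
  obtains l f m C where "0 < l" "f \<in> hcone (B - 1)" "0 < m" "\<And>x. x \<in> X \<Longrightarrow> m \<le> f x"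
    "Q f = (\<lambda>x. l * f x)" "\<And>x. x \<in> X \<Longrightarrow> (\<lambda>n. (Q ^^ n) (indicat_real X) x / l ^ n) \<longlonglongrightarrow> f x"
proof -
  define one where "one = indicat_real X"
  define q where "q n = (Q ^^ n) one" for n
  obtain m1 M1 where m1: "0 < m1" "\<And>x. x \<in> X \<Longrightarrow> m1 \<le> Q one x" and M1: "0 < M1" "\<And>x. x \<in> X \<Longrightarrow> Q one x \<le> M1"
    using Q_one_bounds unfolding one_def by metis
  have one: "one \<in> hcone (B - 1)" "one \<in> hcone B" and one_b: "one \<in> bounded_on X"
    using B_ge_1 bounded_on_indicator by (auto simp: one_def intro: cone_indicator)
  have q_Suc: "q (Suc n) = (Q ^^ n) (Q one)" for n
    by (simp add: q_def funpow_swap1)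
  have q0: "q 0 = one"
    by (simp add: q_def)
  have q_lower: "m1 * q n x \<le> q (Suc n) x" if "x \<in> X" for n x
  proof -
    have "(Q ^^ n) (\<lambda>x. m1 * one x) x \<le> (Q ^^ n) (Q one) x"
      using m1 that by (intro iter_mono bounded_on_scale one_b Q_bounded) (auto simp: one_def)
    then show ?thesis
      by (simp add: q_Suc iter_scale[OF one_b]) (simp add: q_def)
  qed
  have q_pos: "0 < q n x" if "x \<in> X" for n x
  proof (induction n)
    case 0
    with that show ?case
      by (simp add: q_def one_def)
  next
    case (Suc n)
    with m1 have "0 < m1 * q n x"
      by simp
    with q_lower[OF that, of n] show ?case
      by linarith
  qed
  have dom: "(\<lambda>x. M1 / (margin * 1) * one x - Q one x) \<in> hcone B"
    using M1 one by (intro dominate Q_cone) (auto simp: one_def)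
  obtain l where l: "\<And>n. \<exists>u\<in>hcone B. \<exists>v\<in>hcone B. (\<lambda>x. (Q ^^ n) (Q one) x - l * (Q ^^ n) one x) = (\<lambda>x. u x - v x) \<and>
      (\<forall>x\<in>X. u x \<le> M1 / (margin * 1) * rate ^ n * (Q ^^ n) one x \<and> v x \<le> M1 / (margin * 1) * rate ^ n * (Q ^^ n) one x)"
    by (rule ratio_converges[OF Q_cone'[OF one(2)] one(2) _ dom]) (use M1 margin_pos in auto)
  define b where "b = M1 / margin"
  have b: "0 < b"
    using M1 margin_pos by (simp add: b_def)
  have q_step: "\<bar>q (Suc n) x - l * q n x\<bar> \<le> b * rate ^ n * q n x" if x: "x \<in> X" for n x
  proof -
    obtain u v where uv: "u \<in> hcone B" "v \<in> hcone B" "(\<lambda>x. q (Suc n) x - l * q n x) = (\<lambda>x. u x - v x)"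
      "u x \<le> b * rate ^ n * q n x" "v x \<le> b * rate ^ n * q n x"
      using l[of n] x unfolding q_Suc by (auto simp: q_def b_def)
    have "q (Suc n) x - l * q n x = u x - v x"
      using uv(3) by (rule fun_cong)
    with uv(4,5) holder_coneD(2)[OF uv(1) x] holder_coneD(2)[OF uv(2) x] show ?thesis
      by linarith
  qed
  obtain x0 where x0: "x0 \<in> X"
    using nonempty by blast
  \<comment> \<open>Positivity of \<open>l\<close>: every ratio \<open>Q^(n+1) 1 / Q^n 1\<close> is at least \<open>m1\<close>.\<close>
  have "m1 \<le> l + b * rate ^ n" for n
  proof -
    have "m1 * q n x0 \<le> (l + b * rate ^ n) * q n x0"
      using q_step[OF x0, of n] q_lower[OF x0, of n] by (simp add: distrib_right abs_le_iff)
    then show ?thesis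
      using q_pos[OF x0, of n] by simp
  qed
  moreover have "(\<lambda>n. l + b * rate ^ n) \<longlonglongrightarrow> l + b * 0"
    using rate by (intro tendsto_intros LIMSEQ_power_zero) simp
  ultimately have "m1 \<le> l"
    by (intro LIMSEQ_le_const[of "\<lambda>n. l + b * rate ^ n"]) auto
  with m1 have l_pos: "0 < l"
    by simp
  define e where "e x n = q n x / l ^ n" for x n
  have e_pos: "0 < e x n" if "x \<in> X" for x n
    using q_pos[OF that] l_pos by (simp add: e_def)
  have e0: "e x 0 = 1" if "x \<in> X" for x
    using that by (simp add: e_def q_def one_def)
  have e_step: "\<bar>e x (Suc n) - e x n\<bar> \<le> b / l * rate ^ n * e x n" if x: "x \<in> X" for x n
  proof -
    have "e x (Suc n) - e x n = (q (Suc n) x - l * q n x) / l ^ Suc n"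
      using l_pos by (simp add: e_def field_simps)
    then have "\<bar>e x (Suc n) - e x n\<bar> = \<bar>q (Suc n) x - l * q n x\<bar> / l ^ Suc n"
      using l_pos by (simp add: abs_divide)
    also have "\<dots> \<le> b * rate ^ n * q n x / l ^ Suc n"
      using q_step[OF x] l_pos by (intro divide_right_mono) auto
    finally show ?thesis
      by (simp add: e_def)
  qed
  define E where "E = exp (b / l / (1 - rate))"
  have upper: "e x n \<le> E" if x: "x \<in> X" for x n
  proof -
    have "e x n \<le> exp (b / l / (1 - rate)) * e x 0"
    proof (rule exp_growth)
      show "e x (Suc n) \<le> (1 + b / l * rate ^ n) * e x n" for n
        using e_step[OF x, of n] unfolding distrib_right by linarith
    qed (use rate b l_pos e_pos[OF x] in \<open>auto intro: less_imp_le\<close>)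
    then show ?thesis
      by (simp add: E_def e0[OF x])
  qed
  have lower: "exp (- (b / m1 / (1 - rate))) \<le> e x n" if x: "x \<in> X" for x n
  proof -
    \<comment> \<open>The reciprocals grow as slowly as the sequence itself, which keeps the limit away from \<open>0\<close>.\<close>
    have inv_step: "1 / e x (Suc k) \<le> (1 + b / m1 * rate ^ k) * (1 / e x k)" for k
    proof -
      have "m1 / l * e x k \<le> e x (Suc k)"
        using q_lower[OF x, of k] l_pos by (simp add: e_def field_simps)
      then have "b / m1 * rate ^ k * (m1 / l * e x k) \<le> b / m1 * rate ^ k * e x (Suc k)"
        using b m1 rate by (intro mult_left_mono) auto
      then have "b / l * rate ^ k * e x k \<le> b / m1 * rate ^ k * e x (Suc k)"
        using m1 by (simp add: field_simps)
      with e_step[OF x, of k] have "e x k \<le> (1 + b / m1 * rate ^ k) * e x (Suc k)"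
        unfolding distrib_right by linarith
      then show ?thesis
        using e_pos[OF x, of k] e_pos[OF x, of "Suc k"] by (simp add: divide_le_eq)
    qed
    have "1 / e x n \<le> exp (b / m1 / (1 - rate)) * (1 / e x 0)"
      by (rule exp_growth[OF _ _ _ _ inv_step]) (use rate b m1 e_pos[OF x] in \<open>auto intro: less_imp_le\<close>)
    then have "1 \<le> exp (b / m1 / (1 - rate)) * e x n"
      using e_pos[OF x, of n] by (simp add: e0[OF x] divide_le_eq)
    then have "exp (- (b / m1 / (1 - rate))) * 1 \<le> exp (- (b / m1 / (1 - rate))) * (exp (b / m1 / (1 - rate)) * e x n)"
      by (intro mult_left_mono) auto
    then show ?thesis
      by (simp flip: exp_add mult.assoc)
  qed
  have e_step': "\<bar>e x (Suc n) - e x n\<bar> \<le> b / l * E * rate ^ n" if x: "x \<in> X" for x n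
  proof -
    have "b / l * rate ^ n * e x n \<le> b / l * rate ^ n * E"
      using upper[OF x, of n] b l_pos rate by (intro mult_left_mono) auto
    with e_step[OF x, of n] show ?thesis
      by (simp add: mult_ac)
  qed
  define f where "f x = lim (e x)" for x
  have lim: "e x \<longlonglongrightarrow> f x" and conv: "\<bar>e x n - f x\<bar> \<le> b / l * E / (1 - rate) * rate ^ n" if x: "x \<in> X" for x n
    using geometric_increments[of rate "e x", OF rate(1,2) e_step'[OF x]] by (auto simp: f_def)
  define c2 where "c2 = b / l * E / (1 - rate)"
  have q_cone: "q (Suc n) \<in> hcone (B - 1)" for n
    using Q_cone[OF iter_cone[OF one(2)], of n] by (simp add: q_def)
  have qb: "q n \<in> bounded_on X" for n
    using iter_bounded[OF one_b] by (simp add: q_def)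
  have off: "f x = 0" if "x \<notin> X" for x
  proof -
    have "e x n = 0" for n
      using qb[of n] that by (simp add: e_def bounded_on_def)
    then have "e x = (\<lambda>_. 0)"
      by auto
    then show ?thesis
      by (simp add: f_def)
  qed
  have f_lower: "exp (- (b / m1 / (1 - rate))) \<le> f x" if "x \<in> X" for x
    by (rule LIMSEQ_le_const[OF lim[OF that]]) (use lower[OF that] in auto)
  have f_cone: "f \<in> hcone (B - 1)"
  proof -
    have "f x \<le> exp ((B - 1) * D x y) * f y" if xy: "x \<in> X" "y \<in> X" "ty x = ty y" for x y
    proof (rule LIMSEQ_le)
      show "(\<lambda>n. e x (Suc n)) \<longlonglongrightarrow> f x" "(\<lambda>n. exp ((B - 1) * D x y) * e y (Suc n)) \<longlonglongrightarrow> exp ((B - 1) * D x y) * f y"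
        by (intro tendsto_intros LIMSEQ_Suc lim xy)+
      have "e x (Suc n) \<le> exp ((B - 1) * D x y) * e y (Suc n)" for n
        using divide_right_mono[OF holder_coneD(3)[OF q_cone xy, of n], of "l ^ Suc n"] l_pos by (simp add: e_def)
      then show "\<exists>N. \<forall>n\<ge>N. e x (Suc n) \<le> exp ((B - 1) * D x y) * e y (Suc n)"
        by blast
    qed
    moreover have "0 \<le> f x" if "x \<in> X" for x
      using f_lower[OF that] exp_ge_zero order_trans by blast
    ultimately show ?thesis
      by (auto simp: holder_cone_def off)
  qed
  have fb: "f \<in> bounded_on X"
    by (rule cone_bounded[OF f_cone])
  have "Q f x = l * f x" if x: "x \<in> X" for x
  proof -
    have Qe: "Q (\<lambda>y. 1 / l ^ n * q n y) x = l * e x (Suc n)" for n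
      using l_pos by (subst Q_scale[OF qb]) (simp add: e_def q_def)
    have "\<forall>n. norm (Q f x - l * e x (Suc n)) \<le> c2 * rate ^ n * Q one x"
    proof
      fix n
      have "Q (\<lambda>y. f y - 1 * (1 / l ^ n * q n y)) x = Q f x - 1 * Q (\<lambda>y. 1 / l ^ n * q n y) x"
        by (subst Q_diff[OF fb bounded_on_scale[OF qb]]) (rule refl)
      moreover have "\<bar>Q (\<lambda>y. f y - 1 * (1 / l ^ n * q n y)) x\<bar> \<le> c2 * rate ^ n * Q one x"
        unfolding one_def
      proof (rule Q_abs_le[OF _ _ x])
        show "(\<lambda>y. f y - 1 * (1 / l ^ n * q n y)) \<in> bounded_on X"
          using bounded_on_diff[OF fb bounded_on_scale[OF qb, of "1 / l ^ n" n]] by simp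
        show "\<bar>f y - 1 * (1 / l ^ n * q n y)\<bar> \<le> c2 * rate ^ n" if "y \<in> X" for y
          using conv[OF that, of n] by (simp add: e_def c2_def abs_minus_commute)
      qed
      ultimately show "norm (Q f x - l * e x (Suc n)) \<le> c2 * rate ^ n * Q one x"
        unfolding Qe by simp
    qed
    moreover have "(\<lambda>n. c2 * rate ^ n * Q one x) \<longlonglongrightarrow> 0"
      by (intro tendsto_mult_left_zero tendsto_mult_right_zero LIMSEQ_power_zero) (use rate in simp)
    ultimately have "(\<lambda>n. Q f x - l * e x (Suc n)) \<longlonglongrightarrow> 0"
      by (rule Lim_null_comparison[OF always_eventually])
    moreover have "(\<lambda>n. Q f x - l * e x (Suc n)) \<longlonglongrightarrow> Q f x - l * f x"
      by (intro tendsto_diff tendsto_mult tendsto_const LIMSEQ_Suc[OF lim[OF x]])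
    ultimately have "0 = Q f x - l * f x"
      by (rule LIMSEQ_unique)
    then show ?thesis
      by simp
  qed
  moreover have "Q f x = l * f x" if "x \<notin> X" for x
    using Q_bounded[OF fb] that off by (simp add: bounded_on_def)
  ultimately have Qf: "Q f = (\<lambda>x. l * f x)"
    by blast
  have "(\<lambda>n. (Q ^^ n) (indicat_real X) x / l ^ n) \<longlonglongrightarrow> f x" if "x \<in> X" for x
    using lim[OF that] unfolding e_def[abs_def] q_def one_def .
  from that[OF l_pos f_cone exp_gt_zero f_lower Qf this] show thesis .
qed

text \<open>
Apply \<open>ratio_converges\<close> to \<open>Q h\<close> and \<open>f\<close>; passing to \<open>Q h\<close> is what puts \<open>h\<close> into the narrow cone.
All constants are linear in the bound \<open>\<epsilon>\<close> of \<open>h\<close>, which makes the result an estimate in operator norm.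
\<close>

lemma spectral_gap_cone:
  assumes l: "0 < l" and f: "f \<in> hcone (B - 1)" "0 < m" "\<And>x. x \<in> X \<Longrightarrow> m \<le> f x" and Qf: "Q f = (\<lambda>x. l * f x)"
  obtains C where "0 \<le> C" "\<And>h \<epsilon>. h \<in> hcone B \<Longrightarrow> (\<And>x. x \<in> X \<Longrightarrow> h x \<le> \<epsilon>) \<Longrightarrow>
    \<exists>c. \<bar>c\<bar> \<le> C * \<epsilon> \<and> (\<forall>n. cbound (\<lambda>x. (Q ^^ n) h x - c * l ^ n * f x) (C * \<epsilon> * rate ^ n * l ^ n))"
proof -
  obtain m1 M1 where M1: "0 < M1" "\<And>x. x \<in> X \<Longrightarrow> Q (indicat_real X) x \<le> M1"
    using Q_one_bounds by metis
  have f': "f \<in> hcone B"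
    by (rule cone_mono[OF f(1)]) simp
  obtain F0 where "\<forall>x\<in>X. \<bar>f x\<bar> \<le> F0"
    using cone_bounded[OF f'] by (auto simp: bounded_on_def)
  then have F: "f x \<le> max F0 1" if "x \<in> X" for x
    using that by fastforce
  define F where "F = max F0 1"
  have F: "1 \<le> F" "\<And>x. x \<in> X \<Longrightarrow> f x \<le> F"
    using F by (auto simp: F_def)
  have iter_f: "(Q ^^ n) f = (\<lambda>x. l ^ n * f x)" for n
  proof (induction n)
    case (Suc n)
    then show ?case
      using Q_scale[OF cone_bounded[OF f'], of "l ^ n"] by (simp add: Qf mult_ac)
  qed simp
  define C1 where "C1 = M1 / (margin * m)"
  have C1: "0 < C1"
    using M1 margin_pos f by (simp add: C1_def)
  \<comment> \<open>The summands bound \<open>c\<close>, the error for \<open>n = 0\<close> (two of them), and the error for \<open>n > 0\<close>.\<close>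
  define C where "C = C1 / l + 1 + C1 / l * F + C1 * F / (rate * l)"
  show thesis
  proof (rule that)
    have pos: "0 < C1 / l" "0 < C1 / l * F" "0 < C1 * F / (rate * l)"
      using C1 l F rate by auto
    then show "0 \<le> C"
      by (simp add: C_def)
    fix h \<epsilon> assume h: "h \<in> hcone B" and he: "\<And>x. x \<in> X \<Longrightarrow> h x \<le> \<epsilon>"
    have e: "0 \<le> \<epsilon>"
      using he nonempty holder_coneD(2)[OF h] by (meson all_not_in_conv order_trans)
    have Qh_le: "Q h x \<le> \<epsilon> * M1" if x: "x \<in> X" for x
    proof -
      have "\<bar>Q h x\<bar> \<le> \<epsilon> * Q (indicat_real X) x"
        using he holder_coneD(2)[OF h] by (intro Q_abs_le[OF cone_bounded[OF h] _ x]) simp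
      also have "\<dots> \<le> \<epsilon> * M1"
        using M1(2)[OF x] e by (rule mult_left_mono)
      finally show ?thesis
        by simp
    qed
    have dom: "(\<lambda>x. \<epsilon> * M1 / (margin * m) * f x - Q h x) \<in> hcone B"
      using e M1 Qh_le f by (intro dominate Q_cone h) auto
    have b: "0 \<le> \<epsilon> * M1 / (margin * m)"
      using e M1 margin_pos f by simp
    obtain c0 where c0: "0 \<le> c0" "c0 \<le> \<epsilon> * M1 / (margin * m)"
      "\<And>n. \<exists>u\<in>hcone B. \<exists>v\<in>hcone B. (\<lambda>x. (Q ^^ n) (Q h) x - c0 * (Q ^^ n) f x) = (\<lambda>x. u x - v x) \<and>
      (\<forall>x\<in>X. u x \<le> \<epsilon> * M1 / (margin * m) * rate ^ n * (Q ^^ n) f x \<and> v x \<le> \<epsilon> * M1 / (margin * m) * rate ^ n * (Q ^^ n) f x)"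
      by (rule ratio_converges[OF Q_cone'[OF h] f' b dom]) blast
    have eq: "\<epsilon> * M1 / (margin * m) = \<epsilon> * C1"
      by (simp add: C1_def)
    note c0 = c0[unfolded eq]
    have c_le: "c0 / l \<le> \<epsilon> * (C1 / l)"
      using c0(2) l by (simp add: divide_right_mono)
    have zero: "cbound (\<lambda>x. h x - c0 / l * f x) (C * \<epsilon>)"
    proof -
      have "cbound (\<lambda>x. h x - c0 / l * f x) (\<epsilon> + \<bar>c0 / l\<bar> * F)"
        by (intro cbound_diff cbound_scale cbound_cone h f' F he)
      moreover have "\<epsilon> + \<bar>c0 / l\<bar> * F \<le> C * \<epsilon>"
      proof -
        have "\<bar>c0 / l\<bar> * F \<le> \<epsilon> * (C1 / l) * F"
          using c_le c0(1) l F by (intro mult_right_mono) auto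
        moreover have "C * \<epsilon> = \<epsilon> * (C1 / l) + \<epsilon> + \<epsilon> * (C1 / l) * F + \<epsilon> * (C1 * F / (rate * l))"
          by (simp add: C_def algebra_simps)
        moreover have "0 \<le> \<epsilon> * (C1 / l)" "0 \<le> \<epsilon> * (C1 * F / (rate * l))"
          using mult_nonneg_nonneg[OF e less_imp_le[OF pos(1)]] mult_nonneg_nonneg[OF e less_imp_le[OF pos(3)]] by blast+
        ultimately show ?thesis
          by linarith
      qed
      ultimately show ?thesis
        by (rule cbound_mono)
    qed
    have succ: "cbound (\<lambda>x. (Q ^^ Suc n) h x - c0 / l * l ^ Suc n * f x) (C * \<epsilon> * rate ^ Suc n * l ^ Suc n)" for n
    proof -
      obtain u v where uv: "u \<in> hcone B" "v \<in> hcone B" "(\<lambda>x. (Q ^^ n) (Q h) x - c0 * (Q ^^ n) f x) = (\<lambda>x. u x - v x)"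
        "\<forall>x\<in>X. u x \<le> \<epsilon> * C1 * rate ^ n * (Q ^^ n) f x \<and> v x \<le> \<epsilon> * C1 * rate ^ n * (Q ^^ n) f x"
        using c0(3)[of n] by blast
      have le: "\<epsilon> * C1 * rate ^ n * (l ^ n * f x) \<le> C * \<epsilon> * rate ^ Suc n * l ^ Suc n" if x: "x \<in> X" for x
      proof -
        have "\<epsilon> * C1 * rate ^ n * (l ^ n * f x) \<le> \<epsilon> * C1 * rate ^ n * (l ^ n * F)"
          using F(2)[OF x] e C1 rate l by (intro mult_left_mono) auto
        also have "\<dots> = (C1 * F / (rate * l)) * (\<epsilon> * rate ^ Suc n * l ^ Suc n)"
          using rate l by simp
        also have "\<dots> \<le> C * (\<epsilon> * rate ^ Suc n * l ^ Suc n)"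
          using pos e rate l by (intro mult_right_mono) (auto simp: C_def)
        finally show ?thesis
          by (simp add: mult_ac)
      qed
      have "(\<lambda>x. (Q ^^ Suc n) h x - c0 / l * l ^ Suc n * f x) = (\<lambda>x. u x - v x)"
        using uv(3) l unfolding iter_f by (simp add: funpow_swap1 mult_ac)
      moreover have "u x \<le> C * \<epsilon> * rate ^ Suc n * l ^ Suc n \<and> v x \<le> C * \<epsilon> * rate ^ Suc n * l ^ Suc n" if "x \<in> X" for x
        using uv(4) le[OF that] that unfolding iter_f by fastforce
      ultimately show ?thesis
        using uv(1,2) unfolding cone_bound_def by blast
    qed
    have "cbound (\<lambda>x. (Q ^^ n) h x - c0 / l * l ^ n * f x) (C * \<epsilon> * rate ^ n * l ^ n)" for n
      using zero succ by (cases n) auto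
    moreover have "\<bar>c0 / l\<bar> \<le> C * \<epsilon>"
    proof -
      have "\<epsilon> * (C1 / l) \<le> \<epsilon> * C"
        using pos e by (intro mult_left_mono) (auto simp: C_def)
      with c_le c0(1) l show ?thesis
        by (simp add: mult.commute)
    qed
    ultimately show "\<exists>c. \<bar>c\<bar> \<le> C * \<epsilon> \<and> (\<forall>n. cbound (\<lambda>x. (Q ^^ n) h x - c * l ^ n * f x) (C * \<epsilon> * rate ^ n * l ^ n))"
      by blast
  qed
qed

lemma spectral_gap:
  assumes l: "0 < l" and f: "f \<in> hcone (B - 1)" "0 < m" "\<And>x. x \<in> X \<Longrightarrow> m \<le> f x" and Qf: "Q f = (\<lambda>x. l * f x)"
  obtains C where "0 \<le> C" "\<And>h \<epsilon>. cbound h \<epsilon> \<Longrightarrow>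
    \<exists>c. \<bar>c\<bar> \<le> C * \<epsilon> \<and> (\<forall>n. cbound (\<lambda>x. (Q ^^ n) h x - c * l ^ n * f x) (C * \<epsilon> * rate ^ n * l ^ n))"
proof -
  obtain C where C: "0 \<le> C" "\<And>h \<epsilon>. h \<in> hcone B \<Longrightarrow> (\<And>x. x \<in> X \<Longrightarrow> h x \<le> \<epsilon>) \<Longrightarrow>
    \<exists>c. \<bar>c\<bar> \<le> C * \<epsilon> \<and> (\<forall>n. cbound (\<lambda>x. (Q ^^ n) h x - c * l ^ n * f x) (C * \<epsilon> * rate ^ n * l ^ n))"
    using spectral_gap_cone[OF assms] by blast
  show thesis
  proof (rule that[of "2 * C"])
    fix h \<epsilon> assume "cbound h \<epsilon>"
    then obtain u v where uv: "u \<in> hcone B" "v \<in> hcone B" "h = (\<lambda>x. u x - v x)" "\<forall>x\<in>X. u x \<le> \<epsilon> \<and> v x \<le> \<epsilon>"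
      unfolding cone_bound_def by blast
    obtain a where a: "\<bar>a\<bar> \<le> C * \<epsilon>" "\<And>n. cbound (\<lambda>x. (Q ^^ n) u x - a * l ^ n * f x) (C * \<epsilon> * rate ^ n * l ^ n)"
      using C(2)[OF uv(1)] uv(4) by blast
    obtain b where b: "\<bar>b\<bar> \<le> C * \<epsilon>" "\<And>n. cbound (\<lambda>x. (Q ^^ n) v x - b * l ^ n * f x) (C * \<epsilon> * rate ^ n * l ^ n)"
      using C(2)[OF uv(2)] uv(4) by blast
    have "cbound (\<lambda>x. (Q ^^ n) h x - (a - b) * l ^ n * f x) (2 * C * \<epsilon> * rate ^ n * l ^ n)" for n
    proof -
      have "(Q ^^ n) h = (\<lambda>x. (Q ^^ n) u x - (Q ^^ n) v x)"
        using iter_diff[OF cone_bounded[OF uv(1)] cone_bounded[OF uv(2)], of n 1] by (simp add: uv(3))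
      then have "(\<lambda>x. (Q ^^ n) h x - (a - b) * l ^ n * f x) =
        (\<lambda>x. ((Q ^^ n) u x - a * l ^ n * f x) - ((Q ^^ n) v x - b * l ^ n * f x))"
        by (simp add: algebra_simps)
      with cbound_diff[OF a(2) b(2), of n n] show ?thesis
        by (simp add: mult_ac)
    qed
    moreover have "\<bar>a - b\<bar> \<le> 2 * C * \<epsilon>"
      using a(1) b(1) by linarith
    ultimately show "\<exists>c. \<bar>c\<bar> \<le> 2 * C * \<epsilon> \<and> (\<forall>n. cbound (\<lambda>x. (Q ^^ n) h x - c * l ^ n * f x) (2 * C * \<epsilon> * rate ^ n * l ^ n))"
      by blast
  qed (use C in simp)
qed

end

section \<open>Geometry of the shift space\<close>

context countable_markov_shift
begin

abbreviation "X \<equiv> shift_space (range b) A"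

lemma b_inj: "inj b"
  using alphabet_increasing by (rule strict_mono_imp_inj_on)

lemma b_range: "b k \<in> {0..1}"
  using alphabet_subset by blast

lemma X_symbol: "x \<in> X \<Longrightarrow> x n \<in> range b"
  by (simp add: shift_space_def)

lemma X_range: "x \<in> X \<Longrightarrow> x n \<in> {0..1}"
  using b_range by (elim X_symbol[of x n, THEN imageE]) (simp only:)

lemma X_step: "x \<in> X \<Longrightarrow> A (x n) (x (Suc n)) = 1"
  by (simp add: shift_space_def)

lemma shift_in_X: "x \<in> X \<Longrightarrow> shift x \<in> X"
  by (simp add: shift_space_def shift_def)

lemma prepend_simps [simp]: "prepend a x 0 = a" "prepend a x (Suc n) = x n" "shift (prepend a x) = x"
  by (auto simp: prepend_def shift_def)

text \<open>
The symbols that may precede \<open>r\<close>, so the preimages of \<open>x\<close> under the shift are the points \<open>prepend a x\<close> with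
\<open>a \<in> pred (x 0)\<close>.
\<close>

definition pred :: "real \<Rightarrow> real set" where
  "pred r = {a \<in> range b. A a r = 1}"

lemma prepend_in_X:
  assumes "x \<in> X" "a \<in> pred (x 0)"
  shows "prepend a x \<in> X"
proof -
  have "prepend a x n \<in> range b \<and> A (prepend a x n) (prepend a x (Suc n)) = 1" for n
    by (cases n) (use assms in \<open>simp_all add: shift_space_def pred_def\<close>)
  then show ?thesis
    unfolding shift_space_def by blast
qed

lemma matrix_power_pos_SucD:
  assumes "matrix_power (range b) A (Suc k) i j > 0"
  shows "\<exists>l\<in>range b. matrix_power (range b) A k i l > 0 \<and> A l j \<noteq> 0"
proof (rule ccontr)
  assume "\<not> ?thesis"
  then have "matrix_power (range b) A k i l * of_nat (A l j) = 0" if "l \<in> range b" for l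
    using that by (metis mult_zero_left mult_zero_right not_gr_zero of_nat_0)
  then have "matrix_power (range b) A (Suc k) i j = 0"
    by (simp add: infsum_0)
  with assms show False
    by simp
qed

lemma matrix_nonzero:
  assumes "i \<in> range b" "j \<in> range b" "A i j \<noteq> 0"
  shows "A i j = 1"
proof -
  from assms obtain k l where "i = b k" "j = b l"
    by (elim imageE)
  with matrix_entries[of k l] assms(3) show ?thesis
    by (elim insertE) simp_all
qed

text \<open>
Matrix powers are defined by splitting off the last step of a path; the first step has to be found by
induction.
\<close>

lemma successor_of_path:
  assumes "matrix_power (range b) A k i j > 0" "1 \<le> k" "i \<in> range b" "j \<in> range b"
  shows "\<exists>l\<in>range b. A i l = 1"
  using assms(2,1,4)
proof (induction k arbitrary: j rule: dec_induct)
  case base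
  then have "matrix_power (range b) A (Suc 0) i j > 0"
    by simp
  from matrix_power_pos_SucD[OF this]
  obtain l where "l \<in> range b" "matrix_power (range b) A 0 i l > 0" "A l j \<noteq> 0"
    by blast
  then have "A i j \<noteq> 0"
    by (simp split: if_splits)
  then have "A i j = 1"
    by (rule matrix_nonzero[OF assms(3) base(2)])
  with base(2) show ?case
    by (intro bexI)
next
  case (step k)
  from matrix_power_pos_SucD[OF step.prems(1)]
  obtain l where "l \<in> range b" "matrix_power (range b) A k i l > 0"
    by blast
  then show ?case
    by (intro step.IH)
qed

lemma return_path:
  assumes "i \<in> range b"
  obtains k where "matrix_power (range b) A (Suc k) i i > 0"
proof -
  obtain k where k: "1 \<le> k" "matrix_power (range b) A k i i > 0"
    using matrix_irreducible assms unfolding irreducible_matrix_def by meson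
  then have "k = Suc (k - 1)"
    by simp
  with k(2) have "matrix_power (range b) A (Suc (k - 1)) i i > 0"
    by metis
  then show thesis
    by (rule that)
qed

lemma successor_exists:
  assumes "i \<in> range b"
  shows "\<exists>l\<in>range b. A i l = 1"
proof -
  obtain k where "matrix_power (range b) A (Suc k) i i > 0"
    by (rule return_path[OF assms])
  from successor_of_path[OF this _ assms assms] show ?thesis
    by simp
qed

lemma pred_nonempty: assumes "j \<in> range b" shows "pred j \<noteq> {}"
proof -
  obtain k where "matrix_power (range b) A (Suc k) j j > 0"
    by (rule return_path[OF assms])
  from matrix_power_pos_SucD[OF this] obtain l where "l \<in> range b" "A l j \<noteq> 0"
    by blast
  with assms have "l \<in> pred j"
    unfolding pred_def using matrix_nonzero by blast
  then show ?thesis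
    by blast
qed

lemma X_point_starting_with:
  assumes "i \<in> range b"
  obtains x where "x \<in> X" "x 0 = i"
proof -
  obtain s where s: "\<And>i. i \<in> range b \<Longrightarrow> s i \<in> range b \<and> A i (s i) = 1"
    using successor_exists by metis
  define x where "x n = (s ^^ n) i" for n
  have x: "x n \<in> range b" for n
  proof (induction n)
    case (Suc n)
    with s[of "x n"] show ?case
      by (simp add: x_def)
  qed (simp add: x_def assms)
  have "A (x n) (x (Suc n)) = 1" for n
    using s[OF x[of n]] by (simp add: x_def)
  with x have "x \<in> X"
    unfolding shift_space_def by blast
  moreover have "x 0 = i"
    by (simp add: x_def)
  ultimately show thesis
    using that by blast
qed

lemma X_nonempty: "X \<noteq> {}"
proof -
  obtain x where "x \<in> X"
    by (rule X_point_starting_with[OF rangeI])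
  then show ?thesis
    by blast
qed

lemma seq_dist_nonneg: "0 \<le> seq_dist x y"
  unfolding seq_dist_def by (intro infsum_nonneg) auto

lemma seq_dist_sym: "seq_dist x y = seq_dist y x"
  by (simp add: seq_dist_def abs_minus_commute)

lemma seq_dist_sums:
  assumes "x \<in> X" "y \<in> X"
  shows "(\<lambda>n. \<bar>x n - y n\<bar> / 2 ^ Suc n) sums seq_dist x y"
proof -
  have "(\<lambda>n. \<bar>x n - y n\<bar> / 2 ^ Suc n) summable_on UNIV"
    by (rule seq_dist_summable) (intro X_range assms)+
  then show ?thesis
    unfolding seq_dist_def by (intro has_sum_imp_sums has_sum_infsum)
qed

text \<open>
The distance is self-similar; all its metric properties below follow from this identity by induction.
\<close>

lemma seq_dist_split:
  assumes "x \<in> X" "y \<in> X"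
  shows "seq_dist x y = \<bar>x 0 - y 0\<bar> / 2 + seq_dist (shift x) (shift y) / 2"
proof -
  have "(\<lambda>n. \<bar>shift x n - shift y n\<bar> / 2 ^ Suc n / 2) sums (seq_dist (shift x) (shift y) / 2)"
    by (intro sums_divide seq_dist_sums shift_in_X assms)
  then have "(\<lambda>n. \<bar>x (Suc n) - y (Suc n)\<bar> / 2 ^ Suc (Suc n)) sums (seq_dist (shift x) (shift y) / 2)"
    by (simp add: shift_def mult_ac)
  from sums_Suc[OF this] have "(\<lambda>n. \<bar>x n - y n\<bar> / 2 ^ Suc n) sums (seq_dist (shift x) (shift y) / 2 + \<bar>x 0 - y 0\<bar> / 2)"
    by simp
  with seq_dist_sums[OF assms] show ?thesis
    by (simp add: sums_iff)
qed

lemma seq_dist_le_1: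
  assumes "x \<in> X" "y \<in> X"
  shows "seq_dist x y \<le> 1"
proof (rule sums_le[OF _ seq_dist_sums[OF assms]])
  show "(\<lambda>n. (1 / 2) ^ Suc n) sums (1 :: real)"
    using power_half_series .
  show "\<bar>x n - y n\<bar> / 2 ^ Suc n \<le> (1 / 2) ^ Suc n" for n
    using X_range[OF assms(1), of n] X_range[OF assms(2), of n] by (auto simp: power_divide field_simps)
qed

lemma seq_dist_prepend:
  "x \<in> X \<Longrightarrow> y \<in> X \<Longrightarrow> prepend a x \<in> X \<Longrightarrow> prepend a y \<in> X \<Longrightarrow> seq_dist (prepend a x) (prepend a y) = seq_dist x y / 2"
  using seq_dist_split[of "prepend a x" "prepend a y"] by simp

lemma seq_dist_shift: "x \<in> X \<Longrightarrow> y \<in> X \<Longrightarrow> seq_dist (shift x) (shift y) \<le> 2 * seq_dist x y"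
  using seq_dist_split[of x y] by simp

lemma seq_dist_ge_coordinate:
  "x \<in> X \<Longrightarrow> y \<in> X \<Longrightarrow> \<bar>x n - y n\<bar> / 2 ^ Suc n \<le> seq_dist x y"
proof (induction n arbitrary: x y)
  case 0
  then show ?case
    using seq_dist_split[of x y] seq_dist_nonneg[of "shift x" "shift y"] by simp
next
  case (Suc n)
  from Suc.IH[OF shift_in_X[OF Suc.prems(1)] shift_in_X[OF Suc.prems(2)]]
  have "\<bar>x (Suc n) - y (Suc n)\<bar> / 2 ^ Suc (Suc n) \<le> seq_dist (shift x) (shift y) / 2"
    by (simp add: shift_def)
  also have "\<dots> \<le> seq_dist x y"
    using seq_dist_split[OF Suc.prems] by simp
  finally show ?case .
qed

lemma seq_dist_le_agree:
  "x \<in> X \<Longrightarrow> y \<in> X \<Longrightarrow> (\<And>i. i < n \<Longrightarrow> x i = y i) \<Longrightarrow> seq_dist x y \<le> (1 / 2) ^ n"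
proof (induction n arbitrary: x y)
  case 0
  then show ?case
    using seq_dist_le_1 by simp
next
  case (Suc n)
  have "seq_dist (shift x) (shift y) \<le> (1 / 2) ^ n"
    by (rule Suc.IH[OF shift_in_X[OF Suc.prems(1)] shift_in_X[OF Suc.prems(2)]])
      (simp add: shift_def Suc.prems(3))
  with Suc.prems(3)[of 0] seq_dist_split[OF Suc.prems(1,2)] show ?case
    by simp
qed

text \<open>
No symbol is a limit of other symbols, since the symbols increase.
\<close>

lemma symbol_gap_exists: "\<exists>g>0. \<forall>j. j \<noteq> k \<longrightarrow> g \<le> \<bar>b j - b k\<bar>"
proof -
  have up: "b (Suc k) - b k \<le> \<bar>b j - b k\<bar>" if "k < j" for j
    using strict_mono_less_eq[OF alphabet_increasing, of "Suc k" j] that by simp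
  have less: "b i < b j" if "i < j" for i j
    using strict_mono_less[OF alphabet_increasing] that by simp
  show ?thesis
  proof (cases k)
    case 0
    with up less[of k "Suc k"] show ?thesis
      by (intro exI[of _ "b (Suc k) - b k"]) auto
  next
    case (Suc i)
    have down: "b k - b i \<le> \<bar>b j - b k\<bar>" if "j < k" for j
      using strict_mono_less_eq[OF alphabet_increasing, of j i] that Suc by simp
    show ?thesis
    proof (intro exI[of _ "min (b (Suc k) - b k) (b k - b i)"] conjI allI impI)
      show "0 < min (b (Suc k) - b k) (b k - b i)"
        using less[of k "Suc k"] less[of i k] Suc by simp
      show "min (b (Suc k) - b k) (b k - b i) \<le> \<bar>b j - b k\<bar>" if "j \<noteq> k" for j
        using up[of j] down[of j] that by linarith
    qed
  qed
qed

definition symbol_gap :: "nat \<Rightarrow> real" where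
  "symbol_gap k = (SOME g. g > 0 \<and> (\<forall>j. j \<noteq> k \<longrightarrow> g \<le> \<bar>b j - b k\<bar>))"

lemma symbol_gap: "symbol_gap k > 0" "j \<noteq> k \<Longrightarrow> symbol_gap k \<le> \<bar>b j - b k\<bar>"
proof -
  have "symbol_gap k > 0 \<and> (\<forall>j. j \<noteq> k \<longrightarrow> symbol_gap k \<le> \<bar>b j - b k\<bar>)"
    unfolding symbol_gap_def by (rule someI_ex[OF symbol_gap_exists])
  then show "symbol_gap k > 0" "j \<noteq> k \<Longrightarrow> symbol_gap k \<le> \<bar>b j - b k\<bar>"
    by simp_all
qed

definition index :: "(nat \<Rightarrow> real) \<Rightarrow> nat \<Rightarrow> nat" where
  "index x n = inv b (x n)"

lemma b_index: "x \<in> X \<Longrightarrow> b (index x n) = x n"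
  unfolding index_def by (rule f_inv_into_f[OF X_symbol])

lemma index_eqI: "x n = b k \<Longrightarrow> index x n = k"
  by (simp add: index_def inv_f_f[OF b_inj])

definition tail_start :: nat where
  "tail_start = (SOME j0. \<forall>j\<ge>j0. \<forall>i. A (b i) (b j) = A (b i) (b j0))"

lemma tail_start: "tail_start \<le> j \<Longrightarrow> A (b i) (b j) = A (b i) (b tail_start)"
proof -
  have "\<forall>j\<ge>tail_start. \<forall>i. A (b i) (b j) = A (b i) (b tail_start)"
    unfolding tail_start_def by (rule someI_ex[OF columns_eventually_constant])
  then show "tail_start \<le> j \<Longrightarrow> A (b i) (b j) = A (b i) (b tail_start)"
    by blast
qed

text \<open>
The type of a point stands for the column of \<open>A\<close> at its first symbol. All symbols from index \<open>tail_start\<close> on have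
the same column and are given the same type; earlier symbols are kept apart even when their columns agree.
\<close>

definition ty :: "(nat \<Rightarrow> real) \<Rightarrow> nat" where
  "ty x = min (index x 0) tail_start"

lemma finite_ty: "finite (ty ` X)"
proof (rule finite_subset)
  show "ty ` X \<subseteq> {..tail_start}"
    by (intro image_subsetI) (simp add: ty_def)
qed simp

lemma pred_eq_min: "pred (b k) = pred (b (min k tail_start))"
proof (cases "k \<le> tail_start")
  case False
  then have k: "tail_start \<le> k" "min k tail_start = tail_start"
    by simp_all
  have "A a (b k) = A a (b tail_start)" if "a \<in> range b" for a
    using tail_start[OF k(1)] that by (elim imageE) (simp only:)
  then show ?thesis
    unfolding pred_def k(2) by (intro Collect_cong conj_cong refl) (simp only:)
qed simp

lemma pred_eq_ty: "x \<in> X \<Longrightarrow> pred (x 0) = pred (b (ty x))"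
  using pred_eq_min[of "index x 0"] by (simp only: ty_def b_index)

lemma pred_cong_ty: "x \<in> X \<Longrightarrow> y \<in> X \<Longrightarrow> ty x = ty y \<Longrightarrow> pred (x 0) = pred (y 0)"
  by (simp only: pred_eq_ty)

lemma dist_ge_gap:
  assumes "x \<in> X" "y \<in> X" "index x n \<noteq> index y n"
  shows "symbol_gap (index x n) / 2 ^ Suc n \<le> seq_dist x y"
proof -
  have "symbol_gap (index x n) \<le> \<bar>x n - y n\<bar>"
    using symbol_gap(2)[of "index y n" "index x n"] assms by (simp add: b_index abs_minus_commute)
  then have "symbol_gap (index x n) / 2 ^ Suc n \<le> \<bar>x n - y n\<bar> / 2 ^ Suc n"
    by (intro divide_right_mono) auto
  also have "\<dots> \<le> seq_dist x y"
    using assms by (intro seq_dist_ge_coordinate)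
  finally show ?thesis .
qed

text \<open>
Points of different types differ in the first symbol, and one of the two symbols is among the finitely many with
index below \<open>tail_start\<close>.
\<close>

lemma types_separated:
  obtains g where "0 < g" "\<And>x y. x \<in> X \<Longrightarrow> y \<in> X \<Longrightarrow> ty x \<noteq> ty y \<Longrightarrow> g \<le> seq_dist x y"
proof
  let ?g = "Min (symbol_gap ` {..tail_start}) / 2"
  show "0 < ?g"
    using symbol_gap(1) by simp
  have *: "?g \<le> seq_dist x y" if "x \<in> X" "y \<in> X" "ty x \<noteq> ty y" "index x 0 < tail_start" for x y
  proof -
    have "Min (symbol_gap ` {..tail_start}) \<le> symbol_gap (index x 0)"
      using that by (intro Min_le) auto
    also have "symbol_gap (index x 0) \<le> 2 * seq_dist x y"
    proof -
      have "index x 0 \<noteq> index y 0"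
      proof
        assume "index x 0 = index y 0"
        with that(3) show False
          by (simp add: ty_def)
      qed
      from dist_ge_gap[OF that(1,2) this] show ?thesis
        by simp
    qed
    finally show ?thesis
      by simp
  qed
  fix x y assume xy: "x \<in> X" "y \<in> X" "ty x \<noteq> ty y"
  have "index x 0 < tail_start \<or> index y 0 < tail_start"
  proof (rule ccontr)
    assume "\<not> ?thesis"
    then have "ty x = tail_start" "ty y = tail_start"
      by (simp_all add: ty_def)
    with xy(3) show False
      by simp
  qed
  then show "?g \<le> seq_dist x y"
  proof
    assume "index x 0 < tail_start"
    from *[OF xy this] show ?thesis .
  next
    assume "index y 0 < tail_start"
    from *[OF xy(2,1) not_sym[OF xy(3)] this] show ?thesis
      by (subst seq_dist_sym)
  qed
qed

end

section \<open>The Ruelle operator on the Hoelder cone\<close>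

locale ruelle_potential = countable_markov_shift b A for b A +
  fixes \<alpha> :: real and \<phi> \<phi>0 :: "(nat \<Rightarrow> real) \<Rightarrow> real" and p :: "real \<Rightarrow> real"
  assumes alpha_pos: "0 < \<alpha>"
    and phi0_holder: "\<phi>0 \<in> holder_space (shift_space (range b) A) \<alpha>"
    and p_pos: "\<And>k. 0 < p (b k)"
    and p_sums: "(\<lambda>k. p (b k)) sums 1"
    and phi_eq: "\<And>x. x \<in> shift_space (range b) A \<Longrightarrow> \<phi> x = \<phi>0 x + ln (p (x 0))"
begin

abbreviation "L \<equiv> ruelle (range b) A \<phi>"

definition hdist :: "(nat \<Rightarrow> real) \<Rightarrow> (nat \<Rightarrow> real) \<Rightarrow> real" where
  "hdist x y = seq_dist x y powr \<alpha>"

text \<open>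
Prepending a symbol multiplies the distance by \<open>1 / 2\<close> and its \<open>\<alpha>\<close>-th power by \<open>theta\<close>.
\<close>

definition theta :: real where "theta = (1 / 2) powr \<alpha>"

lemma theta: "0 < theta" "theta < 1"
  using alpha_pos powr_less_mono2[of \<alpha> "1 / 2" 1] by (auto simp: theta_def)

lemma hdist_nonneg: "0 \<le> hdist x y"
  by (simp add: hdist_def)

lemma hdist_le_1: "x \<in> X \<Longrightarrow> y \<in> X \<Longrightarrow> hdist x y \<le> 1"
  unfolding hdist_def using alpha_pos seq_dist_nonneg seq_dist_le_1 by (intro powr_le1) auto

lemma hdist_sym: "hdist x y = hdist y x"
  unfolding hdist_def by (subst seq_dist_sym) (rule refl)

lemma hdist_prepend:
  assumes "x \<in> X" "y \<in> X" "a \<in> pred (x 0)" "a \<in> pred (y 0)"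
  shows "hdist (prepend a x) (prepend a y) = theta * hdist x y"
proof -
  have "seq_dist (prepend a x) (prepend a y) = seq_dist x y * (1 / 2)"
    using seq_dist_prepend[OF assms(1,2)] prepend_in_X assms by simp
  then show ?thesis
    using seq_dist_nonneg[of x y] by (simp only: hdist_def theta_def powr_mult mult.commute)
qed

lemma holder_spaceE:
  fixes h :: "(nat \<Rightarrow> real) \<Rightarrow> 'v::real_normed_vector"
  assumes "h \<in> holder_space X \<alpha>"
  obtains C where "0 \<le> C" "\<And>x. x \<notin> X \<Longrightarrow> h x = 0" "\<And>x y. x \<in> X \<Longrightarrow> y \<in> X \<Longrightarrow> norm (h x - h y) \<le> C * hdist x y"
    "\<And>x. x \<in> X \<Longrightarrow> norm (h x) \<le> C"
proof -
  obtain C0 where C0: "\<And>x. x \<notin> X \<Longrightarrow> h x = 0" "\<And>x y. x \<in> X \<Longrightarrow> y \<in> X \<Longrightarrow> norm (h x - h y) \<le> C0 * hdist x y"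
    using assms unfolding holder_space_def hdist_def by blast
  obtain z where z: "z \<in> X"
    using X_nonempty by blast
  define C where "C = \<bar>C0\<bar> + norm (h z)"
  have le: "norm (h x - h y) \<le> \<bar>C0\<bar> * hdist x y" if "x \<in> X" "y \<in> X" for x y
  proof -
    have "C0 * hdist x y \<le> \<bar>C0\<bar> * hdist x y"
      by (intro mult_right_mono hdist_nonneg) simp
    with C0(2)[OF that] show ?thesis
      by linarith
  qed
  show thesis
  proof (rule that[of C])
    show "norm (h x - h y) \<le> C * hdist x y" if "x \<in> X" "y \<in> X" for x y
    proof -
      have "\<bar>C0\<bar> * hdist x y \<le> C * hdist x y"
        by (intro mult_right_mono hdist_nonneg) (simp add: C_def)
      with le[OF that] show ?thesis
        by linarith
    qed
    show "norm (h x) \<le> C" if "x \<in> X" for x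
    proof -
      have "\<bar>C0\<bar> * hdist x z \<le> \<bar>C0\<bar> * 1"
        by (intro mult_left_mono hdist_le_1 that z) simp
      moreover have "norm (h x) \<le> norm (h x - h z) + norm (h z)"
        using norm_triangle_ineq[of "h x - h z" "h z"] by simp
      ultimately show ?thesis
        using le[OF that z] by (simp add: C_def)
    qed
  qed (use C0(1) in \<open>simp_all add: C_def\<close>)
qed

lemma holder_spaceI:
  fixes g :: "(nat \<Rightarrow> real) \<Rightarrow> 'v::real_normed_vector"
  assumes "\<And>x. x \<notin> X \<Longrightarrow> g x = 0" "\<And>x y. x \<in> X \<Longrightarrow> y \<in> X \<Longrightarrow> norm (g x - g y) \<le> C * hdist x y"
  shows "g \<in> holder_space X \<alpha>"
  using assms unfolding holder_space_def hdist_def by blast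

definition phi0_bound :: real where
  "phi0_bound = (SOME C. 0 \<le> C \<and> (\<forall>x\<in>X. \<forall>y\<in>X. norm (\<phi>0 x - \<phi>0 y) \<le> C * hdist x y) \<and> (\<forall>x\<in>X. norm (\<phi>0 x) \<le> C))"

lemma phi0_bound:
  shows "0 \<le> phi0_bound"
    and "x \<in> X \<Longrightarrow> y \<in> X \<Longrightarrow> \<bar>\<phi>0 x - \<phi>0 y\<bar> \<le> phi0_bound * hdist x y"
    and "x \<in> X \<Longrightarrow> \<bar>\<phi>0 x\<bar> \<le> phi0_bound"
proof -
  have "0 \<le> phi0_bound \<and> (\<forall>x\<in>X. \<forall>y\<in>X. norm (\<phi>0 x - \<phi>0 y) \<le> phi0_bound * hdist x y) \<and> (\<forall>x\<in>X. norm (\<phi>0 x) \<le> phi0_bound)"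
    unfolding phi0_bound_def by (rule someI_ex) (metis holder_spaceE[OF phi0_holder])
  then show "0 \<le> phi0_bound"
    and "x \<in> X \<Longrightarrow> y \<in> X \<Longrightarrow> \<bar>\<phi>0 x - \<phi>0 y\<bar> \<le> phi0_bound * hdist x y"
    and "x \<in> X \<Longrightarrow> \<bar>\<phi>0 x\<bar> \<le> phi0_bound"
    by simp_all
qed

text \<open>
The solution of \<open>theta * (B + phi0_bound) = B - 1\<close>, whose left side is the constant of the cone into which the
Ruelle operator maps the cone with constant \<open>B\<close>.
\<close>

definition aperture :: real where "aperture = (theta * phi0_bound + 1) / (1 - theta)"

lemma aperture: "theta * (aperture + phi0_bound) = aperture - 1" "1 \<le> aperture"
proof -
  have "aperture * (1 - theta) = theta * phi0_bound + 1"
    using theta by (simp add: aperture_def)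
  then show "theta * (aperture + phi0_bound) = aperture - 1"
    by (simp add: algebra_simps)
  have "0 \<le> theta * phi0_bound"
    using theta phi0_bound(1) by simp
  then have "1 - theta \<le> theta * phi0_bound + 1"
    using theta(1) by linarith
  then show "1 \<le> aperture"
    using theta by (simp add: aperture_def pos_le_divide_eq)
qed

sublocale type_space X ty hdist aperture
  by unfold_locales
    (rule X_nonempty hdist_nonneg hdist_le_1 hdist_sym finite_ty aperture(2); assumption?)+

lemma p_has_sum: "(p has_sum 1) (range b)"
proof -
  have "((p \<circ> b) has_sum 1) UNIV"
    unfolding comp_def using p_sums p_pos by (intro sums_nonneg_imp_has_sum) (auto intro: less_imp_le)
  then show ?thesis
    by (subst has_sum_reindex[OF b_inj])
qed

lemma p_summable: "p summable_on range b"
  using p_has_sum by (rule has_sum_imp_summable)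

lemma pred_subset: "pred r \<subseteq> range b"
  by (auto simp: pred_def)

lemma p_nonneg: "a \<in> range b \<Longrightarrow> 0 \<le> p a" and p_gt_0: "a \<in> range b \<Longrightarrow> 0 < p a"
  using p_pos by (auto intro: less_imp_le)

lemma p_pred_nonneg: "a \<in> pred r \<Longrightarrow> 0 \<le> p a"
  by (rule p_nonneg) (simp add: pred_def)

lemma p_summable_subset: "Y \<subseteq> range b \<Longrightarrow> p summable_on Y"
  using p_summable by (rule summable_on_subset_banach)

text \<open>
The weight \<open>exp (\<phi> (prepend a x))\<close> is \<open>p a\<close> up to this factor in either direction.
\<close>

definition weight_bound :: real where "weight_bound = exp phi0_bound"

lemma weight_bound: "0 < weight_bound"
  by (simp add: weight_bound_def)

lemma weight:
  assumes "x \<in> X" "a \<in> pred (x 0)"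
  shows "exp (\<phi> (prepend a x)) = p a * exp (\<phi>0 (prepend a x))"
  using phi_eq[OF prepend_in_X[OF assms]] p_gt_0[of a] pred_subset assms(2)
  by (auto simp: exp_add mult.commute)

lemma weight_le:
  assumes "x \<in> X" "a \<in> pred (x 0)"
  shows "exp (\<phi> (prepend a x)) \<le> weight_bound * p a"
proof -
  have "exp (\<phi>0 (prepend a x)) \<le> weight_bound"
    using phi0_bound(3)[OF prepend_in_X[OF assms]] by (simp add: weight_bound_def)
  then show ?thesis
    using p_nonneg[of a] pred_subset assms(2) unfolding weight[OF assms] by (subst mult.commute) (intro mult_right_mono, auto)
qed

lemma weight_ge:
  assumes "x \<in> X" "a \<in> pred (x 0)"
  shows "p a * exp (- phi0_bound) \<le> exp (\<phi> (prepend a x))"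
  using phi0_bound(3)[OF prepend_in_X[OF assms]] p_nonneg[of a] pred_subset assms(2) unfolding weight[OF assms]
  by (intro mult_left_mono) auto

lemma L_eq: "x \<in> X \<Longrightarrow> L \<xi> x = (\<Sum>\<^sub>\<infinity>a\<in>pred (x 0). exp (\<phi> (prepend a x)) *\<^sub>R \<xi> (prepend a x))"
  by (simp add: ruelle_def pred_def)

lemma L_off: "x \<notin> X \<Longrightarrow> L \<xi> x = 0"
  by (simp add: ruelle_def)

lemma L_abs_summable:
  fixes \<xi> :: "(nat \<Rightarrow> real) \<Rightarrow> 'v::banach"
  assumes "x \<in> X" "\<And>y. y \<in> X \<Longrightarrow> norm (\<xi> y) \<le> M"
  shows "(\<lambda>a. exp (\<phi> (prepend a x)) *\<^sub>R \<xi> (prepend a x)) abs_summable_on pred (x 0)"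
proof -
  have "(\<lambda>a. (weight_bound * M) * p a) summable_on pred (x 0)"
    by (intro summable_on_cmult_right p_summable_subset pred_subset)
  moreover have "norm (exp (\<phi> (prepend a x)) *\<^sub>R \<xi> (prepend a x)) \<le> (weight_bound * M) * p a" if a: "a \<in> pred (x 0)" for a
  proof -
    have "norm (exp (\<phi> (prepend a x)) *\<^sub>R \<xi> (prepend a x)) = exp (\<phi> (prepend a x)) * norm (\<xi> (prepend a x))"
      by simp
    also have "\<dots> \<le> (weight_bound * p a) * M"
      using a p_pred_nonneg[OF a] weight_bound
      by (intro mult_mono weight_le[OF assms(1)] assms(2) prepend_in_X[OF assms(1)]) auto
    finally show ?thesis
      by (simp add: mult_ac)
  qed
  ultimately show ?thesis
    by (rule summable_on_comparison_test) simp_all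
qed

lemma L_summable:
  assumes "x \<in> X" "\<xi> \<in> bounded_on X"
  shows "(\<lambda>a. exp (\<phi> (prepend a x)) * \<xi> (prepend a x)) summable_on pred (x 0)"
proof -
  obtain M where "\<And>y. y \<in> X \<Longrightarrow> norm (\<xi> y) \<le> M"
    using assms(2) unfolding bounded_on_def real_norm_def by blast
  from abs_summable_summable[OF L_abs_summable[OF assms(1) this]] show ?thesis
    by simp
qed

lemma L_real_eq:
  fixes \<xi> :: "(nat \<Rightarrow> real) \<Rightarrow> real"
  shows "x \<in> X \<Longrightarrow> L \<xi> x = (\<Sum>\<^sub>\<infinity>a\<in>pred (x 0). exp (\<phi> (prepend a x)) * \<xi> (prepend a x))"
  by (simp add: L_eq)

lemma L_add:
  assumes "f \<in> bounded_on X" "g \<in> bounded_on X"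
  shows "L (\<lambda>x. f x + g x) = (\<lambda>x. L f x + L g x)"
proof
  fix x
  show "L (\<lambda>x. f x + g x) x = L f x + L g x"
  proof (cases "x \<in> X")
    case True
    then show ?thesis
      using infsum_add[OF L_summable[OF True assms(1)] L_summable[OF True assms(2)]]
      by (simp add: L_real_eq distrib_left)
  qed (simp add: L_off)
qed

lemma L_scale:
  fixes f :: "(nat \<Rightarrow> real) \<Rightarrow> real"
  shows "L (\<lambda>x. k * f x) = (\<lambda>x. k * L f x)"
proof
  fix x
  show "L (\<lambda>x. k * f x) x = k * L f x"
  proof (cases "x \<in> X")
    case True
    then show ?thesis
      using infsum_cmult_right'[of k "\<lambda>a. exp (\<phi> (prepend a x)) * f (prepend a x)" "pred (x 0)"]
      by (simp add: L_real_eq mult_ac)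
  qed (simp add: L_off)
qed

lemma L_nonneg:
  fixes f :: "(nat \<Rightarrow> real) \<Rightarrow> real"
  assumes "\<And>y. y \<in> X \<Longrightarrow> 0 \<le> f y" "x \<in> X"
  shows "0 \<le> L f x"
  unfolding L_real_eq[OF assms(2)]
  by (intro infsum_nonneg mult_nonneg_nonneg assms(1) prepend_in_X[OF assms(2)]) simp_all

lemma L_norm_le:
  fixes f :: "(nat \<Rightarrow> real) \<Rightarrow> 'v::banach"
  assumes "\<And>y. y \<in> X \<Longrightarrow> norm (f y) \<le> t" "x \<in> X" "0 \<le> t"
  shows "norm (L f x) \<le> weight_bound * t"
proof -
  have "norm (L f x) \<le> (\<Sum>\<^sub>\<infinity>a\<in>pred (x 0). norm (exp (\<phi> (prepend a x)) *\<^sub>R f (prepend a x)))"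
    unfolding L_eq[OF assms(2)] by (intro norm_infsum_bound L_abs_summable[OF assms(2,1)])
  also have "\<dots> \<le> (\<Sum>\<^sub>\<infinity>a\<in>pred (x 0). (weight_bound * t) * p a)"
  proof (rule infsum_mono)
    show "(\<lambda>a. norm (exp (\<phi> (prepend a x)) *\<^sub>R f (prepend a x))) summable_on pred (x 0)"
      by (rule L_abs_summable[OF assms(2,1)])
    show "(\<lambda>a. (weight_bound * t) * p a) summable_on pred (x 0)"
      by (intro summable_on_cmult_right p_summable_subset pred_subset)
    fix a assume a: "a \<in> pred (x 0)"
    have "norm (exp (\<phi> (prepend a x)) *\<^sub>R f (prepend a x)) = exp (\<phi> (prepend a x)) * norm (f (prepend a x))"
      by simp
    also have "\<dots> \<le> (weight_bound * p a) * t"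
      using a p_pred_nonneg[OF a] weight_bound
      by (intro mult_mono weight_le[OF assms(2)] assms(1) prepend_in_X[OF assms(2)]) auto
    finally show "norm (exp (\<phi> (prepend a x)) *\<^sub>R f (prepend a x)) \<le> (weight_bound * t) * p a"
      by (simp add: mult_ac)
  qed
  also have "\<dots> = (weight_bound * t) * infsum p (pred (x 0))"
    by (rule infsum_cmult_right')
  also have "\<dots> \<le> (weight_bound * t) * infsum p (range b)"
    using weight_bound assms(3) p_nonneg by (intro mult_left_mono infsum_mono2 p_summable_subset pred_subset p_summable) auto
  also have "infsum p (range b) = 1"
    using p_has_sum by (rule infsumI)
  finally show ?thesis
    by simp
qed

lemma L_bounded:
  assumes "f \<in> bounded_on X"
  shows "L f \<in> bounded_on X"
proof -
  obtain M where "\<And>y. y \<in> X \<Longrightarrow> norm (f y) \<le> M"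
    using assms unfolding bounded_on_def real_norm_def by blast
  then have "\<And>y. y \<in> X \<Longrightarrow> norm (f y) \<le> \<bar>M\<bar>"
    by fastforce
  from L_norm_le[OF this] have "\<bar>L f x\<bar> \<le> weight_bound * \<bar>M\<bar>" if "x \<in> X" for x
    using that by simp
  then show ?thesis
    unfolding bounded_on_def using L_off by blast
qed

lemma L_diff:
  assumes "f \<in> bounded_on X" "g \<in> bounded_on X"
  shows "L (\<lambda>x. f x - g x) = (\<lambda>x. L f x - L g x)"
  using L_add[OF assms(1) bounded_on_scale[OF assms(2), of "-1"]] L_scale[of "-1" g] by simp

lemma L_mono:
  assumes "f \<in> bounded_on X" "g \<in> bounded_on X" "\<And>y. y \<in> X \<Longrightarrow> f y \<le> g y" "x \<in> X"
  shows "L f x \<le> L g x"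
  using L_nonneg[of "\<lambda>x. g x - f x" x] assms L_diff[OF assms(2,1)] by simp

lemma L_ge_term:
  assumes "f \<in> bounded_on X" "\<And>y. y \<in> X \<Longrightarrow> 0 \<le> f y" "x \<in> X" "a \<in> pred (x 0)"
  shows "p a * exp (- phi0_bound) * f (prepend a x) \<le> L f x"
proof -
  have "p a * exp (- phi0_bound) * f (prepend a x) \<le> exp (\<phi> (prepend a x)) * f (prepend a x)"
    by (intro mult_right_mono weight_ge assms prepend_in_X)
  also have "\<dots> = (\<Sum>a\<in>{a}. exp (\<phi> (prepend a x)) * f (prepend a x))"
    by simp
  also have "\<dots> \<le> L f x"
    unfolding L_real_eq[OF assms(3)] using assms(4)
    by (intro finite_sum_le_infsum L_summable assms mult_nonneg_nonneg prepend_in_X) auto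
  finally show ?thesis .
qed

text \<open>
Points of the same type have the same predecessors, so the two sums can be compared term by term. Each term
contributes the Hoelder constant of \<open>\<phi>0\<close> and the constant of \<open>h\<close>, at a distance shortened by \<open>theta\<close>.
\<close>

lemma L_cone:
  assumes h: "h \<in> hcone aperture"
  shows "L h \<in> hcone (aperture - 1)"
proof -
  have "L h x \<le> exp ((aperture - 1) * hdist x y) * L h y" if x: "x \<in> X" and y: "y \<in> X" and xy: "ty x = ty y" for x y
  proof -
    have pr: "pred (x 0) = pred (y 0)"
      by (rule pred_cong_ty[OF x y xy])
    have hb: "h \<in> bounded_on X"
      by (rule cone_bounded[OF h])
    have "L h x \<le> (\<Sum>\<^sub>\<infinity>a\<in>pred (x 0). exp ((aperture - 1) * hdist x y) * (exp (\<phi> (prepend a y)) * h (prepend a y)))"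
      unfolding L_real_eq[OF x]
    proof (rule infsum_mono)
      show "(\<lambda>a. exp (\<phi> (prepend a x)) * h (prepend a x)) summable_on pred (x 0)"
        by (rule L_summable[OF x hb])
      show "(\<lambda>a. exp ((aperture - 1) * hdist x y) * (exp (\<phi> (prepend a y)) * h (prepend a y))) summable_on pred (x 0)"
        unfolding pr by (intro summable_on_cmult_right L_summable[OF y hb])
      fix a assume a: "a \<in> pred (x 0)"
      have ax: "prepend a x \<in> X" and ay: "prepend a y \<in> X"
        using prepend_in_X[OF x a] prepend_in_X[OF y] a pr by auto
      have d: "hdist (prepend a x) (prepend a y) = theta * hdist x y"
        using a pr by (intro hdist_prepend x y) auto
      have "ty (prepend a x) = ty (prepend a y)"
        by (simp add: ty_def index_def)
      then have 1: "h (prepend a x) \<le> exp (aperture * (theta * hdist x y)) * h (prepend a y)"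
        using holder_coneD(3)[OF h ax ay] d by simp
      have "\<phi>0 (prepend a x) \<le> phi0_bound * (theta * hdist x y) + \<phi>0 (prepend a y)"
        using phi0_bound(2)[OF ax ay] d by (simp add: abs_le_iff)
      then have "exp (\<phi>0 (prepend a x)) \<le> exp (phi0_bound * (theta * hdist x y)) * exp (\<phi>0 (prepend a y))"
        by (simp flip: exp_add)
      then have 2: "exp (\<phi> (prepend a x)) \<le> exp (phi0_bound * (theta * hdist x y)) * exp (\<phi> (prepend a y))"
        using mult_left_mono[OF _ p_nonneg[of a], of "exp (\<phi>0 (prepend a x))" "exp (phi0_bound * (theta * hdist x y)) * exp (\<phi>0 (prepend a y))"]
          a pred_subset[of "x 0"] weight[OF x a] weight[OF y] pr by (auto simp: mult_ac)
      have "exp (\<phi> (prepend a x)) * h (prepend a x) \<le>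
          (exp (phi0_bound * (theta * hdist x y)) * exp (\<phi> (prepend a y))) * (exp (aperture * (theta * hdist x y)) * h (prepend a y))"
        by (intro mult_mono 1 2 holder_coneD(2)[OF h] ax) auto
      also have "\<dots> = exp (phi0_bound * (theta * hdist x y) + aperture * (theta * hdist x y)) * (exp (\<phi> (prepend a y)) * h (prepend a y))"
        by (simp add: exp_add mult_ac)
      also have "phi0_bound * (theta * hdist x y) + aperture * (theta * hdist x y) = (aperture - 1) * hdist x y"
        unfolding aperture(1)[symmetric] by (simp add: algebra_simps)
      finally show "exp (\<phi> (prepend a x)) * h (prepend a x) \<le> exp ((aperture - 1) * hdist x y) * (exp (\<phi> (prepend a y)) * h (prepend a y))" .
    qed
    also have "\<dots> = exp ((aperture - 1) * hdist x y) * L h y"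
      unfolding L_real_eq[OF y] pr by (rule infsum_cmult_right')
    finally show ?thesis .
  qed
  then show ?thesis
    using L_nonneg[of h] holder_coneD(2)[OF h] L_off by (auto simp: holder_cone_def)
qed

lemma L_cone': "h \<in> hcone aperture \<Longrightarrow> L h \<in> hcone aperture"
  using cone_mono[OF L_cone] by simp

lemma Liter_cone': "h \<in> hcone aperture \<Longrightarrow> (L ^^ n) h \<in> hcone aperture"
  by (induction n) (simp_all add: L_cone')

lemma Liter_cone: "h \<in> hcone aperture \<Longrightarrow> 0 < n \<Longrightarrow> (L ^^ n) h \<in> hcone (aperture - 1)"
  by (cases n) (simp_all add: L_cone Liter_cone')

lemma Liter_bounded: "h \<in> bounded_on X \<Longrightarrow> (L ^^ n) h \<in> bounded_on X"
  by (induction n) (simp_all add: L_bounded)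

lemma Liter_add: "f \<in> bounded_on X \<Longrightarrow> g \<in> bounded_on X \<Longrightarrow> (L ^^ n) (\<lambda>x. f x + g x) = (\<lambda>x. (L ^^ n) f x + (L ^^ n) g x)"
  by (induction n) (simp_all add: L_add Liter_bounded)

lemma Liter_scale:
  fixes f :: "(nat \<Rightarrow> real) \<Rightarrow> real"
  shows "(L ^^ n) (\<lambda>x. k * f x) = (\<lambda>x. k * (L ^^ n) f x)"
  by (induction n) (simp_all add: L_scale)

lemma Liter_nonneg:
  fixes f :: "(nat \<Rightarrow> real) \<Rightarrow> real"
  assumes "\<And>y. y \<in> X \<Longrightarrow> 0 \<le> f y" "x \<in> X"
  shows "0 \<le> (L ^^ n) f x"
  using assms(2) by (induction n arbitrary: x) (auto intro: L_nonneg assms(1))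

lemma Liter_norm_le:
  fixes f :: "(nat \<Rightarrow> real) \<Rightarrow> 'v::banach"
  assumes "\<And>y. y \<in> X \<Longrightarrow> norm (f y) \<le> t" "x \<in> X" "0 \<le> t"
  shows "norm ((L ^^ n) f x) \<le> weight_bound ^ n * t"
  using assms(2)
proof (induction n arbitrary: x)
  case (Suc n)
  then show ?case
    using L_norm_le[of "(L ^^ n) f" "weight_bound ^ n * t" x] assms(3) weight_bound by (simp add: mult.assoc)
qed (use assms(1) in simp)

text \<open>
Types are represented by the symbols with index up to \<open>tail_start\<close>; the symbol with index \<open>tail_start\<close>
stands for the common type of all later ones.
\<close>

definition communicating :: "nat set \<Rightarrow> bool" where
  "communicating S \<longleftrightarrow> finite S \<and> 0 \<notin> S \<and>
     (\<forall>i\<le>tail_start. \<forall>j\<le>tail_start. \<exists>k\<in>S. matrix_power (range b) A k (b i) (b j) > 0)"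

text \<open>
There are only finitely many pairs of types, so irreducibility provides finitely many path lengths; aperiodicity
provides a single one.
\<close>

lemma communicating_exists:
  obtains S where "communicating S" "aperiodic_matrix (range b) A \<Longrightarrow> \<exists>k. S = {k}"
proof (cases "aperiodic_matrix (range b) A")
  case True
  then obtain k where "1 \<le> k" "\<forall>i\<in>range b. \<forall>j\<in>range b. matrix_power (range b) A k i j > 0"
    unfolding aperiodic_matrix_def by meson
  then have "communicating {k}"
    by (simp add: communicating_def)
  with that show thesis
    by blast
next
  case False
  have "\<forall>ij. \<exists>k\<ge>1. matrix_power (range b) A k (b (fst ij)) (b (snd ij)) > 0"
    using matrix_irreducible unfolding irreducible_matrix_def by simp
  then obtain kf where kf: "\<forall>ij. 1 \<le> kf ij \<and> matrix_power (range b) A (kf ij) (b (fst ij)) (b (snd ij)) > 0"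
    by (elim choice[THEN exE])
  let ?S = "kf ` ({..tail_start} \<times> {..tail_start})"
  have "communicating ?S"
    unfolding communicating_def
  proof (intro conjI allI impI)
    show "0 \<notin> ?S"
    proof
      assume "0 \<in> ?S"
      then obtain ij where "kf ij = 0"
        by (metis imageE)
      with kf[rule_format, of ij] show False
        by simp
    qed
    fix i j assume "i \<le> tail_start" "j \<le> tail_start"
    with kf[rule_format, of "(i, j)"] show "\<exists>k\<in>?S. matrix_power (range b) A k (b i) (b j) > 0"
      by (intro bexI[of _ "kf (i, j)"]) simp_all
  qed simp
  with that False show thesis
    by blast
qed

text \<open>
An iterate at \<open>y\<close> is bounded below by a fixed multiple of the value at some point beginning with \<open>i\<close>,
namely the endpoint of a path of length \<open>k\<close> prepended to \<open>y\<close>.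
\<close>

definition reaches :: "real \<Rightarrow> nat \<Rightarrow> real \<Rightarrow> (nat \<Rightarrow> real) \<Rightarrow> bool" where
  "reaches i k w y \<longleftrightarrow> (\<forall>h\<in>bounded_on X. (\<forall>x\<in>X. 0 \<le> h x) \<longrightarrow> (\<exists>u\<in>X. u 0 = i \<and> w * h u \<le> (L ^^ k) h y))"

lemma reaches_step:
  assumes l: "l \<in> pred (y 0)" and y: "y \<in> X" and r: "reaches i k w (prepend l y)"
  shows "reaches i (Suc k) (p l * exp (- phi0_bound) * w) y"
  unfolding reaches_def
proof (intro ballI impI)
  fix h assume h: "h \<in> bounded_on X" "\<forall>x\<in>X. 0 \<le> h x"
  with r obtain u where u: "u \<in> X" "u 0 = i" "w * h u \<le> (L ^^ k) h (prepend l y)"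
    unfolding reaches_def by blast
  have "p l * exp (- phi0_bound) * w * h u \<le> p l * exp (- phi0_bound) * (L ^^ k) h (prepend l y)"
    using mult_left_mono[OF u(3), of "p l * exp (- phi0_bound)"] p_pred_nonneg[OF l] by (simp add: mult.assoc)
  also have "\<dots> \<le> L ((L ^^ k) h) y"
    using h(2) by (intro L_ge_term Liter_bounded Liter_nonneg h(1) y l) simp
  finally show "\<exists>u\<in>X. u 0 = i \<and> p l * exp (- phi0_bound) * w * h u \<le> (L ^^ Suc k) h y"
    using u by auto
qed

lemma path_weight:
  assumes "matrix_power (range b) A k i j > 0" "j \<in> range b"
  shows "\<exists>w>0. \<forall>y\<in>X. y 0 = j \<longrightarrow> reaches i k w y"
  using assms
proof (induction k arbitrary: j)
  case 0
  then have "i = j"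
    by (simp split: if_splits)
  then show ?case
    by (intro exI[of _ 1]) (auto simp: reaches_def)
next
  case (Suc k)
  from matrix_power_pos_SucD[OF Suc.prems(1)]
  obtain l where l: "l \<in> range b" "matrix_power (range b) A k i l > 0" "A l j \<noteq> 0"
    by blast
  have "l \<in> pred j"
    using l(1) matrix_nonzero[OF l(1) Suc.prems(2) l(3)] by (simp add: pred_def)
  moreover obtain w where "0 < w" "\<forall>y\<in>X. y 0 = l \<longrightarrow> reaches i k w y"
    using Suc.IH[OF l(2,1)] by blast
  ultimately show ?case
    using p_gt_0[OF l(1)]
    by (intro exI[of _ "p l * exp (- phi0_bound) * w"]) (auto intro!: reaches_step simp: prepend_in_X)
qed

text \<open>
The last step of a path into \<open>b j\<close> may be redirected into any symbol with the same column, so a path into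
one representative serves all points of its type.
\<close>

lemma path_weight_type:
  assumes "matrix_power (range b) A k i (b j) > 0" "0 < k"
  shows "\<exists>w>0. \<forall>y\<in>X. ty y = j \<longrightarrow> reaches i k w y"
proof -
  obtain k' where k: "k = Suc k'"
    using assms(2) by (cases k) simp_all
  from matrix_power_pos_SucD[OF assms(1)[unfolded k]]
  obtain l where l: "l \<in> range b" "matrix_power (range b) A k' i l > 0" "A l (b j) \<noteq> 0"
    by blast
  have lp: "l \<in> pred (b j)"
    using l(1) matrix_nonzero[OF l(1) rangeI l(3)] by (simp add: pred_def)
  obtain w where w: "0 < w" "\<forall>y\<in>X. y 0 = l \<longrightarrow> reaches i k' w y"
    using path_weight[OF l(2,1)] by blast
  have "reaches i k (p l * exp (- phi0_bound) * w) y" if y: "y \<in> X" "ty y = j" for y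
  proof -
    have "l \<in> pred (y 0)"
      using lp y by (simp add: pred_eq_ty)
    then show ?thesis
      unfolding k using w(2) y(1) by (intro reaches_step) (simp_all add: prepend_in_X)
  qed
  with w(1) p_gt_0[OF l(1)] show ?thesis
    by (intro exI[of _ "p l * exp (- phi0_bound) * w"]) simp
qed

lemma uniform_reach:
  assumes "communicating S"
  obtains w where "0 < w" "\<And>i y. i \<le> tail_start \<Longrightarrow> y \<in> X \<Longrightarrow> \<exists>k\<in>S. reaches (b i) k w y"
proof -
  have "\<exists>w>0. \<exists>k\<in>S. \<forall>y\<in>X. ty y = j \<longrightarrow> reaches (b i) k w y" if "i \<le> tail_start" "j \<le> tail_start" for i j
  proof -
    obtain k where k: "k \<in> S" "matrix_power (range b) A k (b i) (b j) > 0"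
      using assms \<open>i \<le> tail_start\<close> \<open>j \<le> tail_start\<close> unfolding communicating_def by blast
    moreover have "0 < k"
      using k(1) assms unfolding communicating_def by (metis gr0I)
    ultimately show ?thesis
      using path_weight_type by blast
  qed
  then have "\<forall>ij\<in>{..tail_start} \<times> {..tail_start}. \<exists>w>0. \<exists>k\<in>S. \<forall>y\<in>X. ty y = snd ij \<longrightarrow> reaches (b (fst ij)) k w y"
    by simp
  from bchoice[OF this] obtain W where W: "\<forall>ij\<in>{..tail_start} \<times> {..tail_start}. 0 < W ij \<and>
      (\<exists>k\<in>S. \<forall>y\<in>X. ty y = snd ij \<longrightarrow> reaches (b (fst ij)) k (W ij) y)"
    by (elim exE)
  define w where "w = Min (W ` ({..tail_start} \<times> {..tail_start}))"
  have "0 < w"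
    using W by (auto simp: w_def)
  moreover have "\<exists>k\<in>S. reaches (b i) k w y" if i: "i \<le> tail_start" and y: "y \<in> X" for i y
  proof -
    have mem: "(i, ty y) \<in> {..tail_start} \<times> {..tail_start}"
      using i by (simp add: ty_def)
    then obtain k where k: "k \<in> S" "reaches (b i) k (W (i, ty y)) y"
      using W y by fastforce
    have "w \<le> W (i, ty y)"
      unfolding w_def using mem by (intro Min_le) auto
    with k(2) have "reaches (b i) k w y"
      unfolding reaches_def by (meson mult_right_mono order_trans)
    with k(1) show ?thesis
      by blast
  qed
  ultimately show thesis
    by (rule that)
qed

text \<open>
For an irreducible matrix with a period, no power of \<open>L\<close> makes values at different types comparable, but a
finite sum of powers does.
\<close>

definition Q :: "nat set \<Rightarrow> ((nat \<Rightarrow> real) \<Rightarrow> real) \<Rightarrow> (nat \<Rightarrow> real) \<Rightarrow> real" where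
  "Q S h x = (\<Sum>k\<in>S. (L ^^ k) h x)"

lemma Liter_pos:
  assumes "x \<in> X"
  shows "0 < (L ^^ n) (indicat_real X) x"
  using assms
proof (induction n arbitrary: x)
  case (Suc n)
  obtain a where a: "a \<in> pred (x 0)"
    using pred_nonempty[OF X_symbol[OF Suc.prems]] by blast
  have "0 < p a * exp (- phi0_bound) * (L ^^ n) (indicat_real X) (prepend a x)"
    using Suc.IH[OF prepend_in_X[OF Suc.prems a]] p_gt_0[OF subsetD[OF pred_subset a]] by simp
  also have "\<dots> \<le> (L ^^ Suc n) (indicat_real X) x"
    unfolding funpow.simps comp_def
    by (intro L_ge_term Liter_bounded bounded_on_indicator less_imp_le[OF Suc.IH] Suc.prems a)
  finally show ?case .
qed simp

text \<open>
From above, \<open>Q h\<close> is bounded by the largest value of \<open>h\<close> at a representative of a type; from below, every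
point is reached from that type by one of the paths with length in \<open>S\<close>.
\<close>

lemma cone_contraction_Q:
  assumes S: "communicating S"
  obtains K where "cone_contraction X ty hdist aperture (Q S) K"
proof -
  have fin: "finite S" and S0: "0 \<notin> S"
    using S by (simp_all add: communicating_def)
  obtain w where w: "0 < w" "\<And>i y. i \<le> tail_start \<Longrightarrow> y \<in> X \<Longrightarrow> \<exists>k\<in>S. reaches (b i) k w y"
    using uniform_reach[OF S] by blast
  have "\<forall>i. \<exists>z. z \<in> X \<and> z 0 = b i"
    using X_point_starting_with[OF rangeI] by metis
  then obtain zf where zf: "\<And>i. zf i \<in> X" "\<And>i. zf i 0 = b i"
    by metis
  have ty_eq: "ty u = i" if "u 0 = b i" "i \<le> tail_start" for u i
    using index_eqI[of u 0 i] that by (simp add: ty_def)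
  \<comment> \<open>The second summand is the quotient of the upper and the lower bound; the first ensures \<open>1 \<le> K\<close>.\<close>
  define K where "K = 1 + (\<Sum>k\<in>S. weight_bound ^ k) * (exp aperture * exp aperture / w)"
  have sum0: "0 \<le> (\<Sum>k\<in>S. weight_bound ^ k)"
    using weight_bound by (intro sum_nonneg) auto
  have comparable: "Q S h x \<le> K * Q S h y" if h: "h \<in> hcone aperture" and x: "x \<in> X" and y: "y \<in> X" for h x y
  proof -
    have hb: "h \<in> bounded_on X"
      by (rule cone_bounded[OF h])
    have h0: "\<And>x. x \<in> X \<Longrightarrow> 0 \<le> h x"
      by (rule holder_coneD(2)[OF h])
    have rep: "\<exists>z\<in>zf ` {..tail_start}. ty z = ty x" if "x \<in> X" for x
      using ty_eq[of "zf (ty x)" "ty x", OF zf(2)] by (intro bexI[of _ "zf (ty x)"]) (simp_all add: ty_def)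
    obtain z where z: "z \<in> zf ` {..tail_start}" "\<And>x. x \<in> X \<Longrightarrow> h x \<le> exp aperture * h z"
      by (rule cone_bounded_by_representatives[OF h _ _ _ rep]) (use aperture zf in auto)
    then obtain i where i: "i \<le> tail_start" "z = zf i"
      by auto
    have z0: "0 \<le> h z"
      using h0[OF zf(1)] i by simp
    have "Q S h x \<le> (\<Sum>k\<in>S. weight_bound ^ k * (exp aperture * h z))"
      unfolding Q_def
    proof (rule sum_mono)
      fix k
      have "norm ((L ^^ k) h x) \<le> weight_bound ^ k * (exp aperture * h z)"
        using z(2) h0 z0 by (intro Liter_norm_le x) simp_all
      then show "(L ^^ k) h x \<le> weight_bound ^ k * (exp aperture * h z)"
        by simp
    qed
    also have "\<dots> = (\<Sum>k\<in>S. weight_bound ^ k) * exp aperture * h z"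
      by (simp add: sum_distrib_right mult.assoc)
    finally have upper: "Q S h x \<le> (\<Sum>k\<in>S. weight_bound ^ k) * exp aperture * h z" .
    obtain k where k: "k \<in> S" "reaches (b i) k w y"
      using w(2)[OF i(1) y] by blast
    then obtain u where u: "u \<in> X" "u 0 = b i" "w * h u \<le> (L ^^ k) h y"
      using hb h0 unfolding reaches_def by blast
    have "h z \<le> exp aperture * h u"
      using ty_eq[of u i, OF u(2) i(1)] ty_eq[of "zf i" i, OF zf(2) i(1)] i(2) aperture(2) zf(1)
      by (intro cone_le_same_type[OF h] u(1)) simp_all
    also have "\<dots> \<le> exp aperture * ((L ^^ k) h y / w)"
      using u(3) w(1) by (intro mult_left_mono) (simp_all add: pos_le_divide_eq mult.commute)
    also have "(L ^^ k) h y \<le> Q S h y"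
      unfolding Q_def using fin k(1) by (intro member_le_sum Liter_nonneg h0 y) simp_all
    finally have lower: "h z \<le> exp aperture * (Q S h y / w)"
      using w(1) by (simp add: divide_right_mono)
    have Qy: "0 \<le> Q S h y"
      unfolding Q_def by (intro sum_nonneg Liter_nonneg h0 y)
    have "(\<Sum>k\<in>S. weight_bound ^ k) * exp aperture * h z \<le> (\<Sum>k\<in>S. weight_bound ^ k) * exp aperture * (exp aperture * (Q S h y / w))"
      using sum0 by (intro mult_left_mono lower) simp
    also have "\<dots> \<le> K * Q S h y"
      using Qy by (simp add: K_def distrib_right)
    finally show ?thesis
      using upper by linarith
  qed
  obtain k0 where k0: "k0 \<in> S"
    using S unfolding communicating_def by blast
  have "cone_contraction X ty hdist aperture (Q S) K"
  proof unfold_locales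
    show "1 \<le> K"
      using sum0 w(1) by (simp add: K_def)
    show "Q S (\<lambda>x. f x + g x) = (\<lambda>x. Q S f x + Q S g x)" if "f \<in> bounded_on X" "g \<in> bounded_on X" for f g
      by (rule ext) (simp add: Q_def Liter_add[OF that] sum.distrib)
    show "Q S (\<lambda>x. k * f x) = (\<lambda>x. k * Q S f x)" for k f
      by (rule ext) (simp add: Q_def Liter_scale sum_distrib_left)
    show "Q S f \<in> bounded_on X" if "f \<in> bounded_on X" for f
      unfolding Q_def[abs_def] using fin
    proof (induction S rule: finite_induct)
      case (insert k S)
      then show ?case
        using bounded_on_add[OF Liter_bounded[OF that] insert.IH] by simp
    qed (auto simp: bounded_on_def)
    show "0 \<le> Q S f x" if "\<And>y. y \<in> X \<Longrightarrow> 0 \<le> f y" "x \<in> X" for f x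
      unfolding Q_def by (intro sum_nonneg Liter_nonneg that)
    show "Q S h \<in> hcone (aperture - 1)" if "h \<in> hcone aperture" for h
      unfolding Q_def[abs_def] using S0 by (intro holder_cone_sum fin Liter_cone that) (metis gr0I)
    show "Q S h x \<le> K * Q S h y" if "h \<in> hcone aperture" "x \<in> X" "y \<in> X" for h x y
      by (rule comparable[OF that])
    show "0 < Q S (indicat_real X) x" if "x \<in> X" for x
      unfolding Q_def using k0 fin Liter_pos[OF that] by (intro sum_pos) auto
  qed
  then show thesis
    by (rule that)
qed

end

section \<open>The leading eigenfunction and its functional\<close>

context ruelle_potential
begin

abbreviation H :: "((nat \<Rightarrow> real) \<Rightarrow> real) set" where "H \<equiv> holder_space X \<alpha>"

text \<open>
Adding the constant \<open>2 M\<close> makes \<open>h\<close> at least \<open>M\<close>, and a function bounded below by its Hoelder constant lies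
in the cone because \<open>1 \<le> aperture\<close>.
\<close>

lemma holder_imp_cbound:
  fixes h :: "(nat \<Rightarrow> real) \<Rightarrow> real"
  assumes off: "\<And>x. x \<notin> X \<Longrightarrow> h x = 0" and M: "\<And>x. x \<in> X \<Longrightarrow> \<bar>h x\<bar> \<le> M"
    and hol: "\<And>x y. x \<in> X \<Longrightarrow> y \<in> X \<Longrightarrow> \<bar>h x - h y\<bar> \<le> M * hdist x y"
  shows "cbound h (3 * M)"
proof -
  obtain z where z: "z \<in> X"
    using X_nonempty by blast
  have M0: "0 \<le> M"
    using M[OF z] by simp
  define v where "v = (\<lambda>x. 2 * M * indicat_real X x)"
  define u where "u = (\<lambda>x. h x + 2 * M * indicat_real X x)"
  have v: "v \<in> hcone aperture"
    unfolding v_def using M0 aperture(2) by (intro holder_cone_scale cone_indicator) simp_all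
  have ge: "M \<le> u x" and le: "u x \<le> 3 * M" if "x \<in> X" for x
    using M[OF that] that by (simp_all add: u_def abs_le_iff)
  have "u x \<le> exp (aperture * hdist x y) * u y" if x: "x \<in> X" and y: "y \<in> X" for x y
  proof -
    have "u x - u y \<le> M * hdist x y"
      using hol[OF x y] x y by (simp add: u_def abs_le_iff)
    also have "\<dots> \<le> u y * (aperture * hdist x y)"
      using ge[OF y] M0 aperture(2) hdist_nonneg[of x y] by (intro mult_mono) (auto simp: mult_le_cancel_right1)
    also have "\<dots> \<le> u y * (exp (aperture * hdist x y) - 1)"
      using ge[OF y] M0 exp_ge_add_one_self[of "aperture * hdist x y"] by (intro mult_left_mono) linarith+
    finally show ?thesis
      by (simp add: algebra_simps)
  qed
  moreover have "0 \<le> u x" if "x \<in> X" for x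
    using ge[OF that] M0 by simp
  ultimately have u: "u \<in> hcone aperture"
    by (auto simp: holder_cone_def u_def off)
  show ?thesis
    unfolding cone_bound_def
  proof (rule bexI[OF _ u], rule bexI[OF _ v], intro conjI ballI)
    show "h = (\<lambda>x. u x - v x)"
      by (simp add: u_def v_def)
    show "u x \<le> 3 * M" "v x \<le> 3 * M" if "x \<in> X" for x
      using le[OF that] M0 that by (simp_all add: v_def)
  qed
qed

lemma cone_lipschitz:
  assumes u: "u \<in> hcone aperture" "\<And>x. x \<in> X \<Longrightarrow> u x \<le> \<epsilon>" and xy: "x \<in> X" "y \<in> X" "ty x = ty y"
  shows "u x - u y \<le> \<epsilon> * (aperture * exp aperture) * hdist x y"
proof -
  define d where "d = aperture * hdist x y"
  have d: "0 \<le> d" "d \<le> aperture"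
    using aperture(2) hdist_nonneg[of x y] hdist_le_1[OF xy(1,2)] by (auto simp: d_def mult_left_le)
  have uy: "0 \<le> u y"
    by (rule holder_coneD(2)[OF u(1) xy(2)])
  have "u x - u y \<le> u y * (exp d - 1)"
    using holder_coneD(3)[OF u(1), OF xy] by (simp add: d_def algebra_simps)
  also have "\<dots> \<le> u y * (d * exp aperture)"
  proof (rule mult_left_mono[OF _ uy])
    have "1 - d \<le> exp (- d)"
      using exp_ge_add_one_self[of "- d"] by simp
    then have "exp d * (1 - d) \<le> exp d * exp (- d)"
      by (intro mult_left_mono) auto
    then have "exp d - 1 \<le> d * exp d"
      by (simp add: algebra_simps flip: exp_add)
    also have "\<dots> \<le> d * exp aperture"
      using d by (intro mult_left_mono) auto
    finally show "exp d - 1 \<le> d * exp aperture" .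
  qed
  also have "u y * (d * exp aperture) \<le> \<epsilon> * (d * exp aperture)"
    using u(2)[OF xy(2)] d by (intro mult_right_mono) auto
  finally show ?thesis
    by (simp add: d_def mult_ac)
qed

text \<open>
Within a type the cone condition gives a Lipschitz bound relative to the size of the function; across types,
the distance is bounded below and the size alone is enough.
\<close>

lemma cbound_imp_holder:
  obtains C where "0 \<le> C" "\<And>h \<epsilon> x y. cbound h \<epsilon> \<Longrightarrow> x \<in> X \<Longrightarrow> y \<in> X \<Longrightarrow> \<bar>h x - h y\<bar> \<le> C * \<epsilon> * hdist x y"
proof -
  obtain g where g: "0 < g" "\<And>x y. x \<in> X \<Longrightarrow> y \<in> X \<Longrightarrow> ty x \<noteq> ty y \<Longrightarrow> g \<le> seq_dist x y"
    using types_separated by blast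
  define C where "C = 2 * (aperture * exp aperture) + 2 / g powr \<alpha>"
  have parts: "0 \<le> 2 * (aperture * exp aperture)" "0 \<le> 2 / g powr \<alpha>"
    using aperture(2) by simp_all
  have "\<bar>h x - h y\<bar> \<le> C * \<epsilon> * hdist x y" if h: "cbound h \<epsilon>" and x: "x \<in> X" and y: "y \<in> X" for h \<epsilon> x y
  proof (cases "ty x = ty y")
    case True
    obtain u v where uv: "u \<in> hcone aperture" "v \<in> hcone aperture" "h = (\<lambda>x. u x - v x)" "\<forall>x\<in>X. u x \<le> \<epsilon> \<and> v x \<le> \<epsilon>"
      using h unfolding cone_bound_def by blast
    have *: "w x - w y \<le> \<epsilon> * (aperture * exp aperture) * hdist x y" "w y - w x \<le> \<epsilon> * (aperture * exp aperture) * hdist x y"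
      if "w \<in> hcone aperture" "\<And>x. x \<in> X \<Longrightarrow> w x \<le> \<epsilon>" for w
      using cone_lipschitz[OF that x y True] cone_lipschitz[OF that y x True[symmetric]] hdist_sym[of x y] by simp_all
    have "\<bar>h x - h y\<bar> \<le> 2 * (\<epsilon> * (aperture * exp aperture) * hdist x y)"
      using *[OF uv(1)] *[OF uv(2)] uv(3,4) by (simp add: abs_le_iff)
    also have "\<dots> = 2 * (aperture * exp aperture) * (\<epsilon> * hdist x y)"
      by simp
    also have "\<dots> \<le> C * (\<epsilon> * hdist x y)"
      using parts cbound_nonneg[OF h] hdist_nonneg[of x y] by (intro mult_right_mono) (simp_all add: C_def)
    finally show ?thesis
      by simp
  next
    case False
    have "g powr \<alpha> \<le> hdist x y"
      unfolding hdist_def using g(1) g(2)[OF x y False] alpha_pos by (intro powr_mono2) simp_all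
    then have "1 \<le> hdist x y / g powr \<alpha>"
      using g(1) by simp
    then have "2 * \<epsilon> * 1 \<le> 2 * \<epsilon> * (hdist x y / g powr \<alpha>)"
      using cbound_nonneg[OF h] by (intro mult_left_mono) simp_all
    then have "\<bar>h x - h y\<bar> \<le> 2 / g powr \<alpha> * (\<epsilon> * hdist x y)"
      using cbound_abs[OF h x] cbound_abs[OF h y] by (simp add: abs_le_iff)
    also have "\<dots> \<le> C * (\<epsilon> * hdist x y)"
      using parts cbound_nonneg[OF h] hdist_nonneg[of x y] by (intro mult_right_mono) (simp_all add: C_def)
    finally show ?thesis
      by simp
  qed
  moreover have "0 \<le> C"
    using parts by (simp add: C_def)
  ultimately show thesis
    by (intro that)
qed

lemma H_iff_cbound: "h \<in> H \<longleftrightarrow> (\<exists>\<epsilon>. cbound h \<epsilon>)"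
proof
  assume "h \<in> H"
  then obtain C where "0 \<le> C" "\<And>x. x \<notin> X \<Longrightarrow> h x = 0" "\<And>x y. x \<in> X \<Longrightarrow> y \<in> X \<Longrightarrow> norm (h x - h y) \<le> C * hdist x y"
    "\<And>x. x \<in> X \<Longrightarrow> norm (h x) \<le> C"
    by (rule holder_spaceE) blast
  then have "cbound h (3 * C)"
    unfolding real_norm_def by (intro holder_imp_cbound)
  then show "\<exists>\<epsilon>. cbound h \<epsilon>" ..
next
  assume "\<exists>\<epsilon>. cbound h \<epsilon>"
  then obtain \<epsilon> where e: "cbound h \<epsilon>" ..
  obtain C where "\<And>x y. x \<in> X \<Longrightarrow> y \<in> X \<Longrightarrow> \<bar>h x - h y\<bar> \<le> C * \<epsilon> * hdist x y"
    using cbound_imp_holder e by metis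
  moreover have "h x = 0" if "x \<notin> X" for x
    using cbound_bounded[OF e] that by (simp add: bounded_on_def)
  ultimately show "h \<in> H"
    unfolding holder_space_def hdist_def real_norm_def by blast
qed

lemma H_bounded: "h \<in> H \<Longrightarrow> h \<in> bounded_on X"
  using H_iff_cbound cbound_bounded by blast

lemma H_add: "f \<in> H \<Longrightarrow> g \<in> H \<Longrightarrow> (\<lambda>x. f x + g x) \<in> H"
  using H_iff_cbound cbound_add by blast

lemma H_scale: "f \<in> H \<Longrightarrow> (\<lambda>x. k * f x) \<in> H"
  using H_iff_cbound cbound_scale by blast

lemma H_diff: "f \<in> H \<Longrightarrow> g \<in> H \<Longrightarrow> (\<lambda>x. f x - g x) \<in> H"
  using H_iff_cbound cbound_diff by blast

lemma H_indicator: "indicat_real X \<in> H"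
  using H_iff_cbound cbound_cone[OF cone_indicator[of aperture], of 1] aperture(2) by force

lemma zero_in_H: "(\<lambda>_. 0) \<in> H"
  using H_scale[OF H_indicator, of 0] by simp

lemma H_cone: "h \<in> hcone aperture \<Longrightarrow> h \<in> H"
proof -
  assume h: "h \<in> hcone aperture"
  obtain M where "\<forall>x\<in>X. \<bar>h x\<bar> \<le> M"
    using cone_bounded[OF h] unfolding bounded_on_def by blast
  then have "cbound h M"
    by (intro cbound_cone h) (simp add: abs_le_iff)
  then show "h \<in> H"
    using H_iff_cbound by blast
qed

lemma cbound_L:
  assumes "cbound h \<epsilon>"
  shows "cbound (L h) (weight_bound * \<epsilon>)"
proof -
  obtain u v where uv: "u \<in> hcone aperture" "v \<in> hcone aperture" "h = (\<lambda>x. u x - v x)" "\<forall>x\<in>X. u x \<le> \<epsilon> \<and> v x \<le> \<epsilon>"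
    using assms unfolding cone_bound_def by blast
  have e: "0 \<le> \<epsilon>"
    by (rule cbound_nonneg[OF assms])
  have *: "L w x \<le> weight_bound * \<epsilon>" if "w \<in> hcone aperture" "\<And>x. x \<in> X \<Longrightarrow> w x \<le> \<epsilon>" "x \<in> X" for w x
    using L_norm_le[of w \<epsilon> x] that(2) holder_coneD(2)[OF that(1)] that(3) e by (simp add: abs_le_iff)
  show ?thesis
    unfolding cone_bound_def
  proof (rule bexI[OF _ L_cone'[OF uv(1)]], rule bexI[OF _ L_cone'[OF uv(2)]], intro conjI ballI)
    show "L h = (\<lambda>x. L u x - L v x)"
      unfolding uv(3) by (rule L_diff[OF cone_bounded[OF uv(1)] cone_bounded[OF uv(2)]])
    show "L u x \<le> weight_bound * \<epsilon>" "L v x \<le> weight_bound * \<epsilon>" if "x \<in> X" for x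
      using *[OF uv(1) _ that] *[OF uv(2) _ that] uv(4) by simp_all
  qed
qed

lemma H_L: "h \<in> H \<Longrightarrow> L h \<in> H"
  using H_iff_cbound cbound_L by blast

lemma cbound_Liter: "cbound h \<epsilon> \<Longrightarrow> cbound ((L ^^ n) h) (weight_bound ^ n * \<epsilon>)"
  by (induction n) (simp_all add: cbound_L mult.assoc)

lemma H_Liter: "h \<in> H \<Longrightarrow> (L ^^ n) h \<in> H"
  by (induction n) (simp_all add: H_L)

lemma H_sum: "finite T \<Longrightarrow> (\<And>k. k \<in> T \<Longrightarrow> g k \<in> H) \<Longrightarrow> (\<lambda>x. \<Sum>k\<in>T. g k x) \<in> H"
proof (induction T rule: finite_induct)
  case empty
  then show ?case
    by (auto simp: holder_space_def intro: exI[of _ 0])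
next
  case (insert k T)
  then show ?case
    using H_add[of "g k" "\<lambda>x. \<Sum>k\<in>T. g k x"] by simp
qed

lemma L_sum:
  "finite T \<Longrightarrow> (\<And>k. k \<in> T \<Longrightarrow> g k \<in> bounded_on X) \<Longrightarrow> L (\<lambda>x. \<Sum>k\<in>T. g k x) = (\<lambda>x. \<Sum>k\<in>T. L (g k) x)
    \<and> (\<lambda>x. \<Sum>k\<in>T. g k x) \<in> bounded_on X"
proof (induction T rule: finite_induct)
  case empty
  then show ?case
    using L_scale[of 0 "\<lambda>_. 0"] by (auto simp: bounded_on_def)
next
  case (insert k T)
  then show ?case
    using L_add[of "g k" "\<lambda>x. \<Sum>k\<in>T. g k x"] bounded_on_add[of "g k" X "\<lambda>x. \<Sum>k\<in>T. g k x"] by simp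
qed

lemma L_Q_commute:
  assumes "finite S" "h \<in> bounded_on X"
  shows "Q S (L h) = L (Q S h)"
proof
  fix x
  have "Q S (L h) x = (\<Sum>k\<in>S. L ((L ^^ k) h) x)"
    by (simp add: Q_def funpow_swap1)
  also have "\<dots> = L (Q S h) x"
    using L_sum[OF assms(1), of "\<lambda>k. (L ^^ k) h"] Liter_bounded[OF assms(2)] unfolding Q_def[abs_def] by simp
  finally show "Q S (L h) x = L (Q S h) x" .
qed

end

text \<open>
The norm of the cone dominates the supremum norm.
\<close>

lemma (in type_space) cbound_gap_imp_limit:
  assumes W: "0 < W" and r: "0 \<le> r" "r < 1" and a: "\<And>n. cbound (\<lambda>x. q n x - a * W ^ n * f x) (E * r ^ n * W ^ n)"
    and x: "x \<in> X"
  shows "(\<lambda>n. q n x / W ^ n) \<longlonglongrightarrow> a * f x"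
proof -
  have "\<forall>n. norm (q n x / W ^ n - a * f x) \<le> E * r ^ n"
  proof
    fix n
    have "\<bar>q n x - a * W ^ n * f x\<bar> / W ^ n \<le> E * r ^ n"
      using cbound_abs[OF a x, of n] W by (simp add: pos_divide_le_eq)
    also have "\<bar>q n x - a * W ^ n * f x\<bar> / W ^ n = \<bar>(q n x - a * W ^ n * f x) / W ^ n\<bar>"
      using W by simp
    also have "(q n x - a * W ^ n * f x) / W ^ n = q n x / W ^ n - a * f x"
      using W by (simp add: diff_divide_distrib)
    finally show "norm (q n x / W ^ n - a * f x) \<le> E * r ^ n"
      by simp
  qed
  moreover have "(\<lambda>n. E * r ^ n) \<longlonglongrightarrow> 0"
    by (intro tendsto_mult_right_zero LIMSEQ_power_zero) (use r in simp)
  ultimately have "(\<lambda>n. q n x / W ^ n - a * f x) \<longlonglongrightarrow> 0"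
    by (rule Lim_null_comparison[OF always_eventually])
  then show ?thesis
    by (rule Lim_null[THEN iffD2])
qed

text \<open>
The outcome of the contraction argument: \<open>f\<close> is the eigenfunction, \<open>l\<close> its eigenvalue, and \<open>c h\<close>
is the coefficient of \<open>f\<close> in the asymptotics of the iterates of \<open>h\<close>. The sum of the \<open>l^k\<close> is the eigenvalue
of \<open>Q S\<close>.
\<close>

locale ruelle_spectral = ruelle_potential b A \<alpha> \<phi> \<phi>0 p for b A \<alpha> \<phi> \<phi>0 p +
  fixes S :: "nat set" and l m C r :: real and f :: "(nat \<Rightarrow> real) \<Rightarrow> real" and c :: "((nat \<Rightarrow> real) \<Rightarrow> real) \<Rightarrow> real"
  assumes S: "communicating S"
    and l_pos: "0 < l" and m_pos: "0 < m" and f_cone: "f \<in> holder_cone X ty hdist aperture" and f_ge: "\<And>x. x \<in> X \<Longrightarrow> m \<le> f x"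
    and Lf: "ruelle (range b) A \<phi> f = (\<lambda>x. l * f x)"
    and r: "0 \<le> r" "r < 1" and C_nonneg: "0 \<le> C"
    and c_bound: "\<And>h \<epsilon>. cone_bound X ty hdist aperture h \<epsilon> \<Longrightarrow> \<bar>c h\<bar> \<le> C * \<epsilon>"
    and cone_gap: "\<And>h \<epsilon> n. cone_bound X ty hdist aperture h \<epsilon> \<Longrightarrow>
      cone_bound X ty hdist aperture (\<lambda>x. (Q S ^^ n) h x - c h * (\<Sum>k\<in>S. l ^ k) ^ n * f x) (C * \<epsilon> * r ^ n * (\<Sum>k\<in>S. l ^ k) ^ n)"
    and c_one: "c (indicat_real X) = 1"

text \<open>
\<open>Q^n (L f) = L (Q^n f)\<close> is a multiple of \<open>L f\<close>, and its normalized limit is a multiple of \<open>f\<close>. So \<open>f\<close> is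
an eigenfunction of \<open>L\<close> too.
\<close>

lemma (in ruelle_potential) spectral_data:
  assumes S: "communicating S"
  obtains l m C r f c where "ruelle_spectral b A \<alpha> \<phi> \<phi>0 p S l m C r f c"
proof -
  have fin: "finite S"
    using S by (simp add: communicating_def)
  obtain K where K: "cone_contraction X ty hdist aperture (Q S) K"
    by (rule cone_contraction_Q[OF S])
  interpret Qc: cone_contraction X ty hdist aperture "Q S" K
    by (rule K)
  obtain lq f m where lq: "0 < lq" and f: "f \<in> hcone (aperture - 1)" and m: "0 < m" "\<And>x. x \<in> X \<Longrightarrow> m \<le> f x"
    and Qf: "Q S f = (\<lambda>x. lq * f x)"
    and one: "\<And>x. x \<in> X \<Longrightarrow> (\<lambda>n. (Q S ^^ n) (indicat_real X) x / lq ^ n) \<longlonglongrightarrow> f x"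
    by (rule Qc.eigenfunction) blast
  obtain C where C: "0 \<le> C" "\<And>h \<epsilon>. cbound h \<epsilon> \<Longrightarrow>
    \<exists>c. \<bar>c\<bar> \<le> C * \<epsilon> \<and> (\<forall>n. cbound (\<lambda>x. (Q S ^^ n) h x - c * lq ^ n * f x) (C * \<epsilon> * Qc.rate ^ n * lq ^ n))"
    using Qc.spectral_gap[OF lq f m Qf] by blast
  have fB: "f \<in> hcone aperture"
    by (rule cone_mono[OF f]) simp
  have fb: "f \<in> bounded_on X"
    by (rule cone_bounded[OF fB])
  obtain x0 where x0: "x0 \<in> X"
    using X_nonempty by blast
  have f_pos: "0 < f x" if "x \<in> X" for x
    using m(1) m(2)[OF that] by simp
  have lim: "(\<lambda>n. (Q S ^^ n) h x / lq ^ n) \<longlonglongrightarrow> a * f x"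
    if a: "\<forall>n. cbound (\<lambda>x. (Q S ^^ n) h x - a * lq ^ n * f x) (C * \<epsilon> * Qc.rate ^ n * lq ^ n)" and x: "x \<in> X" for h \<epsilon> a x
    by (rule cbound_gap_imp_limit[OF lq Qc.rate(1,2) _ x]) (use a in blast)
  \<comment> \<open>The coefficient is unique, so one point serves to define it.\<close>
  define c where "c h = lim (\<lambda>n. (Q S ^^ n) h x0 / lq ^ n) / f x0" for h
  have c_eq: "c h = a"
    if "\<forall>n. cbound (\<lambda>x. (Q S ^^ n) h x - a * lq ^ n * f x) (C * \<epsilon> * Qc.rate ^ n * lq ^ n)" for h \<epsilon> a
    unfolding c_def limI[OF lim[OF that x0]] using f_pos[OF x0] by simp
  have c_bound: "\<bar>c h\<bar> \<le> C * \<epsilon>" and c_gap: "cbound (\<lambda>x. (Q S ^^ n) h x - c h * lq ^ n * f x) (C * \<epsilon> * Qc.rate ^ n * lq ^ n)"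
    if h: "cbound h \<epsilon>" for h \<epsilon> n
  proof -
    obtain a where a: "\<bar>a\<bar> \<le> C * \<epsilon>" "\<forall>n. cbound (\<lambda>x. (Q S ^^ n) h x - a * lq ^ n * f x) (C * \<epsilon> * Qc.rate ^ n * lq ^ n)"
      using C(2)[OF h] by blast
    have "c h = a"
      by (rule c_eq[OF a(2)])
    with a show "\<bar>c h\<bar> \<le> C * \<epsilon>" "cbound (\<lambda>x. (Q S ^^ n) h x - c h * lq ^ n * f x) (C * \<epsilon> * Qc.rate ^ n * lq ^ n)"
      by simp_all
  qed
  have c_lim: "(\<lambda>n. (Q S ^^ n) h x / lq ^ n) \<longlonglongrightarrow> c h * f x" if h: "h \<in> H" and x: "x \<in> X" for h x
  proof -
    obtain \<epsilon> where "cbound h \<epsilon>"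
      using h H_iff_cbound by blast
    then have "\<forall>n. cbound (\<lambda>x. (Q S ^^ n) h x - c h * lq ^ n * f x) (C * \<epsilon> * Qc.rate ^ n * lq ^ n)"
      using c_gap by blast
    then show ?thesis
      by (rule lim[OF _ x])
  qed
  have c_one: "c (indicat_real X) = 1"
    using LIMSEQ_unique[OF c_lim[OF H_indicator x0] one[OF x0]] f_pos[OF x0] by simp
  have iter: "(Q S ^^ n) (L f) = (\<lambda>x. lq ^ n * L f x)" for n
  proof (induction n)
    case (Suc n)
    have "(Q S ^^ Suc n) (L f) = Q S (\<lambda>x. lq ^ n * L f x)"
      by (simp add: Suc)
    also have "\<dots> = (\<lambda>x. lq ^ n * Q S (L f) x)"
      by (rule Qc.Q_scale[OF L_bounded[OF fb]])
    also have "\<dots> = (\<lambda>x. lq ^ n * L (\<lambda>x. lq * f x) x)"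
      by (simp add: L_Q_commute[OF fin fb] Qf)
    also have "\<dots> = (\<lambda>x. lq ^ Suc n * L f x)"
      by (simp add: L_scale mult_ac)
    finally show ?case .
  qed simp
  define l where "l = c (L f)"
  have Lfx: "L f x = l * f x" for x
  proof (cases "x \<in> X")
    case True
    have "(\<lambda>n. (Q S ^^ n) (L f) x / lq ^ n) = (\<lambda>n. L f x)"
      using lq by (simp add: iter)
    with c_lim[OF H_L[OF H_cone[OF fB]] True] have "(\<lambda>n. L f x) \<longlonglongrightarrow> l * f x"
      by (simp add: l_def)
    then show ?thesis
      by (simp add: LIMSEQ_const_iff)
  next
    case False
    then show ?thesis
      using holder_coneD(1)[OF fB] by (simp add: L_off)
  qed
  then have Lf: "L f = (\<lambda>x. l * f x)"
    by blast
  have l: "0 < l"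
  proof -
    obtain a where a: "a \<in> pred (x0 0)"
      using pred_nonempty[OF X_symbol[OF x0]] by blast
    have "0 < p a * exp (- phi0_bound) * f (prepend a x0)"
      using f_pos[OF prepend_in_X[OF x0 a]] p_gt_0[OF subsetD[OF pred_subset a]] by simp
    also have "\<dots> \<le> L f x0"
      using f_pos by (intro L_ge_term fb x0 a) (simp add: less_imp_le)
    finally show ?thesis
      using f_pos[OF x0] by (simp add: Lfx zero_less_mult_iff)
  qed
  have Literf: "(L ^^ k) f = (\<lambda>x. l ^ k * f x)" for k
  proof (induction k)
    case (Suc k)
    then show ?case
      using L_scale[of "l ^ k" f] by (simp add: Lf mult_ac)
  qed simp
  have "lq = (\<Sum>k\<in>S. l ^ k)"
  proof -
    have "lq * f x0 = Q S f x0"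
      by (simp add: Qf)
    also have "\<dots> = (\<Sum>k\<in>S. l ^ k) * f x0"
      by (simp add: Q_def Literf sum_distrib_right)
    finally show ?thesis
      using f_pos[OF x0] by simp
  qed
  then have "ruelle_spectral b A \<alpha> \<phi> \<phi>0 p S l m C Qc.rate f c"
    using S l m fB Lf Qc.rate C c_bound c_gap c_one by unfold_locales simp_all
  then show thesis
    by (rule that)
qed

context ruelle_spectral
begin

text \<open>
The eigenvalue of \<open>Q S\<close> at \<open>f\<close>.
\<close>

definition W :: real where "W = (\<Sum>k\<in>S. l ^ k)"

lemma finite_S: "finite S"
  using S by (simp add: communicating_def)

lemma W_pos: "0 < W"
proof -
  obtain k where "k \<in> S"
    using S unfolding communicating_def by blast
  then show ?thesis
    unfolding W_def using finite_S l_pos by (intro sum_pos) auto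
qed

lemma f_pos: "x \<in> X \<Longrightarrow> 0 < f x"
  using m_pos f_ge[of x] by simp

lemma f_off: "x \<notin> X \<Longrightarrow> f x = 0"
  using holder_coneD(1)[OF f_cone] .

lemma f_H: "f \<in> H"
  by (rule H_cone[OF f_cone])

lemma f_bounded: "f \<in> bounded_on X"
  by (rule cone_bounded[OF f_cone])

lemma Q_contraction: obtains K where "cone_contraction X ty hdist aperture (Q S) K"
  using cone_contraction_Q[OF S] .

lemma Q_limit:
  assumes h: "h \<in> H" and x: "x \<in> X"
  shows "(\<lambda>n. (Q S ^^ n) h x / W ^ n) \<longlonglongrightarrow> c h * f x"
proof -
  obtain \<epsilon> where "cbound h \<epsilon>"
    using h H_iff_cbound by blast
  from cbound_gap_imp_limit[OF W_pos r cone_gap[OF this, folded W_def] x] show ?thesis .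
qed

lemma c_eqI:
  assumes "h \<in> H" "x \<in> X" "(\<lambda>n. (Q S ^^ n) h x / W ^ n) \<longlonglongrightarrow> a * f x"
  shows "c h = a"
  using LIMSEQ_unique[OF Q_limit[OF assms(1,2)] assms(3)] f_pos[OF assms(2)] by simp

lemma c_diff_scale:
  assumes g: "g \<in> H" and h: "h \<in> H"
  shows "c (\<lambda>x. g x - k * h x) = c g - k * c h"
proof -
  obtain K where K: "cone_contraction X ty hdist aperture (Q S) K"
    by (rule Q_contraction)
  obtain x where x: "x \<in> X"
    using X_nonempty by blast
  have "(\<lambda>n. (Q S ^^ n) g x / W ^ n - k * ((Q S ^^ n) h x / W ^ n)) \<longlonglongrightarrow> c g * f x - k * (c h * f x)"
    by (intro tendsto_diff tendsto_mult tendsto_const Q_limit g h x)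
  then have "(\<lambda>n. (Q S ^^ n) (\<lambda>x. g x - k * h x) x / W ^ n) \<longlonglongrightarrow> (c g - k * c h) * f x"
    by (simp add: cone_contraction.iter_diff[OF K H_bounded[OF g] H_bounded[OF h]] diff_divide_distrib left_diff_distrib mult.assoc)
  then show ?thesis
    by (rule c_eqI[OF H_diff[OF g H_scale[OF h]] x])
qed

lemma c_zero: "c (\<lambda>_. 0) = 0"
  using c_diff_scale[OF H_indicator H_indicator, of 1] by simp

lemma c_diff: "g \<in> H \<Longrightarrow> h \<in> H \<Longrightarrow> c (\<lambda>x. g x - h x) = c g - c h"
  using c_diff_scale[of g h 1] by simp

lemma c_scale: "h \<in> H \<Longrightarrow> c (\<lambda>x. k * h x) = k * c h"
  using c_diff_scale[OF zero_in_H, of h "- k"] by (simp add: c_zero)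

lemma c_add: "g \<in> H \<Longrightarrow> h \<in> H \<Longrightarrow> c (\<lambda>x. g x + h x) = c g + c h"
  using c_diff_scale[of g h "-1"] by simp

lemma Qiter_nonneg:
  assumes "\<And>y. y \<in> X \<Longrightarrow> 0 \<le> h y" "x \<in> X"
  shows "0 \<le> (Q S ^^ n) h x"
  using assms(2)
proof (induction n arbitrary: x)
  case (Suc n)
  have "0 \<le> Q S ((Q S ^^ n) h) x"
    unfolding Q_def[of S "(Q S ^^ n) h"] using Suc by (intro sum_nonneg Liter_nonneg)
  then show ?case
    by simp
qed (use assms(1) in simp)

lemma c_nonneg:
  assumes h: "h \<in> H" "\<And>x. x \<in> X \<Longrightarrow> 0 \<le> h x"
  shows "0 \<le> c h"
proof -
  obtain x where x: "x \<in> X"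
    using X_nonempty by blast
  have "0 \<le> c h * f x"
    using Qiter_nonneg[of h, OF h(2) x] W_pos
    by (intro LIMSEQ_le_const[OF Q_limit[OF h(1) x]]) (auto intro!: divide_nonneg_pos)
  then show ?thesis
    using f_pos[OF x] by (simp add: zero_le_mult_iff)
qed

lemma c_mono:
  assumes "g \<in> H" "h \<in> H" "\<And>x. x \<in> X \<Longrightarrow> g x \<le> h x"
  shows "c g \<le> c h"
  using c_nonneg[OF H_diff[OF assms(2,1)]] c_diff[OF assms(2,1)] assms(3) by simp

lemma c_le_const:
  assumes "h \<in> H" "\<And>x. x \<in> X \<Longrightarrow> h x \<le> t"
  shows "c h \<le> t"
  using c_mono[OF assms(1) H_scale[OF H_indicator, of t]] assms(2) c_scale[OF H_indicator, of t] by (simp add: c_one)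

lemma Literf: "(L ^^ k) f = (\<lambda>x. l ^ k * f x)"
proof (induction k)
  case (Suc k)
  then show ?case
    using L_scale[of "l ^ k" f] by (simp add: Lf mult_ac)
qed simp

lemma Qf: "Q S f = (\<lambda>x. W * f x)"
  by (rule ext) (simp add: Q_def W_def Literf sum_distrib_right)

lemma Qiter_eigen:
  assumes h: "h \<in> bounded_on X" and Qh: "Q S h = (\<lambda>x. W * h x)"
  shows "(Q S ^^ n) h = (\<lambda>x. W ^ n * h x)"
proof (induction n)
  case (Suc n)
  obtain K where K: "cone_contraction X ty hdist aperture (Q S) K"
    by (rule Q_contraction)
  show ?case
    using Suc cone_contraction.Q_scale[OF K h, of "W ^ n"] by (simp add: Qh mult_ac)
qed simp

text \<open>
The normalized iterates of an eigenfunction for \<open>l\<close> are constant, so it equals its own limit.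
\<close>

lemma L_eigen_imp_c:
  assumes h: "h \<in> H" and Lh: "L h = (\<lambda>x. l * h x)" and x: "x \<in> X"
  shows "h x = c h * f x"
proof -
  have "(L ^^ k) h = (\<lambda>x. l ^ k * h x)" for k
  proof (induction k)
    case (Suc k)
    then show ?case
      using L_scale[of "l ^ k" h] by (simp add: Lh mult_ac)
  qed simp
  then have "Q S h = (\<lambda>x. W * h x)"
    by (intro ext) (simp add: Q_def W_def sum_distrib_right)
  from Qiter_eigen[OF H_bounded[OF h] this] have "(\<lambda>n. (Q S ^^ n) h x / W ^ n) = (\<lambda>n. h x)"
    using W_pos by simp
  with Q_limit[OF h x] have "(\<lambda>n. h x) \<longlonglongrightarrow> c h * f x"
    by simp
  then show ?thesis
    by (simp add: LIMSEQ_const_iff)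
qed

lemma c_f: "c f = 1"
proof -
  obtain x where x: "x \<in> X"
    using X_nonempty by blast
  from L_eigen_imp_c[OF f_H Lf x] f_pos[OF x] show ?thesis
    by simp
qed

lemma Qiter_L: "h \<in> bounded_on X \<Longrightarrow> (Q S ^^ n) (L h) = L ((Q S ^^ n) h)"
proof (induction n)
  case (Suc n)
  obtain K where K: "cone_contraction X ty hdist aperture (Q S) K"
    by (rule Q_contraction)
  show ?case
    using Suc L_Q_commute[OF finite_S cone_contraction.iter_bounded[OF K Suc.prems]] by simp
qed simp

text \<open>
The operator \<open>L\<close> is bounded in the norm of the cone and commutes with \<open>Q\<close>, so it may be applied to the
asymptotic expansion of the iterates.
\<close>

lemma c_L:
  assumes h: "h \<in> H"
  shows "c (L h) = l * c h"
proof -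
  obtain K where K: "cone_contraction X ty hdist aperture (Q S) K"
    by (rule Q_contraction)
  obtain x where x: "x \<in> X"
    using X_nonempty by blast
  obtain \<epsilon> where e: "cbound h \<epsilon>"
    using h H_iff_cbound by blast
  have "cbound (\<lambda>x. (Q S ^^ n) (L h) x - (l * c h) * W ^ n * f x) (weight_bound * (C * \<epsilon>) * r ^ n * W ^ n)" for n
  proof -
    have "L (\<lambda>x. (Q S ^^ n) h x - c h * W ^ n * f x) = (\<lambda>x. L ((Q S ^^ n) h) x - c h * W ^ n * (l * f x))"
      using L_diff[OF cone_contraction.iter_bounded[OF K H_bounded[OF h]] bounded_on_scale[OF f_bounded], of n "c h * W ^ n"]
      by (simp add: L_scale Lf)
    also have "\<dots> = (\<lambda>x. (Q S ^^ n) (L h) x - (l * c h) * W ^ n * f x)"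
      by (simp add: Qiter_L[OF H_bounded[OF h]] mult_ac)
    finally show ?thesis
      using cbound_L[OF cone_gap[OF e, folded W_def], of n] by (simp add: mult_ac)
  qed
  from cbound_gap_imp_limit[OF W_pos r this x] show ?thesis
    by (rule c_eqI[OF H_L[OF h] x])
qed

text \<open>
Division with remainder by \<open>k\<close> transfers the estimate from the powers of \<open>Q = L^k\<close> to all powers of \<open>L\<close>, with
the \<open>k\<close>-th root of the rate.
\<close>

lemma aperiodic_gap:
  assumes Sk: "S = {k}"
  obtains D \<rho> where "0 \<le> D" "0 < \<rho>" "\<rho> < 1"
    "\<And>h \<epsilon> n. cbound h \<epsilon> \<Longrightarrow> cbound (\<lambda>x. (L ^^ n) h x - c h * l ^ n * f x) (D * \<epsilon> * \<rho> ^ n * l ^ n)"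
proof -
  have k: "0 < k"
    using S Sk by (simp add: communicating_def)
  \<comment> \<open>The rate must be positive, because powers are compared by dividing by it.\<close>
  define r' where "r' = max r (1 / 2)"
  have r': "0 < r'" "r' < 1" "r \<le> r'"
    using r by (auto simp: r'_def)
  define \<rho> where "\<rho> = root k r'"
  have rho: "0 < \<rho>" "\<rho> < 1" "\<rho> ^ k = r'"
    using r' k by (auto simp: \<rho>_def)
  \<comment> \<open>The fewer than \<open>k\<close> remaining applications of \<open>L\<close> cost at most this factor each, relative to \<open>l\<close>.\<close>
  define a where "a = max 1 (weight_bound / l)"
  define D where "D = C * a ^ k / r'"
  have "0 \<le> D"
    using C_nonneg r' by (simp add: D_def a_def)
  have QS: "Q S = L ^^ k"
    by (intro ext) (simp add: Q_def Sk)
  have W: "W = l ^ k"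
    unfolding W_def by (simp add: Sk)
  have "cbound (\<lambda>x. (L ^^ n) h x - c h * l ^ n * f x) (D * \<epsilon> * \<rho> ^ n * l ^ n)" if h: "cbound h \<epsilon>" for h \<epsilon> n
  proof -
    define q j where "q = n div k" and "j = n mod k"
    have n: "n = j + k * q" and j: "j < k"
      using k by (simp_all add: q_def j_def)
    have hb: "h \<in> bounded_on X"
      by (rule cbound_bounded[OF h])
    have e: "0 \<le> \<epsilon>"
      by (rule cbound_nonneg[OF h])
    have Qq: "(Q S ^^ q) h = (L ^^ (k * q)) h"
      unfolding QS by (simp add: funpow_mult)
    have "cbound ((L ^^ j) (\<lambda>x. (Q S ^^ q) h x - c h * W ^ q * f x)) (weight_bound ^ j * (C * \<epsilon> * r ^ q * W ^ q))"
      by (rule cbound_Liter[OF cone_gap[OF h, folded W_def]])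
    also have "(L ^^ j) (\<lambda>x. (Q S ^^ q) h x - c h * W ^ q * f x) = (\<lambda>x. (L ^^ n) h x - c h * l ^ n * f x)"
    proof -
      have "(L ^^ j) (\<lambda>x. (Q S ^^ q) h x + (- c h * W ^ q) * f x) = (\<lambda>x. (L ^^ j) ((Q S ^^ q) h) x + (- c h * W ^ q) * (L ^^ j) f x)"
        unfolding Qq by (subst Liter_add[OF Liter_bounded[OF hb] bounded_on_scale[OF f_bounded]]) (simp only: Liter_scale)
      also have "(L ^^ j) ((Q S ^^ q) h) = (L ^^ n) h"
        by (simp add: Qq n funpow_add)
      finally show ?thesis
        by (simp add: Literf W n power_add power_mult mult_ac)
    qed
    finally have 1: "cbound (\<lambda>x. (L ^^ n) h x - c h * l ^ n * f x) (weight_bound ^ j * (C * \<epsilon> * r ^ q * W ^ q))" .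
    have 2: "weight_bound ^ j \<le> a ^ k * l ^ j"
    proof -
      have "weight_bound ^ j = (weight_bound / l) ^ j * l ^ j"
        using l_pos by (simp add: power_divide)
      also have "(weight_bound / l) ^ j \<le> a ^ j"
        using weight_bound l_pos by (intro power_mono) (auto simp: a_def)
      also have "a ^ j \<le> a ^ k"
        using j by (intro power_increasing) (auto simp: a_def)
      finally show ?thesis
        using l_pos by simp
    qed
    have 3: "r ^ q \<le> \<rho> ^ n / r'"
    proof -
      have "r ^ q * r' \<le> r' ^ q * \<rho> ^ j"
      proof (rule mult_mono)
        show "r ^ q \<le> r' ^ q"
          using r r' by (intro power_mono) auto
        have "\<rho> ^ k \<le> \<rho> ^ j"
          using j rho by (intro power_decreasing) auto
        then show "r' \<le> \<rho> ^ j"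
          using rho(3) by simp
      qed (use r' rho in auto)
      also have "\<dots> = \<rho> ^ n"
        by (simp add: n power_add power_mult rho(3))
      finally show ?thesis
        using r' by (simp add: pos_le_divide_eq)
    qed
    have "weight_bound ^ j * (C * \<epsilon> * r ^ q * W ^ q) \<le> (a ^ k * l ^ j) * (C * \<epsilon> * (\<rho> ^ n / r') * W ^ q)"
      using 2 3 C_nonneg e W_pos weight_bound r l_pos
      by (intro mult_mono mult_left_mono mult_right_mono) (auto simp: a_def)
    also have "\<dots> = D * \<epsilon> * \<rho> ^ n * l ^ n"
      by (simp add: D_def W n power_add power_mult mult_ac)
    finally show ?thesis
      by (rule cbound_mono[OF 1])
  qed
  with \<open>0 \<le> D\<close> rho show thesis
    by (intro that)
qed

end

section \<open>Point spectrum on complex Hoelder functions\<close>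

context ruelle_potential
begin

abbreviation Hc :: "((nat \<Rightarrow> real) \<Rightarrow> complex) set" where "Hc \<equiv> holder_space X \<alpha>"

lemma Hc_Re:
  assumes "g \<in> Hc"
  shows "(\<lambda>x. Re (g x)) \<in> H"
proof -
  obtain C where C: "0 \<le> C" "\<And>x. x \<notin> X \<Longrightarrow> g x = 0" "\<And>x y. x \<in> X \<Longrightarrow> y \<in> X \<Longrightarrow> norm (g x - g y) \<le> C * hdist x y"
    by (rule holder_spaceE[OF assms]) blast
  show ?thesis
  proof (rule holder_spaceI)
    show "norm (Re (g x) - Re (g y)) \<le> C * hdist x y" if "x \<in> X" "y \<in> X" for x y
      using C(3)[OF that] abs_Re_le_cmod[of "g x - g y"] by simp
  qed (simp add: C(2))
qed

lemma Hc_Im: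
  assumes "g \<in> Hc"
  shows "(\<lambda>x. Im (g x)) \<in> H"
proof -
  obtain C where C: "0 \<le> C" "\<And>x. x \<notin> X \<Longrightarrow> g x = 0" "\<And>x y. x \<in> X \<Longrightarrow> y \<in> X \<Longrightarrow> norm (g x - g y) \<le> C * hdist x y"
    by (rule holder_spaceE[OF assms]) blast
  show ?thesis
  proof (rule holder_spaceI)
    show "norm (Im (g x) - Im (g y)) \<le> C * hdist x y" if "x \<in> X" "y \<in> X" for x y
      using C(3)[OF that] abs_Im_le_cmod[of "g x - g y"] by simp
  qed (simp add: C(2))
qed

lemma HcI:
  assumes "(\<lambda>x. Re (g x)) \<in> H" "(\<lambda>x. Im (g x)) \<in> H"
  shows "g \<in> Hc"
proof -
  obtain C where C: "0 \<le> C" "\<And>x. x \<notin> X \<Longrightarrow> Re (g x) = 0" "\<And>x y. x \<in> X \<Longrightarrow> y \<in> X \<Longrightarrow> norm (Re (g x) - Re (g y)) \<le> C * hdist x y"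
    by (rule holder_spaceE[OF assms(1)]) blast
  obtain C' where C': "0 \<le> C'" "\<And>x. x \<notin> X \<Longrightarrow> Im (g x) = 0" "\<And>x y. x \<in> X \<Longrightarrow> y \<in> X \<Longrightarrow> norm (Im (g x) - Im (g y)) \<le> C' * hdist x y"
    by (rule holder_spaceE[OF assms(2)]) blast
  show ?thesis
  proof (rule holder_spaceI)
    show "g x = 0" if "x \<notin> X" for x
      using C(2)[OF that] C'(2)[OF that] by (simp add: complex_eq_iff)
    show "norm (g x - g y) \<le> (C + C') * hdist x y" if "x \<in> X" "y \<in> X" for x y
      using C(3)[OF that] C'(3)[OF that] cmod_le[of "g x - g y"] by (simp add: distrib_right)
  qed
qed

lemma Hc_bound:
  assumes "g \<in> Hc"
  obtains M where "0 \<le> M" "\<And>x. x \<in> X \<Longrightarrow> norm (g x) \<le> M"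
  by (rule holder_spaceE[OF assms]) (use that in blast)

lemma L_Re:
  assumes "\<And>y. y \<in> X \<Longrightarrow> norm (g y) \<le> M"
  shows "Re (L g x) = L (\<lambda>y. Re (g y)) x"
proof (cases "x \<in> X")
  case True
  from infsum_Re[OF abs_summable_summable[OF L_abs_summable[where \<xi> = g, OF True assms]]] show ?thesis
    by (simp add: L_eq[OF True])
qed (simp add: L_off)

lemma L_Im:
  assumes "\<And>y. y \<in> X \<Longrightarrow> norm (g y) \<le> M"
  shows "Im (L g x) = L (\<lambda>y. Im (g y)) x"
proof (cases "x \<in> X")
  case True
  from infsum_Im[OF abs_summable_summable[OF L_abs_summable[where \<xi> = g, OF True assms]]] show ?thesis
    by (simp add: L_eq[OF True])
qed (simp add: L_off)

lemma Lc_Re: "g \<in> Hc \<Longrightarrow> Re (L g x) = L (\<lambda>y. Re (g y)) x"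
  by (rule Hc_bound) (assumption, rule L_Re)

lemma Lc_Im: "g \<in> Hc \<Longrightarrow> Im (L g x) = L (\<lambda>y. Im (g y)) x"
  by (rule Hc_bound) (assumption, rule L_Im)

lemma Hc_L: "g \<in> Hc \<Longrightarrow> L g \<in> Hc"
  by (rule HcI) (simp_all add: Lc_Re Lc_Im H_L Hc_Re Hc_Im)

lemma Hc_Liter: "g \<in> Hc \<Longrightarrow> (L ^^ n) g \<in> Hc"
  by (induction n) (simp_all add: Hc_L)

lemma Liter_Re: "g \<in> Hc \<Longrightarrow> Re ((L ^^ n) g x) = (L ^^ n) (\<lambda>y. Re (g y)) x"
proof (induction n arbitrary: x)
  case (Suc n)
  then show ?case
    using Lc_Re[OF Hc_Liter[OF Suc.prems], of n x] by simp
qed simp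

lemma Liter_Im: "g \<in> Hc \<Longrightarrow> Im ((L ^^ n) g x) = (L ^^ n) (\<lambda>y. Im (g y)) x"
proof (induction n arbitrary: x)
  case (Suc n)
  then show ?case
    using Lc_Im[OF Hc_Liter[OF Suc.prems], of n x] by simp
qed simp

lemma Lc_diff:
  fixes g h :: "(nat \<Rightarrow> real) \<Rightarrow> 'v::banach"
  assumes "\<And>y. y \<in> X \<Longrightarrow> norm (g y) \<le> M" "\<And>y. y \<in> X \<Longrightarrow> norm (h y) \<le> M'"
  shows "L (\<lambda>y. g y - h y) x = L g x - L h x"
proof (cases "x \<in> X")
  case True
  have h': "\<And>y. y \<in> X \<Longrightarrow> norm (- h y) \<le> M'"
    using assms(2) by simp
  have "L (\<lambda>y. g y - h y) x = L g x + L (\<lambda>y. - h y) x"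
    using infsum_add[OF abs_summable_summable[OF L_abs_summable[where \<xi> = g, OF True assms(1)]] abs_summable_summable[OF L_abs_summable[where \<xi> = "\<lambda>y. - h y", OF True h']]]
    by (simp add: L_eq[OF True] scaleR_diff_right)
  moreover have "L (\<lambda>y. - h y) x = - L h x"
    by (simp add: L_eq[OF True] infsum_uminus)
  ultimately show ?thesis
    by simp
qed (simp add: L_off)

lemma Lc_mult:
  fixes z :: complex
  shows "L (\<lambda>y. z * g y) x = z * L g x"
proof (cases "x \<in> X")
  case True
  then show ?thesis
    using infsum_cmult_right'[of z "\<lambda>a. exp (\<phi> (prepend a x)) *\<^sub>R g (prepend a x)" "pred (x 0)"]
    by (simp add: L_eq)
qed (simp add: L_off)

lemma Lc_of_real: "h \<in> bounded_on X \<Longrightarrow> L (\<lambda>y. complex_of_real (h y)) x = complex_of_real (L h x)"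
proof -
  assume "h \<in> bounded_on X"
  then obtain M where M: "\<And>y. y \<in> X \<Longrightarrow> norm (complex_of_real (h y)) \<le> M"
    unfolding bounded_on_def norm_of_real real_norm_def by blast
  have "L (\<lambda>_. 0) x = (0::real)"
    using L_scale[of 0 "\<lambda>_. 0"] by simp
  then show ?thesis
    using L_Re[where g = "\<lambda>y. complex_of_real (h y)", OF M, of x] L_Im[where g = "\<lambda>y. complex_of_real (h y)", OF M, of x] by (simp add: complex_eq_iff)
qed

lemma L_norm_le_L_norm:
  fixes g :: "(nat \<Rightarrow> real) \<Rightarrow> complex"
  assumes "\<And>y. y \<in> X \<Longrightarrow> norm (g y) \<le> M"
  shows "norm (L g x) \<le> L (\<lambda>y. norm (g y)) x"
proof (cases "x \<in> X")
  case True
  from norm_infsum_bound[OF L_abs_summable[where \<xi> = g, OF True assms]] show ?thesis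
    by (simp add: L_eq[OF True])
qed (simp add: L_off)

lemma hdist_pos:
  assumes "x \<in> X" "y \<in> X" "x \<noteq> y"
  shows "0 < hdist x y"
proof -
  obtain n where "x n \<noteq> y n"
    using assms(3) by blast
  then have "0 < \<bar>x n - y n\<bar> / 2 ^ Suc n"
    by simp
  also have "\<dots> \<le> seq_dist x y"
    by (rule seq_dist_ge_coordinate[OF assms(1,2)])
  finally show ?thesis
    by (simp add: hdist_def)
qed

text \<open>
The suprema in the norm are over sets that are bounded above, and nonempty because there are at least two
symbols.
\<close>

lemma holder_norm_ge:
  fixes g :: "(nat \<Rightarrow> real) \<Rightarrow> 'v::real_normed_vector"
  assumes g: "g \<in> holder_space X \<alpha>"
  shows "x \<in> X \<Longrightarrow> norm (g x) \<le> holder_norm X \<alpha> g"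
    and "x \<in> X \<Longrightarrow> y \<in> X \<Longrightarrow> norm (g x - g y) \<le> holder_norm X \<alpha> g * hdist x y"
proof -
  obtain C where C: "0 \<le> C" "\<And>x y. x \<in> X \<Longrightarrow> y \<in> X \<Longrightarrow> norm (g x - g y) \<le> C * hdist x y" "\<And>x. x \<in> X \<Longrightarrow> norm (g x) \<le> C"
    by (rule holder_spaceE[OF g]) blast
  define P where "P = {(x, y). x \<in> X \<and> y \<in> X \<and> x \<noteq> y}"
  define q where "q = (\<lambda>(x, y). norm (g x - g y) / seq_dist x y powr \<alpha>)"
  have q_le: "q xy \<le> C" if "xy \<in> P" for xy
    using that C(2)[of "fst xy" "snd xy"] hdist_pos[of "fst xy" "snd xy"]
    by (auto simp: P_def q_def hdist_def pos_divide_le_eq)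
  have bdd: "bdd_above ((\<lambda>x. norm (g x)) ` X)" "bdd_above (q ` P)"
    using C(3) by (auto intro!: bdd_aboveI2[of _ _ C] q_le)
  have eq: "holder_norm X \<alpha> g = (SUP x\<in>X. norm (g x)) + (SUP xy\<in>P. q xy)"
    by (simp add: holder_norm_def P_def q_def case_prod_beta')
  obtain x1 x2 where x12: "x1 \<in> X" "x1 0 = b 0" "x2 \<in> X" "x2 0 = b 1"
    using X_point_starting_with[OF rangeI] by metis
  then have "x1 \<noteq> x2"
    using b_inj by (metis injD zero_neq_one)
  with x12 have P12: "(x1, x2) \<in> P"
    by (simp add: P_def)
  have sup1: "norm (g x) \<le> (SUP x\<in>X. norm (g x))" if "x \<in> X" for x
    by (rule cSUP_upper[OF that bdd(1)])
  have sup2: "q xy \<le> (SUP xy\<in>P. q xy)" if "xy \<in> P" for xy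
    by (rule cSUP_upper[OF that bdd(2)])
  have n1: "0 \<le> (SUP x\<in>X. norm (g x))"
    using sup1[OF x12(1)] norm_ge_zero order_trans by blast
  have "0 \<le> q (x1, x2)"
    by (simp add: q_def)
  with sup2[OF P12] have n2: "0 \<le> (SUP xy\<in>P. q xy)"
    by linarith
  show "x \<in> X \<Longrightarrow> norm (g x) \<le> holder_norm X \<alpha> g"
    using sup1[of x] n2 unfolding eq by linarith
  assume x: "x \<in> X" and y: "y \<in> X"
  show "norm (g x - g y) \<le> holder_norm X \<alpha> g * hdist x y"
  proof (cases "x = y")
    case True
    then show ?thesis
      using n1 n2 hdist_nonneg[of x y] unfolding eq by simp
  next
    case False
    then have "q (x, y) \<le> holder_norm X \<alpha> g"
      using sup2[of "(x, y)"] n1 x y unfolding eq by (simp add: P_def)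
    then show ?thesis
      using hdist_pos[OF x y False] by (simp add: q_def hdist_def pos_divide_le_eq)
  qed
qed

lemma holder_norm_le:
  fixes g :: "(nat \<Rightarrow> real) \<Rightarrow> 'v::real_normed_vector"
  assumes "\<And>x. x \<in> X \<Longrightarrow> norm (g x) \<le> M" "\<And>x y. x \<in> X \<Longrightarrow> y \<in> X \<Longrightarrow> norm (g x - g y) \<le> M' * hdist x y"
  shows "holder_norm X \<alpha> g \<le> M + M'"
proof -
  define P where "P = {(x, y). x \<in> X \<and> y \<in> X \<and> x \<noteq> y}"
  obtain x1 x2 where x12: "x1 \<in> X" "x1 0 = b 0" "x2 \<in> X" "x2 0 = b 1"
    using X_point_starting_with[OF rangeI] by metis
  then have "x1 \<noteq> x2"
    using b_inj by (metis injD zero_neq_one)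
  with x12 have P12: "(x1, x2) \<in> P"
    by (simp add: P_def)
  have "(SUP x\<in>X. norm (g x)) \<le> M"
    by (rule cSUP_least[OF X_nonempty assms(1)])
  moreover have "(SUP (x, y)\<in>P. norm (g x - g y) / seq_dist x y powr \<alpha>) \<le> M'"
  proof (rule cSUP_least)
    show "P \<noteq> {}"
      using P12 by blast
    show "(case xy of (x, y) \<Rightarrow> norm (g x - g y) / seq_dist x y powr \<alpha>) \<le> M'" if "xy \<in> P" for xy
      using that assms(2)[of "fst xy" "snd xy"] hdist_pos[of "fst xy" "snd xy"]
      by (auto simp: P_def hdist_def pos_divide_le_eq)
  qed
  ultimately show ?thesis
    by (simp add: holder_norm_def P_def)
qed

end

context ruelle_spectral
begin

definition c_complex :: "((nat \<Rightarrow> real) \<Rightarrow> complex) \<Rightarrow> complex" where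
  "c_complex g = Complex (c (\<lambda>x. Re (g x))) (c (\<lambda>x. Im (g x)))"

lemma L_eigenfunction_complex: "L (\<lambda>x. z * complex_of_real (f x)) x = z * complex_of_real (l * f x)"
  by (simp only: Lc_mult Lc_of_real[OF f_bounded] Lf)

lemma scaled_f_Hc: "(\<lambda>x. z * complex_of_real (f x)) \<in> Hc"
  by (rule HcI) (simp_all add: H_scale[OF f_H])

lemma simple: "simple_eigenvalue (range b) A \<alpha> \<phi> (complex_of_real l)"
  unfolding simple_eigenvalue_def
proof (intro exI conjI)
  let ?g = "\<lambda>x. complex_of_real (f x)"
  obtain x where "x \<in> X"
    using X_nonempty by blast
  then have "?g x \<noteq> 0"
    using f_pos by fastforce
  then show "?g \<noteq> (\<lambda>_. 0)"
    by metis
  show "eigenspace (range b) A \<alpha> \<phi> (complex_of_real l) = range (\<lambda>z x. z * ?g x)"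
  proof (intro equalityI subsetI)
    fix g assume "g \<in> eigenspace (range b) A \<alpha> \<phi> (complex_of_real l)"
    then have g: "g \<in> Hc" and Lg: "L g = (\<lambda>x. complex_of_real l * g x)"
      by (simp_all add: eigenspace_def)
    have "L (\<lambda>x. Re (g x)) x = l * Re (g x)" "L (\<lambda>x. Im (g x)) x = l * Im (g x)" for x
      using Lc_Re[OF g, of x] Lc_Im[OF g, of x] by (simp_all add: Lg)
    then have "L (\<lambda>x. Re (g x)) = (\<lambda>x. l * Re (g x))" "L (\<lambda>x. Im (g x)) = (\<lambda>x. l * Im (g x))"
      by blast+
    then have "Re (g x) = c (\<lambda>x. Re (g x)) * f x" "Im (g x) = c (\<lambda>x. Im (g x)) * f x" if "x \<in> X" for x
      using L_eigen_imp_c[OF Hc_Re[OF g] _ that] L_eigen_imp_c[OF Hc_Im[OF g] _ that] by simp_all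
    then have "g x = c_complex g * ?g x" if "x \<in> X" for x
      using that by (simp add: complex_eq_iff c_complex_def)
    moreover have "g x = c_complex g * ?g x" if "x \<notin> X" for x
      using g that f_off[OF that] by (simp add: holder_space_def)
    ultimately have "g = (\<lambda>x. c_complex g * ?g x)"
      by blast
    then show "g \<in> range (\<lambda>z x. z * ?g x)"
      by blast
  next
    fix g assume "g \<in> range (\<lambda>z x. z * ?g x)"
    then obtain z where z: "g = (\<lambda>x. z * ?g x)"
      by blast
    have "L (\<lambda>x. z * ?g x) = (\<lambda>x. complex_of_real l * (z * ?g x))"
      by (rule ext) (simp add: L_eigenfunction_complex)
    with scaled_f_Hc[of z] show "g \<in> eigenspace (range b) A \<alpha> \<phi> (complex_of_real l)"
      unfolding z eigenspace_def by simp
  qed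
qed

text \<open>
The modulus of an eigenfunction is dominated by a multiple of \<open>f\<close>, and this domination is
preserved by \<open>L\<close>. So \<open>|z|^n\<close> grows at most like \<open>l^n\<close>.
\<close>

lemma maximal:
  assumes "is_eigenvalue (range b) A \<alpha> \<phi> z"
  shows "cmod z \<le> l"
proof -
  obtain g where g: "g \<in> Hc" "L g = (\<lambda>x. z * g x)" "g \<noteq> (\<lambda>_. 0)"
    using assms unfolding is_eigenvalue_def eigenspace_def by blast
  obtain M where M: "0 \<le> M" "\<And>x. x \<in> X \<Longrightarrow> norm (g x) \<le> M"
    by (rule Hc_bound[OF g(1)]) blast
  have g_off: "g x = 0" if "x \<notin> X" for x
    using g(1) that by (simp add: holder_space_def)
  have gb: "(\<lambda>x. norm (g x)) \<in> bounded_on X"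
    using M(2) g_off by (auto simp: bounded_on_def)
  have bound: "cmod z ^ n * norm (g x) \<le> M / m * l ^ n * f x" if "x \<in> X" for n x
    using that
  proof (induction n arbitrary: x)
    case 0
    have "M / m * m \<le> M / m * f x"
      using f_ge[OF 0] M(1) m_pos by (intro mult_left_mono) auto
    then show ?case
      using M(2)[OF 0] m_pos by simp
  next
    case (Suc n)
    have "cmod z ^ Suc n * norm (g x) = cmod z ^ n * norm (L g x)"
      by (simp add: g(2) norm_mult)
    also have "\<dots> \<le> cmod z ^ n * L (\<lambda>y. norm (g y)) x"
      by (intro mult_left_mono L_norm_le_L_norm[OF M(2)]) auto
    also have "\<dots> = L (\<lambda>y. cmod z ^ n * norm (g y)) x"
      by (simp add: L_scale)
    also have "\<dots> \<le> L (\<lambda>y. M / m * l ^ n * f y) x"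
      by (intro L_mono bounded_on_scale gb f_bounded Suc)
    also have "\<dots> = M / m * l ^ Suc n * f x"
      using L_scale[of "M / m * l ^ n" f] by (simp add: Lf)
    finally show ?case .
  qed
  obtain x where gx: "g x \<noteq> 0"
    using g(3) by blast
  then have x: "x \<in> X"
    using g_off by blast
  show ?thesis
  proof (rule ccontr)
    assume "\<not> cmod z \<le> l"
    then have "1 < cmod z / l"
      using l_pos by simp
    then obtain n where n: "M / m * f x / norm (g x) < (cmod z / l) ^ n"
      using real_arch_pow by blast
    have "cmod z ^ n \<le> M / m * l ^ n * f x / norm (g x)"
      using bound[OF x, of n] gx by (subst pos_le_divide_eq) simp_all
    also have "\<dots> = M / m * f x / norm (g x) * l ^ n"
      by simp
    finally have "(cmod z / l) ^ n \<le> M / m * f x / norm (g x)"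
      using l_pos by (simp only: power_divide pos_divide_le_eq zero_less_power)
    with n show False
      by simp
  qed
qed

lemma c_complex_mult:
  assumes "g \<in> Hc"
  shows "c_complex (\<lambda>x. z * g x) = z * c_complex g"
proof -
  have "c (\<lambda>x. Re z * Re (g x) - Im z * Im (g x)) = Re z * c (\<lambda>x. Re (g x)) - Im z * c (\<lambda>x. Im (g x))"
    by (simp add: c_diff_scale[OF H_scale[OF Hc_Re[OF assms]] Hc_Im[OF assms]] c_scale[OF Hc_Re[OF assms]])
  moreover have "c (\<lambda>x. Re z * Im (g x) + Im z * Re (g x)) = Re z * c (\<lambda>x. Im (g x)) + Im z * c (\<lambda>x. Re (g x))"
    by (simp add: c_add[OF H_scale[OF Hc_Im[OF assms]] H_scale[OF Hc_Re[OF assms]]] c_scale[OF Hc_Re[OF assms]] c_scale[OF Hc_Im[OF assms]])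
  ultimately show ?thesis
    by (simp add: c_complex_def complex_eq_iff)
qed

lemma c_complex_L: "g \<in> Hc \<Longrightarrow> c_complex (L g) = l * c_complex g"
  by (simp add: c_complex_def Lc_Re Lc_Im c_L Hc_Re Hc_Im complex_eq_iff)

end

section \<open>The resolvent outside a smaller disk\<close>

text \<open>
The situation of an aperiodic matrix, in which the iterates of \<open>L\<close> themselves approach their leading term
exponentially fast.
\<close>

locale ruelle_gap = ruelle_spectral +
  fixes D \<rho> :: real
  assumes D_nonneg: "0 \<le> D" and rho: "0 < \<rho>" "\<rho> < 1"
    and L_gap: "\<And>h \<epsilon> n. cone_bound (shift_space (range b) A) ty hdist aperture h \<epsilon> \<Longrightarrow>
      cone_bound (shift_space (range b) A) ty hdist aperture (\<lambda>x. (ruelle (range b) A \<phi> ^^ n) h x - c h * l ^ n * f x) (D * \<epsilon> * \<rho> ^ n * l ^ n)"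
begin

definition remainder :: "((nat \<Rightarrow> real) \<Rightarrow> complex) \<Rightarrow> nat \<Rightarrow> (nat \<Rightarrow> real) \<Rightarrow> complex" where
  "remainder g n x = (L ^^ n) g x - c_complex g * of_real (l ^ n * f x)"

lemma remainder_Hc: "g \<in> Hc \<Longrightarrow> remainder g n \<in> Hc"
proof (rule HcI)
  assume g: "g \<in> Hc"
  show "(\<lambda>x. Re (remainder g n x)) \<in> H"
    using H_diff[OF H_Liter[OF Hc_Re[OF g]] H_scale[OF f_H], of n "c (\<lambda>x. Re (g x)) * l ^ n"]
    by (simp add: remainder_def Liter_Re[OF g] c_complex_def mult.assoc)
  show "(\<lambda>x. Im (remainder g n x)) \<in> H"
    using H_diff[OF H_Liter[OF Hc_Im[OF g]] H_scale[OF f_H], of n "c (\<lambda>x. Im (g x)) * l ^ n"]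
    by (simp add: remainder_def Liter_Im[OF g] c_complex_def mult.assoc)
qed

lemma L_remainder:
  assumes g: "g \<in> Hc"
  shows "L (remainder g n) x = remainder g (Suc n) x"
proof -
  obtain M where M: "\<And>x. x \<in> X \<Longrightarrow> norm ((L ^^ n) g x) \<le> M"
    by (rule Hc_bound[OF Hc_Liter[OF g]]) blast
  obtain M' where M': "\<And>x. x \<in> X \<Longrightarrow> norm (c_complex g * of_real (l ^ n) * complex_of_real (f x)) \<le> M'"
    by (rule Hc_bound[OF scaled_f_Hc]) blast
  have "L (remainder g n) x = L (\<lambda>x. (L ^^ n) g x - c_complex g * of_real (l ^ n) * complex_of_real (f x)) x"
    by (simp add: remainder_def[abs_def] mult.assoc)
  also have "\<dots> = L ((L ^^ n) g) x - L (\<lambda>x. c_complex g * of_real (l ^ n) * complex_of_real (f x)) x"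
    by (rule Lc_diff[OF M M'])
  also have "\<dots> = remainder g (Suc n) x"
    unfolding L_eigenfunction_complex by (simp add: remainder_def mult_ac)
  finally show ?thesis .
qed

text \<open>
The norm of the cone is applied to real and imaginary parts and translated back into the Hoelder norm.
\<close>

lemma remainder_estimate:
  obtains E where "0 \<le> E"
    "\<And>g n x. g \<in> Hc \<Longrightarrow> x \<in> X \<Longrightarrow> norm (remainder g n x) \<le> E * holder_norm X \<alpha> g * (\<rho> * l) ^ n"
    "\<And>g n x y. g \<in> Hc \<Longrightarrow> x \<in> X \<Longrightarrow> y \<in> X \<Longrightarrow> norm (remainder g n x - remainder g n y) \<le> E * holder_norm X \<alpha> g * (\<rho> * l) ^ n * hdist x y"
    "\<And>g. g \<in> Hc \<Longrightarrow> norm (c_complex g) \<le> E * holder_norm X \<alpha> g"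
proof -
  obtain CH where CH: "0 \<le> CH" "\<And>h \<epsilon> x y. cbound h \<epsilon> \<Longrightarrow> x \<in> X \<Longrightarrow> y \<in> X \<Longrightarrow> \<bar>h x - h y\<bar> \<le> CH * \<epsilon> * hdist x y"
    using cbound_imp_holder by blast
  define E where "E = 6 * D + 6 * CH * D + 6 * C"
  have parts: "0 \<le> 6 * D" "0 \<le> 6 * CH * D" "0 \<le> 6 * C"
    using D_nonneg CH(1) C_nonneg by simp_all
  have E_ge: "6 * D \<le> E" "6 * CH * D \<le> E" "6 * C \<le> E"
    using parts by (simp_all add: E_def)
  obtain z0 where z0: "z0 \<in> X"
    using X_nonempty by blast
  have norm0: "0 \<le> holder_norm X \<alpha> g" if "g \<in> Hc" for g
    using holder_norm_ge(1)[OF that z0] norm_ge_zero order_trans by blast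
  have re: "cbound (\<lambda>x. Re (g x)) (3 * holder_norm X \<alpha> g)" and im: "cbound (\<lambda>x. Im (g x)) (3 * holder_norm X \<alpha> g)"
    if g: "g \<in> Hc" for g
  proof -
    show "cbound (\<lambda>x. Re (g x)) (3 * holder_norm X \<alpha> g)"
    proof (rule holder_imp_cbound)
      show "Re (g x) = 0" if "x \<notin> X" for x
        using g that by (simp add: holder_space_def)
      show "\<bar>Re (g x)\<bar> \<le> holder_norm X \<alpha> g" if "x \<in> X" for x
        using holder_norm_ge(1)[OF g that] abs_Re_le_cmod[of "g x"] by linarith
      show "\<bar>Re (g x) - Re (g y)\<bar> \<le> holder_norm X \<alpha> g * hdist x y" if "x \<in> X" "y \<in> X" for x y
        using holder_norm_ge(2)[OF g that] abs_Re_le_cmod[of "g x - g y"] by simp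
    qed
    show "cbound (\<lambda>x. Im (g x)) (3 * holder_norm X \<alpha> g)"
    proof (rule holder_imp_cbound)
      show "Im (g x) = 0" if "x \<notin> X" for x
        using g that by (simp add: holder_space_def)
      show "\<bar>Im (g x)\<bar> \<le> holder_norm X \<alpha> g" if "x \<in> X" for x
        using holder_norm_ge(1)[OF g that] abs_Im_le_cmod[of "g x"] by linarith
      show "\<bar>Im (g x) - Im (g y)\<bar> \<le> holder_norm X \<alpha> g * hdist x y" if "x \<in> X" "y \<in> X" for x y
        using holder_norm_ge(2)[OF g that] abs_Im_le_cmod[of "g x - g y"] by simp
    qed
  qed
  have re_err: "cbound (\<lambda>x. Re (remainder g n x)) (3 * (D * holder_norm X \<alpha> g * (\<rho> * l) ^ n))"
    and im_err: "cbound (\<lambda>x. Im (remainder g n x)) (3 * (D * holder_norm X \<alpha> g * (\<rho> * l) ^ n))"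
    if g: "g \<in> Hc" for g n
    using L_gap[OF re[OF g], of n] L_gap[OF im[OF g], of n]
    by (simp_all add: remainder_def Liter_Re[OF g] Liter_Im[OF g] c_complex_def power_mult_distrib mult_ac)
  show thesis
  proof (rule that)
    show "0 \<le> E"
      using parts by (simp add: E_def)
  next
    fix g n x assume g: "g \<in> Hc" and x: "x \<in> X"
    have N: "0 \<le> holder_norm X \<alpha> g * (\<rho> * l) ^ n"
      using norm0[OF g] rho l_pos by simp
    have "norm (remainder g n x) \<le> 6 * D * (holder_norm X \<alpha> g * (\<rho> * l) ^ n)"
      using cbound_abs[OF re_err[OF g] x, of n] cbound_abs[OF im_err[OF g] x, of n] cmod_le[of "remainder g n x"] by simp
    also have "\<dots> \<le> E * (holder_norm X \<alpha> g * (\<rho> * l) ^ n)"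
      by (rule mult_right_mono[OF E_ge(1) N])
    finally show "norm (remainder g n x) \<le> E * holder_norm X \<alpha> g * (\<rho> * l) ^ n"
      by (simp add: mult.assoc)
  next
    fix g n x y assume g: "g \<in> Hc" and xy: "x \<in> X" "y \<in> X"
    have N: "0 \<le> holder_norm X \<alpha> g * (\<rho> * l) ^ n * hdist x y"
      using norm0[OF g] rho l_pos hdist_nonneg[of x y] by simp
    have "norm (remainder g n x - remainder g n y) \<le> 6 * CH * D * (holder_norm X \<alpha> g * (\<rho> * l) ^ n * hdist x y)"
      using CH(2)[OF re_err[OF g] xy, of n] CH(2)[OF im_err[OF g] xy, of n] cmod_le[of "remainder g n x - remainder g n y"] by (simp add: mult_ac)
    also have "\<dots> \<le> E * (holder_norm X \<alpha> g * (\<rho> * l) ^ n * hdist x y)"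
      by (rule mult_right_mono[OF E_ge(2) N])
    finally show "norm (remainder g n x - remainder g n y) \<le> E * holder_norm X \<alpha> g * (\<rho> * l) ^ n * hdist x y"
      by (simp add: mult.assoc)
  next
    fix g assume g: "g \<in> Hc"
    have "norm (c_complex g) \<le> 6 * C * holder_norm X \<alpha> g"
      using c_bound[OF re[OF g]] c_bound[OF im[OF g]] cmod_le[of "c_complex g"] by (simp add: c_complex_def)
    also have "\<dots> \<le> E * holder_norm X \<alpha> g"
      by (rule mult_right_mono[OF E_ge(3) norm0[OF g]])
    finally show "norm (c_complex g) \<le> E * holder_norm X \<alpha> g" .
  qed
qed

lemma ratio_bounds:
  assumes "\<rho> * l < cmod z"
  shows "0 \<le> \<rho> * l / cmod z" "\<rho> * l / cmod z < 1" "0 < cmod z" "norm (\<rho> * l / cmod z) < 1"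
proof -
  have rl: "0 < \<rho> * l"
    using rho l_pos by simp
  with assms show z: "0 < cmod z"
    by linarith
  show 0: "0 \<le> \<rho> * l / cmod z" and 1: "\<rho> * l / cmod z < 1"
    using rl z assms by (simp_all only: pos_divide_less_eq mult_1 divide_nonneg_pos less_imp_le)
  from 0 1 show "norm (\<rho> * l / cmod z) < 1"
    by (simp only: real_norm_def abs_of_nonneg)
qed

text \<open>
Applying \<open>c\<close> to the eigenvalue equation shows that \<open>c\<close> vanishes on \<open>g\<close>. Then the iterates \<open>z^n g\<close> are
pure remainder, which decays faster than \<open>|z|^n\<close> grows.
\<close>

lemma eigen_outside_disk:
  assumes g: "g \<in> Hc" and Lg: "\<And>x. L g x = z * g x" and z: "\<rho> * l < cmod z" "z \<noteq> of_real l"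
  shows "g x = 0"
proof (cases "x \<in> X")
  case True
  have "L g = (\<lambda>x. z * g x)"
    using Lg by blast
  then have "z * c_complex g = l * c_complex g"
    using c_complex_L[OF g] c_complex_mult[OF g, of z] by simp
  with z(2) have cc0: "c_complex g = 0"
    by simp
  have iter: "(L ^^ n) g = (\<lambda>x. z ^ n * g x)" for n
  proof (induction n)
    case (Suc n)
    then show ?case
      by (intro ext) (simp add: Lc_mult Lg)
  qed simp
  obtain E where E: "0 \<le> E" "\<And>n. norm (remainder g n x) \<le> E * holder_norm X \<alpha> g * (\<rho> * l) ^ n"
    using remainder_estimate g True by metis
  have rl: "0 < \<rho> * l"
    using rho l_pos by simp
  have le: "norm (g x) \<le> E * holder_norm X \<alpha> g * (\<rho> * l / cmod z) ^ n" for n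
  proof -
    have z0: "0 < cmod z ^ n"
      using z(1) rl by (intro zero_less_power) linarith
    have "cmod z ^ n * norm (g x) \<le> E * holder_norm X \<alpha> g * (\<rho> * l) ^ n"
      using E(2)[of n] by (simp add: remainder_def iter cc0 norm_mult norm_power)
    then have "norm (g x) \<le> E * holder_norm X \<alpha> g * (\<rho> * l) ^ n / cmod z ^ n"
      using z0 by (subst pos_le_divide_eq) (simp_all only: mult.commute)
    then show ?thesis
      by (simp only: power_divide times_divide_eq_right)
  qed
  have lim: "(\<lambda>n. E * holder_norm X \<alpha> g * (\<rho> * l / cmod z) ^ n) \<longlonglongrightarrow> 0"
    by (intro tendsto_mult_right_zero LIMSEQ_power_zero ratio_bounds(4)[OF z(1)])
  have "norm (g x) \<le> 0"
    using LIMSEQ_le_const[OF lim, of "norm (g x)"] le by blast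
  then show ?thesis
    by simp
next
  case False
  with g show ?thesis
    by (simp add: holder_space_def)
qed

definition series :: "complex \<Rightarrow> ((nat \<Rightarrow> real) \<Rightarrow> complex) \<Rightarrow> (nat \<Rightarrow> real) \<Rightarrow> complex" where
  "series z g x = (if x \<in> X then \<Sum>n. remainder g n x / z ^ Suc n else 0)"

text \<open>
On the line spanned by \<open>f\<close> the resolvent is multiplication by \<open>1 / (z - l)\<close>. On the
kernel of \<open>c_complex\<close>, where the iterates are remainders, it is the Neumann series \<open>series\<close>.
\<close>

definition resolvent :: "complex \<Rightarrow> ((nat \<Rightarrow> real) \<Rightarrow> complex) \<Rightarrow> (nat \<Rightarrow> real) \<Rightarrow> complex" where
  "resolvent z g x = c_complex g / (z - of_real l) * of_real (f x) + series z g x"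

lemma geometric_term:
  fixes z :: complex
  assumes z: "\<rho> * l < cmod z" and N: "norm w \<le> N * (\<rho> * l) ^ n"
  shows "norm (w / z ^ Suc n) \<le> N / cmod z * (\<rho> * l / cmod z) ^ n"
proof -
  have z0: "0 < cmod z"
    using z mult_pos_pos[OF rho(1) l_pos] by linarith
  have "norm (w / z ^ Suc n) = norm w / cmod z ^ Suc n"
    by (simp add: norm_divide norm_mult norm_power)
  also have "\<dots> \<le> N * (\<rho> * l) ^ n / cmod z ^ Suc n"
    using N z0 by (intro divide_right_mono) auto
  also have "\<dots> = N / cmod z * (\<rho> * l / cmod z) ^ n"
    by (simp add: power_divide)
  finally show ?thesis .
qed

lemma series_sums:
  assumes z: "\<rho> * l < cmod z" and g: "g \<in> Hc" and x: "x \<in> X"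
  shows "(\<lambda>n. remainder g n x / z ^ Suc n) sums series z g x"
proof -
  obtain E where E: "\<And>n. norm (remainder g n x) \<le> E * holder_norm X \<alpha> g * (\<rho> * l) ^ n"
    using remainder_estimate g x by metis
  have "summable (\<lambda>n. E * holder_norm X \<alpha> g / cmod z * (\<rho> * l / cmod z) ^ n)"
    by (intro summable_mult summable_geometric ratio_bounds(4)[OF z])
  then have "summable (\<lambda>n. remainder g n x / z ^ Suc n)"
    by (rule summable_comparison_test'[where N = 0]) (rule geometric_term[OF z E])
  then show ?thesis
    using x by (simp add: series_def summable_sums)
qed

lemma series_estimate:
  assumes z: "\<rho> * l < cmod z"
  obtains E where "0 \<le> E"
    "\<And>g N x. g \<in> Hc \<Longrightarrow> x \<in> X \<Longrightarrow>
      norm (series z g x - (\<Sum>n<N. remainder g n x / z ^ Suc n)) \<le> E * holder_norm X \<alpha> g * (\<rho> * l / cmod z) ^ N"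
    "\<And>g x y. g \<in> Hc \<Longrightarrow> x \<in> X \<Longrightarrow> y \<in> X \<Longrightarrow> norm (series z g x - series z g y) \<le> E * holder_norm X \<alpha> g * hdist x y"
    "\<And>g. g \<in> Hc \<Longrightarrow> norm (c_complex g) \<le> E * holder_norm X \<alpha> g"
proof -
  obtain E where E: "0 \<le> E"
    "\<And>g n x. g \<in> Hc \<Longrightarrow> x \<in> X \<Longrightarrow> norm (remainder g n x) \<le> E * holder_norm X \<alpha> g * (\<rho> * l) ^ n"
    "\<And>g n x y. g \<in> Hc \<Longrightarrow> x \<in> X \<Longrightarrow> y \<in> X \<Longrightarrow> norm (remainder g n x - remainder g n y) \<le> E * holder_norm X \<alpha> g * (\<rho> * l) ^ n * hdist x y"
    "\<And>g. g \<in> Hc \<Longrightarrow> norm (c_complex g) \<le> E * holder_norm X \<alpha> g"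
    by (rule remainder_estimate) blast
  define q where "q = \<rho> * l / cmod z"
  have q: "0 \<le> q" "q < 1" "0 < cmod z"
    using ratio_bounds[OF z] by (simp_all only: q_def)
  define E' where "E' = E + E / cmod z / (1 - q)"
  have parts: "0 \<le> E / cmod z / (1 - q)"
    using E(1) q by simp
  obtain z0 where z0: "z0 \<in> X"
    using X_nonempty by blast
  have norm0: "0 \<le> holder_norm X \<alpha> g" if "g \<in> Hc" for g
    using holder_norm_ge(1)[OF that z0] norm_ge_zero order_trans by blast
  have geo: "summable (\<lambda>n. a * q ^ n)" "(\<Sum>n. a * q ^ n) = a / (1 - q)" for a
  proof -
    have "(\<lambda>n. a * q ^ n) sums (a * (1 / (1 - q)))"
      using q by (intro sums_mult geometric_sums) simp
    then show "summable (\<lambda>n. a * q ^ n)" "(\<Sum>n. a * q ^ n) = a / (1 - q)"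
      by (simp_all add: sums_iff)
  qed
  show thesis
  proof (rule that)
    show "0 \<le> E'"
      using E(1) parts by (simp add: E'_def)
  next
    fix g N x assume g: "g \<in> Hc" and x: "x \<in> X"
    have s: "summable (\<lambda>n. remainder g n x / z ^ Suc n)" and e: "series z g x = (\<Sum>n. remainder g n x / z ^ Suc n)"
      using series_sums[OF z g x] by (simp_all add: sums_iff)
    have t: "norm (remainder g (n + N) x / z ^ Suc (n + N)) \<le> E * holder_norm X \<alpha> g / cmod z * q ^ N * q ^ n" for n
      using geometric_term[OF z E(2)[OF g x, of "n + N"]] by (simp add: q_def power_add mult_ac)
    have eq: "series z g x - (\<Sum>n<N. remainder g n x / z ^ Suc n) = (\<Sum>n. remainder g (n + N) x / z ^ Suc (n + N))"
      unfolding e by (rule suminf_minus_initial_segment[OF s, symmetric])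
    have "norm (series z g x - (\<Sum>n<N. remainder g n x / z ^ Suc n)) \<le> (\<Sum>n. E * holder_norm X \<alpha> g / cmod z * q ^ N * q ^ n)"
      unfolding eq by (rule norm_suminf_le[OF t geo(1)])
    also have "\<dots> = E / cmod z / (1 - q) * (holder_norm X \<alpha> g * q ^ N)"
      unfolding geo(2) by simp
    also have "\<dots> \<le> E' * (holder_norm X \<alpha> g * q ^ N)"
      using norm0[OF g] q E(1) by (intro mult_right_mono) (simp_all add: E'_def)
    finally show "norm (series z g x - (\<Sum>n<N. remainder g n x / z ^ Suc n)) \<le> E' * holder_norm X \<alpha> g * (\<rho> * l / cmod z) ^ N"
      by (simp add: q_def mult.assoc)
  next
    fix g x y assume g: "g \<in> Hc" and x: "x \<in> X" and y: "y \<in> X"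
    have t: "norm (remainder g n x / z ^ Suc n - remainder g n y / z ^ Suc n) \<le> E * holder_norm X \<alpha> g * hdist x y / cmod z * q ^ n" for n
      using geometric_term[OF z, of "remainder g n x - remainder g n y" "E * holder_norm X \<alpha> g * hdist x y" n] E(3)[OF g x y, of n]
      by (simp add: q_def mult_ac diff_divide_distrib)
    have eq: "series z g x - series z g y = (\<Sum>n. remainder g n x / z ^ Suc n - remainder g n y / z ^ Suc n)"
      using sums_diff[OF series_sums[OF z g x] series_sums[OF z g y]] by (rule sums_unique)
    have "norm (series z g x - series z g y) \<le> (\<Sum>n. E * holder_norm X \<alpha> g * hdist x y / cmod z * q ^ n)"
      unfolding eq by (rule norm_suminf_le[OF t geo(1)])
    also have "\<dots> = E / cmod z / (1 - q) * (holder_norm X \<alpha> g * hdist x y)"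
      unfolding geo(2) by simp
    also have "\<dots> \<le> E' * (holder_norm X \<alpha> g * hdist x y)"
      using norm0[OF g] hdist_nonneg[of x y] E(1) by (intro mult_right_mono) (simp_all add: E'_def)
    finally show "norm (series z g x - series z g y) \<le> E' * holder_norm X \<alpha> g * hdist x y"
      by (simp add: mult.assoc)
  next
    fix g assume g: "g \<in> Hc"
    have "E * holder_norm X \<alpha> g \<le> E' * holder_norm X \<alpha> g"
      using parts norm0[OF g] by (intro mult_right_mono) (simp_all add: E'_def)
    with E(4)[OF g] show "norm (c_complex g) \<le> E' * holder_norm X \<alpha> g"
      by linarith
  qed
qed

lemma series_Hc:
  assumes z: "\<rho> * l < cmod z" and g: "g \<in> Hc"
  shows "series z g \<in> Hc"
proof -
  obtain E where E0: "0 \<le> E"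
    "\<And>g N x. g \<in> Hc \<Longrightarrow> x \<in> X \<Longrightarrow>
      norm (series z g x - (\<Sum>n<N. remainder g n x / z ^ Suc n)) \<le> E * holder_norm X \<alpha> g * (\<rho> * l / cmod z) ^ N"
    "\<And>g x y. g \<in> Hc \<Longrightarrow> x \<in> X \<Longrightarrow> y \<in> X \<Longrightarrow> norm (series z g x - series z g y) \<le> E * holder_norm X \<alpha> g * hdist x y"
    by (rule series_estimate[OF z]) blast
  show ?thesis
  proof (rule holder_spaceI)
    show "series z g x = 0" if "x \<notin> X" for x
      using that by (simp add: series_def)
    show "norm (series z g x - series z g y) \<le> E * holder_norm X \<alpha> g * hdist x y" if "x \<in> X" "y \<in> X" for x y
      by (rule E0(3)[OF g that])
  qed
qed

text \<open>
\<open>L\<close> maps each remainder to the next, which shifts the series by one index. It may be applied term by term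
because the partial sums converge uniformly.
\<close>

lemma L_series:
  assumes z: "\<rho> * l < cmod z" and g: "g \<in> Hc" and x: "x \<in> X"
  shows "L (series z g) x = z * series z g x - remainder g 0 x"
proof -
  have z0: "z \<noteq> 0"
    using ratio_bounds(3)[OF z] by auto
  obtain E where E0: "0 \<le> E"
    "\<And>g N x. g \<in> Hc \<Longrightarrow> x \<in> X \<Longrightarrow>
      norm (series z g x - (\<Sum>n<N. remainder g n x / z ^ Suc n)) \<le> E * holder_norm X \<alpha> g * (\<rho> * l / cmod z) ^ N"
    "\<And>g x y. g \<in> Hc \<Longrightarrow> x \<in> X \<Longrightarrow> y \<in> X \<Longrightarrow> norm (series z g x - series z g y) \<le> E * holder_norm X \<alpha> g * hdist x y"
    by (rule series_estimate[OF z]) blast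
  note E = E0(1) E0(2)[OF g]
  have norm0: "0 \<le> holder_norm X \<alpha> g"
    using holder_norm_ge(1)[OF g x] norm_ge_zero order_trans by blast
  have partial: "L (\<lambda>y. series z g y - (\<Sum>n<N. remainder g n y / z ^ Suc n)) x = L (series z g) x - (\<Sum>n<N. remainder g (Suc n) x / z ^ Suc n)" for N
  proof (induction N)
    case (Suc N)
    obtain M where M: "\<And>y. y \<in> X \<Longrightarrow> norm (1 / z ^ Suc N * remainder g N y) \<le> M"
    proof -
      obtain M where M: "\<And>y. y \<in> X \<Longrightarrow> norm (remainder g N y) \<le> M"
        by (rule Hc_bound[OF remainder_Hc[OF g]]) blast
      show thesis
        by (rule that[of "norm (1 / z ^ Suc N) * M"]) (unfold norm_mult, intro mult_left_mono M norm_ge_zero)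
    qed
    have "L (\<lambda>y. series z g y - (\<Sum>n<Suc N. remainder g n y / z ^ Suc n)) x =
      L (\<lambda>y. (series z g y - (\<Sum>n<N. remainder g n y / z ^ Suc n)) - 1 / z ^ Suc N * remainder g N y) x"
      by (simp add: algebra_simps)
    also have "\<dots> = L (\<lambda>y. series z g y - (\<Sum>n<N. remainder g n y / z ^ Suc n)) x - L (\<lambda>y. 1 / z ^ Suc N * remainder g N y) x"
      by (rule Lc_diff[OF E(2) M])
    also have "\<dots> = L (series z g) x - (\<Sum>n<Suc N. remainder g (Suc n) x / z ^ Suc n)"
      unfolding Suc Lc_mult L_remainder[OF g] by simp
    finally show ?case .
  qed simp
  have "\<forall>N. norm (L (series z g) x - (\<Sum>n<N. remainder g (Suc n) x / z ^ Suc n)) \<le> weight_bound * (E * holder_norm X \<alpha> g) * (\<rho> * l / cmod z) ^ N"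
  proof
    fix N
    have "0 \<le> E * holder_norm X \<alpha> g * (\<rho> * l / cmod z) ^ N"
      by (intro mult_nonneg_nonneg E(1) norm0 zero_le_power ratio_bounds(1)[OF z])
    from L_norm_le[where f = "\<lambda>y. series z g y - (\<Sum>n<N. remainder g n y / z ^ Suc n)", OF E(2) x this] show "norm (L (series z g) x - (\<Sum>n<N. remainder g (Suc n) x / z ^ Suc n)) \<le> weight_bound * (E * holder_norm X \<alpha> g) * (\<rho> * l / cmod z) ^ N"
      unfolding partial by (simp add: mult.assoc)
  qed
  moreover have "(\<lambda>N. weight_bound * (E * holder_norm X \<alpha> g) * (\<rho> * l / cmod z) ^ N) \<longlonglongrightarrow> 0"
    by (intro tendsto_mult_right_zero LIMSEQ_power_zero ratio_bounds(4)[OF z])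
  ultimately have "(\<lambda>N. L (series z g) x - (\<Sum>n<N. remainder g (Suc n) x / z ^ Suc n)) \<longlonglongrightarrow> 0"
    by (rule Lim_null_comparison[OF always_eventually])
  moreover have "(\<lambda>N. L (series z g) x - (\<Sum>n<N. remainder g (Suc n) x / z ^ Suc n)) \<longlonglongrightarrow> L (series z g) x - (z * series z g x - remainder g 0 x)"
  proof (rule tendsto_diff[OF tendsto_const])
    have "(\<lambda>n. remainder g (Suc n) x / z ^ Suc (Suc n)) sums (series z g x - remainder g 0 x / z ^ Suc 0)"
      using series_sums[OF z g x] by (subst sums_Suc_iff) simp
    then have "(\<lambda>n. z * (remainder g (Suc n) x / z ^ Suc (Suc n))) sums (z * (series z g x - remainder g 0 x / z ^ Suc 0))"
      by (rule sums_mult)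
    also have "(\<lambda>n. z * (remainder g (Suc n) x / z ^ Suc (Suc n))) = (\<lambda>n. remainder g (Suc n) x / z ^ Suc n)"
      using z0 by simp
    also have "z * (series z g x - remainder g 0 x / z ^ Suc 0) = z * series z g x - remainder g 0 x"
      using z0 by (simp add: right_diff_distrib)
    finally show "(\<lambda>N. \<Sum>n<N. remainder g (Suc n) x / z ^ Suc n) \<longlonglongrightarrow> z * series z g x - remainder g 0 x"
      by (simp only: sums_def)
  qed
  ultimately have "0 = L (series z g) x - (z * series z g x - remainder g 0 x)"
    by (rule LIMSEQ_unique)
  then show ?thesis
    by simp
qed

lemma Hc_add: "g \<in> Hc \<Longrightarrow> h \<in> Hc \<Longrightarrow> (\<lambda>x. g x + h x) \<in> Hc"
  by (rule HcI) (simp_all add: H_add Hc_Re Hc_Im)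

lemma Hc_diff: "g \<in> Hc \<Longrightarrow> h \<in> Hc \<Longrightarrow> (\<lambda>x. g x - h x) \<in> Hc"
  by (rule HcI) (simp_all add: H_diff Hc_Re Hc_Im)

lemma Hc_mult: "g \<in> Hc \<Longrightarrow> (\<lambda>x. z * g x) \<in> Hc"
  by (rule HcI) (simp_all add: H_diff H_add H_scale Hc_Re Hc_Im)

lemma Lc_diff_Hc:
  assumes "g \<in> Hc" "h \<in> Hc"
  shows "L (\<lambda>y. g y - h y) x = L g x - L h x"
proof -
  obtain M where "\<And>x. x \<in> X \<Longrightarrow> norm (g x) \<le> M"
    by (rule Hc_bound[OF assms(1)]) blast
  moreover obtain M' where "\<And>x. x \<in> X \<Longrightarrow> norm (h x) \<le> M'"
    by (rule Hc_bound[OF assms(2)]) blast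
  ultimately show ?thesis
    by (rule Lc_diff)
qed

lemma resolvent_Hc: "\<rho> * l < cmod z \<Longrightarrow> g \<in> Hc \<Longrightarrow> resolvent z g \<in> Hc"
  unfolding resolvent_def[abs_def] by (intro Hc_add scaled_f_Hc series_Hc)

lemma resolvent_solves:
  assumes z: "\<rho> * l < cmod z" "z \<noteq> of_real l" and g: "g \<in> Hc"
  shows "z * resolvent z g x - L (resolvent z g) x = g x"
proof (cases "x \<in> X")
  case True
  let ?a = "c_complex g / (z - of_real l)"
  have "L (resolvent z g) x = L (\<lambda>x. series z g x - (- ?a) * of_real (f x)) x"
    by (simp add: resolvent_def[abs_def] add.commute)
  also have "\<dots> = L (series z g) x - L (\<lambda>x. (- ?a) * of_real (f x)) x"
    by (intro Lc_diff_Hc series_Hc z g scaled_f_Hc)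
  also have "\<dots> = z * series z g x - remainder g 0 x + ?a * of_real l * of_real (f x)"
    unfolding L_series[OF z(1) g True] L_eigenfunction_complex by simp
  finally have Lr: "L (resolvent z g) x = z * series z g x - remainder g 0 x + ?a * of_real l * of_real (f x)" .
  have "z * resolvent z g x - L (resolvent z g) x = ?a * (z - of_real l) * of_real (f x) + remainder g 0 x"
    unfolding Lr resolvent_def by (simp only: algebra_simps)
  also have "?a * (z - of_real l) = c_complex g"
    using z(2) by simp
  finally show ?thesis
    by (simp add: remainder_def)
next
  case False
  then show ?thesis
    using g by (simp add: resolvent_def series_def f_off L_off holder_space_def)
qed

lemma resolvent_bounded:
  assumes z: "\<rho> * l < cmod z"
  obtains K where "\<And>g. g \<in> Hc \<Longrightarrow> holder_norm X \<alpha> (resolvent z g) \<le> K * holder_norm X \<alpha> g"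
proof -
  obtain E where E: "0 \<le> E"
    "\<And>g N x. g \<in> Hc \<Longrightarrow> x \<in> X \<Longrightarrow>
      norm (series z g x - (\<Sum>n<N. remainder g n x / z ^ Suc n)) \<le> E * holder_norm X \<alpha> g * (\<rho> * l / cmod z) ^ N"
    "\<And>g x y. g \<in> Hc \<Longrightarrow> x \<in> X \<Longrightarrow> y \<in> X \<Longrightarrow> norm (series z g x - series z g y) \<le> E * holder_norm X \<alpha> g * hdist x y"
    "\<And>g. g \<in> Hc \<Longrightarrow> norm (c_complex g) \<le> E * holder_norm X \<alpha> g"
    by (rule series_estimate[OF z]) blast
  obtain F where F: "0 \<le> F" "\<And>x y. x \<in> X \<Longrightarrow> y \<in> X \<Longrightarrow> norm (f x - f y) \<le> F * hdist x y" "\<And>x. x \<in> X \<Longrightarrow> norm (f x) \<le> F"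
    by (rule holder_spaceE[OF f_H]) blast
  define d where "d = norm (1 / (z - of_real l))"
  have "holder_norm X \<alpha> (resolvent z g) \<le> (2 * (E * d * F + E)) * holder_norm X \<alpha> g" if g: "g \<in> Hc" for g
  proof -
    define N where "N = holder_norm X \<alpha> g"
    define a where "a = c_complex g / (z - of_real l)"
    have a: "norm a \<le> E * N * d"
      using mult_right_mono[OF E(4)[OF g], of d] by (simp add: a_def d_def N_def norm_divide)
    have EN: "0 \<le> E * N * d"
      using a norm_ge_zero order_trans by blast
    have s0: "norm (series z g x) \<le> E * N" if "x \<in> X" for x
      using E(2)[OF g that, of 0] by (simp add: N_def)
    have "holder_norm X \<alpha> (resolvent z g) \<le> (E * N * d * F + E * N) + (E * N * d * F + E * N)"
    proof (rule holder_norm_le)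
      fix x assume x: "x \<in> X"
      have "norm (a * of_real (f x)) \<le> E * N * d * F"
        unfolding norm_mult using a F(3)[OF x] EN by (intro mult_mono) auto
      then show "norm (resolvent z g x) \<le> E * N * d * F + E * N"
        using s0[OF x] norm_triangle_ineq[of "a * of_real (f x)" "series z g x"] unfolding resolvent_def a_def by linarith
      fix y assume y: "y \<in> X"
      have "norm (a * of_real (f x - f y)) \<le> E * N * d * (F * hdist x y)"
        unfolding norm_mult norm_of_real using a F(2)[OF x y] EN by (intro mult_mono) (simp_all only: real_norm_def abs_ge_zero)
      moreover have "resolvent z g x - resolvent z g y = a * of_real (f x - f y) + (series z g x - series z g y)"
        unfolding resolvent_def a_def of_real_diff right_diff_distrib by simp
      ultimately show "norm (resolvent z g x - resolvent z g y) \<le> (E * N * d * F + E * N) * hdist x y"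
        using E(3)[OF g x y] norm_triangle_ineq[of "a * of_real (f x - f y)" "series z g x - series z g y"]
        by (simp add: N_def distrib_right mult.assoc)
    qed
    also have "\<dots> = (2 * (E * d * F + E)) * N"
      by (simp add: algebra_simps)
    finally show ?thesis
      by (simp add: N_def)
  qed
  then show thesis
    by (rule that)
qed

lemma outside_disk_in_resolvent:
  assumes z: "\<rho> * l < cmod z" "z \<noteq> of_real l"
  shows "z \<in> ruelle_resolvent (range b) A \<alpha> \<phi>"
proof -
  define T where "T = (\<lambda>g x. z * g x - L g x)"
  have T_Hc: "T g \<in> Hc" if "g \<in> Hc" for g
    unfolding T_def by (intro Hc_diff Hc_mult Hc_L that)
  have solves: "T (resolvent z g) = g" if "g \<in> Hc" for g
    unfolding T_def using resolvent_solves[OF z that] by blast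
  have inj: "g = h" if g: "g \<in> Hc" and h: "h \<in> Hc" and eq: "T g = T h" for g h
  proof -
    have "L (\<lambda>y. g y - h y) x = z * (g x - h x)" for x
      using fun_cong[OF eq, of x] unfolding Lc_diff_Hc[OF g h] by (simp add: T_def algebra_simps)
    from eigen_outside_disk[OF Hc_diff[OF g h] this z] show ?thesis
      by (intro ext) simp
  qed
  have "bij_betw T Hc Hc"
  proof (rule bij_betw_byWitness[where f' = "resolvent z"])
    show "\<forall>g\<in>Hc. resolvent z (T g) = g"
      using inj solves T_Hc resolvent_Hc[OF z(1)] by simp
    show "\<forall>g\<in>Hc. T (resolvent z g) = g"
      using solves by blast
    show "T ` Hc \<subseteq> Hc" "resolvent z ` Hc \<subseteq> Hc"
      using T_Hc resolvent_Hc[OF z(1)] by blast+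
  qed
  moreover obtain K where K: "\<And>g. g \<in> Hc \<Longrightarrow> holder_norm X \<alpha> (resolvent z g) \<le> K * holder_norm X \<alpha> g"
    using resolvent_bounded[OF z(1)] by blast
  have "holder_norm X \<alpha> g \<le> K * holder_norm X \<alpha> (T g)" if "g \<in> Hc" for g
    using K[OF T_Hc[OF that]] inj[OF resolvent_Hc[OF z(1) T_Hc[OF that]] that solves[OF T_Hc[OF that]]] by simp
  ultimately show ?thesis
    unfolding ruelle_resolvent_def Let_def T_def by blast
qed

lemma spectrum_gap: "ruelle_spectrum (range b) A \<alpha> \<phi> - {complex_of_real l} \<subseteq> cball 0 (\<rho> * l)"
proof
  fix z assume "z \<in> ruelle_spectrum (range b) A \<alpha> \<phi> - {complex_of_real l}"
  then have "\<not> \<rho> * l < cmod z"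
    using outside_disk_in_resolvent[of z] by (auto simp: ruelle_spectrum_def)
  then show "z \<in> cball 0 (\<rho> * l)"
    by simp
qed

end

section \<open>Cylinders and Borel sets\<close>

context countable_markov_shift
begin

text \<open>
Words are lists of indices of symbols, so that they form a countable type.
\<close>

definition cyl :: "nat list \<Rightarrow> (nat \<Rightarrow> real) set" where
  "cyl w = {x \<in> X. \<forall>i<length w. index x i = w ! i}"

definition prefix :: "(nat \<Rightarrow> real) \<Rightarrow> nat \<Rightarrow> nat list" where
  "prefix x n = map (index x) [0..<n]"

lemma length_prefix: "length (prefix x n) = n"
  by (simp add: prefix_def)

lemma nth_prefix: "i < n \<Longrightarrow> prefix x n ! i = index x i"
  by (simp add: prefix_def)

lemma mem_cyl_prefix: "x \<in> X \<Longrightarrow> x \<in> cyl (prefix x n)"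
  by (simp add: cyl_def length_prefix nth_prefix)

lemma mem_cyl_iff: "x \<in> cyl w \<longleftrightarrow> x \<in> X \<and> prefix x (length w) = w"
  by (auto simp: cyl_def length_prefix nth_prefix list_eq_iff_nth_eq)

lemma cyl_subset: "cyl w \<subseteq> X"
  by (auto simp: cyl_def)

lemma cyl_Nil: "cyl [] = X"
  by (auto simp: cyl_def)

lemma cyl_Int:
  assumes "length v \<le> length w"
  shows "cyl v \<inter> cyl w = (if take (length v) w = v then cyl w else {})"
proof -
  have "x \<in> cyl v \<longleftrightarrow> take (length v) w = v" if "x \<in> cyl w" for x
  proof -
    have "prefix x (length v) = take (length v) (prefix x (length w))"
      using assms by (simp add: prefix_def take_map)
    with that show ?thesis
      by (simp add: mem_cyl_iff)
  qed
  then show ?thesis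
    by auto
qed

lemma cyl_seq_dist:
  assumes "x \<in> cyl w" "y \<in> cyl w"
  shows "seq_dist x y \<le> (1 / 2) ^ length w"
proof (rule seq_dist_le_agree)
  show x: "x \<in> X" and y: "y \<in> X"
    using assms by (simp_all add: cyl_def)
  fix i assume "i < length w"
  then have "index x i = index y i"
    using assms by (simp add: cyl_def)
  then show "x i = y i"
    using b_index[OF x, of i] b_index[OF y, of i] by simp
qed

text \<open>
There are only countably many words.
\<close>

lemma open_union_of_cylinders:
  assumes U: "U \<subseteq> X" and loc: "\<And>x. x \<in> U \<Longrightarrow> \<exists>n. cyl (prefix x n) \<subseteq> U"
  shows "U \<in> sigma_sets X (range cyl)"
proof -
  have "U = \<Union> (cyl ` {w. cyl w \<subseteq> U})"
  proof
    show "U \<subseteq> \<Union> (cyl ` {w. cyl w \<subseteq> U})"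
    proof
      fix x assume x: "x \<in> U"
      then obtain n where "cyl (prefix x n) \<subseteq> U"
        using loc by blast
      with x U mem_cyl_prefix[of x n] show "x \<in> \<Union> (cyl ` {w. cyl w \<subseteq> U})"
        by blast
    qed
  qed blast
  also have "\<dots> \<in> sigma_sets X (range cyl)"
  proof (rule sigma_sets_UNION)
    show "countable (cyl ` {w. cyl w \<subseteq> U})"
      by (intro countable_image countableI_type)
  qed (auto intro: sigma_sets.Basic)
  finally show ?thesis .
qed

lemma metric: "Metric_space X seq_dist"
  by (rule Metric_space_seq_dist) (use b_range in blast)

lemma cyl_separated:
  obtains g where "0 < g" "\<And>x y. x \<in> cyl w \<Longrightarrow> y \<in> X \<Longrightarrow> y \<notin> cyl w \<Longrightarrow> g \<le> seq_dist x y"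
proof -
  define G where "G = insert 1 ((\<lambda>i. symbol_gap (w ! i) / 2 ^ Suc i) ` {..<length w})"
  have G: "finite G" "G \<noteq> {}"
    by (simp_all add: G_def)
  have "0 < Min G"
    using G symbol_gap(1) by (auto simp: G_def)
  moreover have "Min G \<le> seq_dist x y" if x: "x \<in> cyl w" and y: "y \<in> X" "y \<notin> cyl w" for x y
  proof -
    obtain i where i: "i < length w" "index y i \<noteq> w ! i"
      using y by (auto simp: cyl_def)
    have xX: "x \<in> X" and xi: "index x i = w ! i"
      using x i by (simp_all add: cyl_def)
    have "Min G \<le> symbol_gap (w ! i) / 2 ^ Suc i"
      using G i by (intro Min_le) (auto simp: G_def)
    also have "\<dots> \<le> seq_dist x y"
      using dist_ge_gap[OF xX y(1), of i] i(2) xi by simp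
    finally show ?thesis .
  qed
  ultimately show thesis
    by (rule that)
qed

text \<open>
Cylinders are open because symbols are isolated, and every ball contains the cylinders of long prefixes of
its centre.
\<close>

lemma sets_shift_borel: "sets (shift_borel (range b) A) = sigma_sets X (range cyl)"
  and space_shift_borel: "space (shift_borel (range b) A) = X"
proof -
  interpret M: Metric_space X seq_dist
    by (rule metric)
  let ?O = "{U. openin M.mtopology U}"
  have sub: "?O \<subseteq> Pow X"
    using openin_subset by fastforce
  show "space (shift_borel (range b) A) = X"
    unfolding shift_borel_def by (rule space_measure_of[OF sub])
  have "sets (shift_borel (range b) A) = sigma_sets X ?O"
    unfolding shift_borel_def by (rule sets_measure_of[OF sub])
  also have "\<dots> = sigma_sets X (range cyl)"
  proof (rule sigma_sets_eqI)
    fix U assume "U \<in> ?O"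
    then have U: "U \<subseteq> X" "\<And>x. x \<in> U \<Longrightarrow> \<exists>r>0. M.mball x r \<subseteq> U"
      by (simp_all add: M.openin_mtopology)
    show "U \<in> sigma_sets X (range cyl)"
    proof (rule open_union_of_cylinders[OF U(1)])
      fix x assume x: "x \<in> U"
      then obtain r where r: "0 < r" "M.mball x r \<subseteq> U"
        using U(2) by blast
      obtain n where n: "(1 / 2) ^ n < r"
        using real_arch_pow_inv[OF r(1), of "1 / 2"] by auto
      have xX: "x \<in> X"
        using x U(1) by blast
      have "cyl (prefix x n) \<subseteq> M.mball x r"
      proof
        fix y assume y: "y \<in> cyl (prefix x n)"
        have "seq_dist x y < r"
          using cyl_seq_dist[OF mem_cyl_prefix[OF xX] y] n by (simp add: length_prefix)
        with y xX show "y \<in> M.mball x r"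
          by (simp add: cyl_def)
      qed
      with r(2) show "\<exists>n. cyl (prefix x n) \<subseteq> U"
        by blast
    qed
  next
    fix C assume "C \<in> range cyl"
    then obtain w where C: "C = cyl w"
      by blast
    obtain g where g: "0 < g" "\<And>x y. x \<in> cyl w \<Longrightarrow> y \<in> X \<Longrightarrow> y \<notin> cyl w \<Longrightarrow> g \<le> seq_dist x y"
      using cyl_separated by blast
    have "openin M.mtopology (cyl w)"
      unfolding M.openin_mtopology
    proof (intro conjI cyl_subset ballI allI impI)
      fix x assume x: "x \<in> cyl w"
      have "M.mball x g \<subseteq> cyl w"
      proof
        fix y assume "y \<in> M.mball x g"
        then have "y \<in> X" "seq_dist x y < g"
          by simp_all
        with g(2)[OF x, of y] show "y \<in> cyl w"
          by fastforce
      qed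
      with g(1) show "\<exists>r>0. M.mball x r \<subseteq> cyl w"
        by blast
    qed
    then show "C \<in> sigma_sets X ?O"
      unfolding C by (intro sigma_sets.Basic) simp
  qed
  finally show "sets (shift_borel (range b) A) = sigma_sets X (range cyl)" .
qed

lemma cyl_sets: "cyl w \<in> sets (shift_borel (range b) A)"
  unfolding sets_shift_borel by (intro sigma_sets.Basic) simp

lemma borel_measure_eqI:
  assumes "sets \<mu> = sets (shift_borel (range b) A)" "sets \<nu> = sets (shift_borel (range b) A)"
    and "finite_measure \<mu>" and eq: "\<And>w. emeasure \<mu> (cyl w) = emeasure \<nu> (cyl w)"
  shows "\<mu> = \<nu>"
proof (rule measure_eqI_generator_eq[where \<Omega> = X and E = "insert {} (range cyl)" and A = "\<lambda>_. X"])
  have Int: "cyl v \<inter> cyl w \<in> insert {} (range cyl)" for v w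
    using cyl_Int[of v w] cyl_Int[of w v] by (cases "length v \<le> length w") (auto simp: Int_commute)
  show "Int_stable (insert {} (range cyl))"
    by (intro Int_stableI) (use Int in auto)
  show "insert {} (range cyl) \<subseteq> Pow X"
    using cyl_subset by auto
  show "emeasure \<mu> Y = emeasure \<nu> Y" if "Y \<in> insert {} (range cyl)" for Y
    using that eq by auto
  have "sigma_sets X (insert {} (range cyl)) = sigma_sets X (range cyl)"
    by (intro sigma_sets_eqI) (auto intro: sigma_sets.intros)
  with assms(1,2) show "sets \<mu> = sigma_sets X (insert {} (range cyl))" "sets \<nu> = sigma_sets X (insert {} (range cyl))"
    by (simp_all add: sets_shift_borel)
  show "range (\<lambda>_. X) \<subseteq> insert {} (range cyl)"
    using cyl_Nil by blast
  show "emeasure \<mu> X \<noteq> \<infinity>"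
    using finite_measure.emeasure_finite[OF assms(3)] by simp
qed simp

end

context ruelle_potential
begin

lemma hdist_cyl:
  assumes "x \<in> cyl w" "y \<in> cyl w"
  shows "hdist x y \<le> theta ^ length w"
proof -
  have "hdist x y \<le> ((1 / 2) ^ length w) powr \<alpha>"
    unfolding hdist_def using cyl_seq_dist[OF assms] seq_dist_nonneg alpha_pos by (intro powr_mono2) auto
  also have "\<dots> = theta ^ length w"
    by (simp add: theta_def powr_power powr_realpow[symmetric] powr_powr mult.commute)
  finally show ?thesis .
qed

text \<open>
A bounded function that takes different values only at points a definite distance apart is Hoelder of every order.
\<close>

lemma holder_of_separated:
  fixes h :: "(nat \<Rightarrow> real) \<Rightarrow> real"
  assumes off: "\<And>x. x \<notin> X \<Longrightarrow> h x = 0" and M: "\<And>x. x \<in> X \<Longrightarrow> \<bar>h x\<bar> \<le> M"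
    and g: "0 < g" "\<And>x y. x \<in> X \<Longrightarrow> y \<in> X \<Longrightarrow> h x \<noteq> h y \<Longrightarrow> g \<le> seq_dist x y"
  shows "h \<in> H"
  unfolding holder_space_def
proof (intro CollectI conjI allI impI exI ballI off)
  fix x y assume xy: "x \<in> X" "y \<in> X"
  have M0: "0 \<le> M"
    using M[OF xy(1)] by simp
  show "norm (h x - h y) \<le> 2 * M / g powr \<alpha> * seq_dist x y powr \<alpha>"
  proof (cases "h x = h y")
    case True
    then show ?thesis
      using M0 by simp
  next
    case False
    have "g powr \<alpha> \<le> seq_dist x y powr \<alpha>"
      using g(1) g(2)[OF xy False] alpha_pos by (intro powr_mono2) auto
    then have "2 * M / g powr \<alpha> * g powr \<alpha> \<le> 2 * M / g powr \<alpha> * seq_dist x y powr \<alpha>"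
      using M0 by (intro mult_left_mono) auto
    moreover have "norm (h x - h y) \<le> 2 * M"
      using M[OF xy(1)] M[OF xy(2)] by (simp add: abs_le_iff)
    ultimately show ?thesis
      using g(1) by simp
  qed
qed

lemma indicator_cyl_H: "indicat_real (cyl w) \<in> H"
proof -
  obtain g where g: "0 < g" "\<And>x y. x \<in> cyl w \<Longrightarrow> y \<in> X \<Longrightarrow> y \<notin> cyl w \<Longrightarrow> g \<le> seq_dist x y"
    using cyl_separated by blast
  show ?thesis
  proof (rule holder_of_separated[OF _ _ g(1), of _ 1])
    show "indicat_real (cyl w) x = 0" if "x \<notin> X" for x
      using that cyl_subset by (auto simp: indicator_def)
    show "\<bar>indicat_real (cyl w) x\<bar> \<le> 1" for x
      by (simp add: indicator_def)
    show "g \<le> seq_dist x y" if "x \<in> X" "y \<in> X" "indicat_real (cyl w) x \<noteq> indicat_real (cyl w) y" for x y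
    proof (cases "x \<in> cyl w")
      case True
      with that g(2)[OF True that(2)] show ?thesis
        by (simp add: indicator_def split: if_splits)
    next
      case False
      with that have "y \<in> cyl w"
        by (simp add: indicator_def split: if_splits)
      from g(2)[OF this that(1) False] show ?thesis
        by (subst seq_dist_sym)
    qed
  qed
qed

text \<open>
Mass that escapes to infinity in the \<open>i\<close>-th coordinate remains in these sets for all \<open>n\<close>.
\<close>

definition tail :: "nat \<Rightarrow> nat \<Rightarrow> (nat \<Rightarrow> real) set" where
  "tail i n = {x \<in> X. n \<le> index x i}"

text \<open>
If a point of \<open>X\<close> lies outside the set, its \<open>i\<close>-th symbol is one of the first \<open>n\<close>, which are uniformly isolated.
\<close>

lemma indicator_tail_H: "indicat_real (tail i n) \<in> H"
proof -
  define G where "G = insert 1 ((\<lambda>k. symbol_gap k / 2 ^ Suc i) ` {..<n})"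
  have G: "finite G" "G \<noteq> {}"
    by (simp_all add: G_def)
  have G0: "0 < Min G"
    using G symbol_gap(1) by (auto simp: G_def)
  have sep: "Min G \<le> seq_dist x y" if "x \<in> X" "y \<in> X" "index x i < n" "n \<le> index y i" for x y
  proof -
    have "Min G \<le> symbol_gap (index x i) / 2 ^ Suc i"
      using G that by (intro Min_le) (auto simp: G_def)
    also have "\<dots> \<le> seq_dist x y"
      using that by (intro dist_ge_gap) auto
    finally show ?thesis .
  qed
  show ?thesis
  proof (rule holder_of_separated[OF _ _ G0, of _ 1])
    show "indicat_real (tail i n) x = 0" if "x \<notin> X" for x
      using that by (auto simp: indicator_def tail_def)
    show "\<bar>indicat_real (tail i n) x\<bar> \<le> 1" for x
      by (simp add: indicator_def)
    show "Min G \<le> seq_dist x y" if "x \<in> X" "y \<in> X" "indicat_real (tail i n) x \<noteq> indicat_real (tail i n) y" for x y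
    proof -
      have "(x \<in> tail i n) \<noteq> (y \<in> tail i n)"
        using that(3) by (auto simp: indicator_def)
      with that(1,2) consider "index x i < n" "n \<le> index y i" | "index y i < n" "n \<le> index x i"
        by (auto simp: tail_def not_le)
      then show ?thesis
      proof cases
        case 1
        then show ?thesis
          by (intro sep that)
      next
        case 2
        then have "Min G \<le> seq_dist y x"
          by (intro sep that)
        then show ?thesis
          by (subst seq_dist_sym)
      qed
    qed
  qed
qed

lemma H_measurable:
  assumes h: "h \<in> H"
  shows "h \<in> borel_measurable (shift_borel (range b) A)"
proof (rule borel_measurableI)
  fix S :: "real set" assume S: "open S"
  obtain C where C: "0 \<le> C" "\<And>x y. x \<in> X \<Longrightarrow> y \<in> X \<Longrightarrow> norm (h x - h y) \<le> C * hdist x y"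
    by (rule holder_spaceE[OF h]) blast
  show "h -` S \<inter> space (shift_borel (range b) A) \<in> sets (shift_borel (range b) A)"
    unfolding space_shift_borel sets_shift_borel
  proof (rule open_union_of_cylinders)
    fix x assume x: "x \<in> h -` S \<inter> X"
    then obtain e where e: "0 < e" "\<And>y. dist y (h x) < e \<Longrightarrow> y \<in> S"
      using S unfolding open_dist by blast
    have "0 < e / (C + 1)"
      using e(1) C(1) by simp
    then obtain n where n: "theta ^ n < e / (C + 1)"
      using real_arch_pow_inv[of "e / (C + 1)" theta] theta by auto
    have "cyl (prefix x n) \<subseteq> h -` S \<inter> X"
    proof
      fix y assume y: "y \<in> cyl (prefix x n)"
      then have yX: "y \<in> X"
        by (simp add: cyl_def)
      have "hdist y x \<le> theta ^ n"
        using hdist_cyl[OF y mem_cyl_prefix[of x n]] x by (simp add: length_prefix)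
      then have "C * hdist y x \<le> C * theta ^ n"
        using C(1) by (rule mult_left_mono)
      also have "\<dots> \<le> (C + 1) * theta ^ n"
        using theta by (simp add: distrib_right)
      also have "\<dots> < e"
        using n C(1) by (simp add: pos_less_divide_eq mult.commute)
      finally have "dist (h y) (h x) < e"
        using C(2)[OF yX, of x] x by (simp add: dist_real_def)
      with e(2) yX show "y \<in> h -` S \<inter> X"
        by simp
    qed
    then show "\<exists>n. cyl (prefix x n) \<subseteq> h -` S \<inter> X"
      by blast
  qed simp
qed

end

section \<open>Masses of cylinders\<close>

context ruelle_spectral
begin

definition mass :: "nat list \<Rightarrow> real" where
  "mass w = c (indicat_real (cyl w))"

lemma mass_nonneg: "0 \<le> mass w"
  unfolding mass_def by (rule c_nonneg[OF indicator_cyl_H]) simp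

lemma mass_Nil: "mass [] = 1"
  by (simp add: mass_def cyl_Nil c_one)

lemma c_sum: "finite T \<Longrightarrow> (\<And>k. k \<in> T \<Longrightarrow> g k \<in> H) \<Longrightarrow> c (\<lambda>x. \<Sum>k\<in>T. g k x) = (\<Sum>k\<in>T. c (g k))"
proof (induction T rule: finite_induct)
  case (insert k T)
  then show ?case
    using c_add[of "g k" "\<lambda>x. \<Sum>k\<in>T. g k x"] H_sum[of T g] by simp
qed (simp add: c_zero)

lemma cyl_nonempty:
  assumes "0 < mass w"
  shows "cyl w \<noteq> {}"
proof
  assume "cyl w = {}"
  then have "indicat_real (cyl w) = (\<lambda>_. 0)"
    by auto
  with assms show False
    by (simp add: mass_def c_zero)
qed

lemma index_prepend: "index (prepend a x) 0 = inv b a" "index (prepend a x) (Suc i) = index x i"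
  by (simp_all add: index_def)

text \<open>
The condition on the coordinate \<open>Suc i\<close> of a preimage is a condition on the coordinate \<open>i\<close> of the point, so the
indicator function can be pulled out of the sum.
\<close>

lemma L_tail_Suc:
  assumes x: "x \<in> X"
  shows "L (indicat_real (tail (Suc i) n)) x \<le> weight_bound * indicat_real (tail i n) x"
proof -
  have "L (indicat_real (tail (Suc i) n)) x = (\<Sum>\<^sub>\<infinity>a\<in>pred (x 0). indicat_real (tail i n) x * (exp (\<phi> (prepend a x)) * indicat_real X (prepend a x)))"
    unfolding L_real_eq[OF x]
  proof (rule infsum_cong)
    fix a assume "a \<in> pred (x 0)"
    then have "prepend a x \<in> X"
      by (rule prepend_in_X[OF x])
    then show "exp (\<phi> (prepend a x)) * indicat_real (tail (Suc i) n) (prepend a x) =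
        indicat_real (tail i n) x * (exp (\<phi> (prepend a x)) * indicat_real X (prepend a x))"
      using x by (simp add: indicator_def tail_def index_prepend)
  qed
  also have "\<dots> = indicat_real (tail i n) x * L (indicat_real X) x"
    unfolding L_real_eq[OF x] by (rule infsum_cmult_right')
  also have "\<dots> \<le> indicat_real (tail i n) x * weight_bound"
  proof (rule mult_left_mono)
    have "norm (L (indicat_real X) x) \<le> weight_bound * 1"
      by (rule L_norm_le[OF _ x]) (simp_all add: indicator_def)
    then show "L (indicat_real X) x \<le> weight_bound"
      by simp
  qed simp
  finally show ?thesis
    by (simp only: mult.commute)
qed

text \<open>
For the first coordinate only the preimages with a symbol of index at least \<open>n\<close> contribute, and their total
weight is a tail of the series of \<open>p\<close>.
\<close>

lemma L_tail_0:
  assumes x: "x \<in> X"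
  shows "L (indicat_real (tail 0 n)) x \<le> weight_bound * (1 - (\<Sum>k<n. p (b k)))"
proof -
  let ?T = "range b - b ` {..<n}"
  have bsub: "b ` {..<n} \<subseteq> range b"
    by blast
  have s1: "(\<lambda>a. p a * indicat_real ?T a) summable_on Y" if "Y \<subseteq> range b" for Y
    by (rule summable_on_comparison_test[OF p_summable_subset[OF that]]) (use that p_nonneg in \<open>auto simp: indicator_def\<close>)
  have "L (indicat_real (tail 0 n)) x \<le> (\<Sum>\<^sub>\<infinity>a\<in>pred (x 0). weight_bound * (p a * indicat_real ?T a))"
    unfolding L_real_eq[OF x]
  proof (rule infsum_mono)
    show "(\<lambda>a. exp (\<phi> (prepend a x)) * indicat_real (tail 0 n) (prepend a x)) summable_on pred (x 0)"
      by (rule L_summable[OF x H_bounded[OF indicator_tail_H]])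
    show "(\<lambda>a. weight_bound * (p a * indicat_real ?T a)) summable_on pred (x 0)"
      by (intro summable_on_cmult_right s1 pred_subset)
    fix a assume a: "a \<in> pred (x 0)"
    have "indicat_real (tail 0 n) (prepend a x) \<le> indicat_real ?T a"
    proof -
      have "a \<in> ?T" if "prepend a x \<in> tail 0 n"
      proof -
        have "n \<le> inv b a"
          using that by (simp add: tail_def index_prepend)
        moreover have "inv b (b k) = k" for k
          by (rule inv_f_f[OF b_inj])
        ultimately have "a \<notin> b ` {..<n}"
          by auto
        then show ?thesis
          using a pred_subset by blast
      qed
      then show ?thesis
        by (simp add: indicator_def)
    qed
    then have "exp (\<phi> (prepend a x)) * indicat_real (tail 0 n) (prepend a x) \<le> (weight_bound * p a) * indicat_real ?T a"
      by (intro mult_mono weight_le[OF x a]) (use weight_bound p_pred_nonneg[OF a] in simp_all)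
    then show "exp (\<phi> (prepend a x)) * indicat_real (tail 0 n) (prepend a x) \<le> weight_bound * (p a * indicat_real ?T a)"
      by (simp only: mult.assoc)
  qed
  also have "\<dots> = weight_bound * (\<Sum>\<^sub>\<infinity>a\<in>pred (x 0). p a * indicat_real ?T a)"
    by (rule infsum_cmult_right')
  also have "\<dots> \<le> weight_bound * (\<Sum>\<^sub>\<infinity>a\<in>range b. p a * indicat_real ?T a)"
    using weight_bound p_nonneg by (intro mult_left_mono infsum_mono2 s1 pred_subset mult_nonneg_nonneg) auto
  also have "(\<Sum>\<^sub>\<infinity>a\<in>range b. p a * indicat_real ?T a) = infsum p ?T"
    by (rule infsum_cong_neutral) auto
  also have "\<dots> = infsum p (range b) - infsum p (b ` {..<n})"
    by (rule infsum_Diff[OF p_summable _ bsub]) simp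
  also have "infsum p (range b) = 1"
    using p_has_sum by (rule infsumI)
  also have "infsum p (b ` {..<n}) = (\<Sum>k<n. p (b k))"
    by (simp add: sum.reindex inj_on_subset[OF b_inj])
  finally show ?thesis .
qed

text \<open>
By \<open>c (L h) = l * c h\<close>, a coordinate is shifted to the front at the cost of a constant factor. So the tail in any
coordinate is controlled by the tail of the series of \<open>p\<close>.
\<close>

lemma tail_limit: "(\<lambda>n. c (indicat_real (tail i n))) \<longlonglongrightarrow> 0"
proof (induction i)
  case 0
  have "(\<lambda>n. weight_bound / l * (1 - (\<Sum>k<n. p (b k)))) \<longlonglongrightarrow> weight_bound / l * (1 - 1)"
    using p_sums unfolding sums_def by (intro tendsto_mult tendsto_const tendsto_diff)
  then have lim: "(\<lambda>n. weight_bound / l * (1 - (\<Sum>k<n. p (b k)))) \<longlonglongrightarrow> 0"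
    by simp
  have "norm (c (indicat_real (tail 0 n))) \<le> weight_bound / l * (1 - (\<Sum>k<n. p (b k)))" for n
  proof -
    have "l * c (indicat_real (tail 0 n)) = c (L (indicat_real (tail 0 n)))"
      by (rule c_L[OF indicator_tail_H, symmetric])
    also have "\<dots> \<le> weight_bound * (1 - (\<Sum>k<n. p (b k)))"
      by (intro c_le_const H_L indicator_tail_H L_tail_0)
    finally have "c (indicat_real (tail 0 n)) \<le> weight_bound / l * (1 - (\<Sum>k<n. p (b k)))"
      using l_pos by (simp add: pos_le_divide_eq mult.commute)
    moreover have "0 \<le> c (indicat_real (tail 0 n))"
      by (rule c_nonneg[OF indicator_tail_H]) simp
    ultimately show ?thesis
      by simp
  qed
  then have "\<forall>n. norm (c (indicat_real (tail 0 n))) \<le> weight_bound / l * (1 - (\<Sum>k<n. p (b k)))"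
    by blast
  then show ?case
    by (rule Lim_null_comparison[OF always_eventually _]) (rule lim)
next
  case (Suc i)
  have lim: "(\<lambda>n. weight_bound / l * c (indicat_real (tail i n))) \<longlonglongrightarrow> 0"
    by (rule tendsto_mult_right_zero[OF Suc])
  have "norm (c (indicat_real (tail (Suc i) n))) \<le> weight_bound / l * c (indicat_real (tail i n))" for n
  proof -
    have "l * c (indicat_real (tail (Suc i) n)) = c (L (indicat_real (tail (Suc i) n)))"
      by (rule c_L[OF indicator_tail_H, symmetric])
    also have "\<dots> \<le> c (\<lambda>x. weight_bound * indicat_real (tail i n) x)"
      by (intro c_mono H_L H_scale indicator_tail_H L_tail_Suc)
    also have "\<dots> = weight_bound * c (indicat_real (tail i n))"
      by (rule c_scale[OF indicator_tail_H])
    finally have "c (indicat_real (tail (Suc i) n)) \<le> weight_bound / l * c (indicat_real (tail i n))"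
      using l_pos by (simp add: pos_le_divide_eq mult.commute)
    moreover have "0 \<le> c (indicat_real (tail (Suc i) n))"
      by (rule c_nonneg[OF indicator_tail_H]) simp
    ultimately show ?thesis
      by simp
  qed
  then have "\<forall>n. norm (c (indicat_real (tail (Suc i) n))) \<le> weight_bound / l * c (indicat_real (tail i n))"
    by blast
  then show ?case
    by (rule Lim_null_comparison[OF always_eventually _]) (rule lim)
qed

lemma mem_cyl_snoc: "x \<in> cyl (w @ [k]) \<longleftrightarrow> x \<in> cyl w \<and> index x (length w) = k"
  by (auto simp: cyl_def less_Suc_eq nth_append)

text \<open>
Additivity over the possible next symbols. The part of the cylinder that the first \<open>n\<close> symbols miss lies in a tail
set and disappears in the limit.
\<close>

lemma mass_sums: "(\<lambda>k. mass (w @ [k])) sums mass w"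
proof -
  define t where "t n x = indicat_real (cyl w) x - (\<Sum>k<n. indicat_real (cyl (w @ [k])) x)" for n x
  have t_eq: "t n x = indicat_real (cyl w \<inter> tail (length w) n) x" for n x
  proof -
    have "(\<Sum>k<n. indicat_real (cyl (w @ [k])) x) = (\<Sum>k<n. if k = index x (length w) then indicat_real (cyl w) x else 0)"
      by (intro sum.cong) (auto simp: indicator_def mem_cyl_snoc)
    also have "\<dots> = (if index x (length w) < n then indicat_real (cyl w) x else 0)"
      by simp
    finally show ?thesis
      using cyl_subset[of w] by (auto simp: t_def indicator_def tail_def)
  qed
  have tH: "(\<lambda>x. t n x) \<in> H" for n
    unfolding t_def by (intro H_diff indicator_cyl_H H_sum) simp
  have ct: "c (\<lambda>x. t n x) = mass w - (\<Sum>k<n. mass (w @ [k]))" for n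
    unfolding t_def mass_def
    by (subst c_diff[OF indicator_cyl_H H_sum[OF _ indicator_cyl_H]]) (simp_all add: c_sum indicator_cyl_H)
  have "norm (mass w - (\<Sum>k<n. mass (w @ [k]))) \<le> c (indicat_real (tail (length w) n))" for n
  proof -
    have "0 \<le> c (\<lambda>x. t n x)"
      by (rule c_nonneg[OF tH]) (simp add: t_eq)
    moreover have "c (\<lambda>x. t n x) \<le> c (indicat_real (tail (length w) n))"
      by (rule c_mono[OF tH indicator_tail_H]) (simp add: t_eq indicator_def)
    ultimately show ?thesis
      unfolding ct by simp
  qed
  then have "\<forall>n. norm (mass w - (\<Sum>k<n. mass (w @ [k]))) \<le> c (indicat_real (tail (length w) n))"
    by blast
  then have "(\<lambda>n. mass w - (\<Sum>k<n. mass (w @ [k]))) \<longlonglongrightarrow> 0"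
    by (rule Lim_null_comparison[OF always_eventually _]) (rule tail_limit)
  from tendsto_diff[OF tendsto_const[of "mass w"] this] show ?thesis
    unfolding sums_def by simp
qed

text \<open>
The conditional distribution of the symbol after \<open>w\<close>. The value for words of mass zero is arbitrary, since
these are never drawn.
\<close>

definition next_symbol :: "nat list \<Rightarrow> nat pmf" where
  "next_symbol w = (if 0 < mass w then embed_pmf (\<lambda>k. mass (w @ [k]) / mass w) else return_pmf 0)"

lemma pmf_next_symbol:
  assumes "0 < mass w"
  shows "pmf (next_symbol w) k = mass (w @ [k]) / mass w"
proof -
  have s: "(\<lambda>k. mass (w @ [k]) / mass w) sums 1"
    using sums_divide[OF mass_sums[of w], of "mass w"] assms by simp
  have "pmf (embed_pmf (\<lambda>k. mass (w @ [k]) / mass w)) k = mass (w @ [k]) / mass w"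
  proof (rule pmf_embed_pmf)
    show "0 \<le> mass (w @ [k]) / mass w" for k
      using mass_nonneg assms by simp
    have "(\<integral>\<^sup>+k. ennreal (mass (w @ [k]) / mass w) \<partial>count_space UNIV) = (\<Sum>k. ennreal (mass (w @ [k]) / mass w))"
      by (rule nn_integral_count_space_nat)
    also have "\<dots> = ennreal (\<Sum>k. mass (w @ [k]) / mass w)"
      using s assms mass_nonneg by (intro suminf_ennreal2) (auto simp: sums_iff)
    finally show "(\<integral>\<^sup>+k. ennreal (mass (w @ [k]) / mass w) \<partial>count_space UNIV) = 1"
      using s by (simp add: sums_iff)
  qed
  with assms show ?thesis
    by (simp add: next_symbol_def)
qed

primrec word_pmf :: "nat \<Rightarrow> nat list pmf" where
  "word_pmf 0 = return_pmf []"
| "word_pmf (Suc n) = bind_pmf (word_pmf n) (\<lambda>w. map_pmf (\<lambda>k. w @ [k]) (next_symbol w))"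

lemma length_word_pmf: "w \<in> set_pmf (word_pmf n) \<Longrightarrow> length w = n"
  by (induction n arbitrary: w) auto

lemma pmf_word_snoc: "pmf (word_pmf (Suc n)) (w @ [k]) = pmf (word_pmf n) w * pmf (next_symbol w) k"
proof -
  have inj: "inj (\<lambda>k. v @ [k])" for v :: "nat list"
    by (rule injI) simp
  have "pmf (map_pmf (\<lambda>k. v @ [k]) (next_symbol v)) (w @ [k]) = indicat_real {w} v * pmf (next_symbol w) k" for v
  proof (cases "v = w")
    case True
    then show ?thesis
      using pmf_map_inj'[OF inj, of w "next_symbol w" k] by simp
  next
    case False
    then have "w @ [k] \<notin> set_pmf (map_pmf (\<lambda>k. v @ [k]) (next_symbol v))"
      by auto
    then have "pmf (map_pmf (\<lambda>k. v @ [k]) (next_symbol v)) (w @ [k]) = 0"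
      by (rule pmf_eq_0_set_pmf[THEN iffD2])
    with False show ?thesis
      by simp
  qed
  then have "pmf (word_pmf (Suc n)) (w @ [k]) = (\<integral>v. indicat_real {w} v * pmf (next_symbol w) k \<partial>measure_pmf (word_pmf n))"
    by (simp add: pmf_bind)
  also have "\<dots> = measure (measure_pmf (word_pmf n)) {w} * pmf (next_symbol w) k"
    by simp
  finally show ?thesis
    by (simp add: pmf.rep_eq)
qed

lemma pmf_word: "length w = n \<Longrightarrow> pmf (word_pmf n) w = mass w"
proof (induction n arbitrary: w)
  case 0
  then show ?case
    by (simp add: mass_Nil)
next
  case (Suc n)
  then obtain v k where w: "w = v @ [k]" "length v = n"
    by (metis append_butlast_last_id length_0_conv length_append_singleton nat.inject old.nat.distinct(2))
  have le: "mass (v @ [k]) \<le> mass v"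
    unfolding mass_def by (rule c_mono[OF indicator_cyl_H indicator_cyl_H]) (simp add: indicator_def mem_cyl_snoc)
  have "pmf (word_pmf (Suc n)) w = mass v * pmf (next_symbol v) k"
    unfolding w(1) pmf_word_snoc Suc.IH[OF w(2)] ..
  also have "\<dots> = mass w"
  proof (cases "0 < mass v")
    case True
    then show ?thesis
      by (simp add: pmf_next_symbol w(1))
  next
    case False
    then show ?thesis
      using le mass_nonneg[of v] mass_nonneg[of "v @ [k]"] by (simp add: w(1))
  qed
  finally show ?case .
qed

lemma take_word_pmf:
  assumes "n \<le> k"
  shows "map_pmf (take n) (word_pmf k) = word_pmf n"
  using assms
proof (induction k rule: dec_induct)
  case base
  have "map_pmf (take n) (word_pmf n) = map_pmf (\<lambda>w. w) (word_pmf n)"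
    by (rule map_pmf_cong) (simp_all add: length_word_pmf)
  then show ?case
    by simp
next
  case (step k)
  have "map_pmf (take n) (word_pmf (Suc k)) = bind_pmf (word_pmf k) (\<lambda>w. map_pmf (\<lambda>j. take n (w @ [j])) (next_symbol w))"
    by (simp add: map_bind_pmf map_pmf_comp)
  also have "\<dots> = bind_pmf (word_pmf k) (\<lambda>w. return_pmf (take n w))"
    using step(1) by (intro bind_pmf_cong) (simp_all add: length_word_pmf)
  also have "\<dots> = map_pmf (take n) (word_pmf k)"
    by (simp add: map_pmf_def)
  finally show ?case
    using step.IH by simp
qed

end

section \<open>Construction of the eigenmeasure\<close>

context ruelle_spectral
begin

text \<open>
The shortest length of a word that determines the coordinates in \<open>J\<close>.
\<close>

definition horizon :: "nat set \<Rightarrow> nat" where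
  "horizon J = (if J = {} then 0 else Suc (Max J))"

definition word_to_seq :: "nat set \<Rightarrow> nat list \<Rightarrow> nat \<Rightarrow> real" where
  "word_to_seq J w = (\<lambda>j\<in>J. b (w ! j))"

text \<open>
The joint law of the coordinates in \<open>J\<close>. Sequences take real values here, as Kolmogorov's extension theorem
needs a Polish space.
\<close>

definition marginal :: "nat set \<Rightarrow> (nat \<Rightarrow> real) measure" where
  "marginal J = distr (measure_pmf (word_pmf (horizon J))) (PiM J (\<lambda>_. borel)) (word_to_seq J)"

lemma less_horizon: "finite J \<Longrightarrow> j \<in> J \<Longrightarrow> j < horizon J"
  using Max_ge[of J j] by (auto simp: horizon_def less_Suc_eq_le)

lemma horizon_mono:
  assumes "J \<subseteq> J'" "finite J'"
  shows "horizon J \<le> horizon J'"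
proof (cases "J = {}")
  case False
  then have "Max J \<in> J'"
    using Max_in[of J] finite_subset[OF assms] assms(1) by blast
  with False less_horizon[OF assms(2)] show ?thesis
    by (simp add: horizon_def Suc_le_eq)
qed (simp add: horizon_def)

lemma word_to_seq_measurable: "word_to_seq J \<in> measurable (measure_pmf q) (PiM J (\<lambda>_. borel))"
  unfolding word_to_seq_def[abs_def] by (rule measurable_restrict) simp

lemma word_to_seq_measurable': "word_to_seq J \<in> measurable (count_space UNIV) (PiM J (\<lambda>_. borel))"
  unfolding word_to_seq_def[abs_def] by (rule measurable_restrict) simp

lemma marginal_projective:
  assumes J: "J \<subseteq> J'" "finite J'"
  shows "marginal J = distr (marginal J') (PiM J (\<lambda>_. borel)) (\<lambda>x. restrict x J)"
proof -
  have fin: "finite J"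
    by (rule finite_subset[OF J])
  have "distr (marginal J') (PiM J (\<lambda>_. borel)) (\<lambda>x. restrict x J) =
      distr (measure_pmf (word_pmf (horizon J'))) (PiM J (\<lambda>_. borel)) ((\<lambda>x. restrict x J) \<circ> word_to_seq J')"
    unfolding marginal_def by (rule distr_distr[OF measurable_restrict_subset[OF J(1)] word_to_seq_measurable])
  also have "(\<lambda>x. restrict x J) \<circ> word_to_seq J' = word_to_seq J \<circ> take (horizon J)"
  proof (rule ext)
    fix w
    show "((\<lambda>x. restrict x J) \<circ> word_to_seq J') w = (word_to_seq J \<circ> take (horizon J)) w"
      using J(1) less_horizon[OF fin] by (auto simp: word_to_seq_def restrict_def fun_eq_iff)
  qed
  also have "distr (measure_pmf (word_pmf (horizon J'))) (PiM J (\<lambda>_. borel)) (word_to_seq J \<circ> take (horizon J)) =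
      distr (distr (measure_pmf (word_pmf (horizon J'))) (count_space UNIV) (take (horizon J))) (PiM J (\<lambda>_. borel)) (word_to_seq J)"
    by (rule distr_distr[symmetric, OF word_to_seq_measurable']) simp
  also have "\<dots> = distr (measure_pmf (map_pmf (take (horizon J)) (word_pmf (horizon J')))) (PiM J (\<lambda>_. borel)) (word_to_seq J)"
    by (simp add: map_pmf_rep_eq)
  also have "\<dots> = marginal J"
    unfolding marginal_def take_word_pmf[OF horizon_mono[OF J]] ..
  finally show ?thesis ..
qed

lemma polish_projective_marginal: "polish_projective UNIV marginal"
proof (intro polish_projective.intro projective_family.intro)
  show "marginal J = distr (marginal H) (PiM J (\<lambda>_. borel)) (\<lambda>f. restrict f J)"
    if "J \<subseteq> H" "finite H" for J H
    by (rule marginal_projective[OF that])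
  show "prob_space (marginal J)" for J
    unfolding marginal_def by (rule prob_space.prob_space_distr[OF prob_space_measure_pmf word_to_seq_measurable])
qed

definition path_measure :: "(nat \<Rightarrow> real) measure" where
  "path_measure = projective_family.lim UNIV marginal (\<lambda>_. borel)"

definition path_cyl :: "nat list \<Rightarrow> (nat \<Rightarrow> real) set" where
  "path_cyl w = {x. \<forall>i<length w. x i = b (w ! i)}"

lemma path_measure_prefix:
  assumes Y: "Y \<in> sets (PiM {..<n} (\<lambda>_. borel))"
  shows "{x. restrict x {..<n} \<in> Y} \<in> sets path_measure"
    and "emeasure path_measure {x. restrict x {..<n} \<in> Y} = emeasure (measure_pmf (word_pmf n)) {v. word_to_seq {..<n} v \<in> Y}"
proof -
  interpret polish_projective UNIV marginal
    by (rule polish_projective_marginal)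
  have hor: "horizon {..<n} = n"
  proof (cases n)
    case (Suc k)
    have "Max {..<Suc k} = k"
      by (rule Max_eqI) auto
    with Suc show ?thesis
      by (auto simp: horizon_def lessThan_empty_iff)
  qed (simp add: horizon_def)
  have eq: "emb UNIV {..<n} Y = {x. restrict x {..<n} \<in> Y}"
    by (auto simp: prod_emb_def)
  have "emb UNIV {..<n} Y \<in> sets lim"
    unfolding sets_lim by (rule measurable_prod_emb[OF subset_UNIV Y])
  then show "{x. restrict x {..<n} \<in> Y} \<in> sets path_measure"
    by (simp add: eq path_measure_def)
  have "emeasure lim (emb UNIV {..<n} Y) = emeasure (marginal {..<n}) Y"
    by (rule emeasure_lim_emb) (simp_all add: Y)
  also have "\<dots> = emeasure (measure_pmf (word_pmf n)) (word_to_seq {..<n} -` Y \<inter> space (measure_pmf (word_pmf n)))"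
    unfolding marginal_def hor by (rule emeasure_distr[OF word_to_seq_measurable Y])
  also have "word_to_seq {..<n} -` Y \<inter> space (measure_pmf (word_pmf n)) = {v. word_to_seq {..<n} v \<in> Y}"
    by auto
  finally show "emeasure path_measure {x. restrict x {..<n} \<in> Y} = emeasure (measure_pmf (word_pmf n)) {v. word_to_seq {..<n} v \<in> Y}"
    unfolding eq path_measure_def .
qed

lemma prob_space_path_measure: "prob_space path_measure"
proof -
  interpret polish_projective UNIV marginal
    by (rule polish_projective_marginal)
  show ?thesis
    unfolding path_measure_def by (rule P.prob_space_axioms)
qed

lemma space_path_measure: "space path_measure = UNIV"
proof -
  interpret polish_projective UNIV marginal
    by (rule polish_projective_marginal)
  show ?thesis
    by (simp add: path_measure_def space_PiM)
qed

lemma box_sets: "(\<Pi>\<^sub>E i\<in>{..<n}. {b (w ! i)}) \<in> sets (PiM {..<n} (\<lambda>_. borel))"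
  by (rule sets_PiM_I_finite) simp_all

lemma path_cyl_eq: "path_cyl w = {x. restrict x {..<length w} \<in> (\<Pi>\<^sub>E i\<in>{..<length w}. {b (w ! i)})}"
  by (auto simp: path_cyl_def PiE_iff)

lemma path_cyl_sets: "path_cyl w \<in> sets path_measure"
  unfolding path_cyl_eq by (rule path_measure_prefix(1)[OF box_sets])

lemma emeasure_path_cyl: "emeasure path_measure (path_cyl w) = ennreal (mass w)"
proof -
  let ?W = "word_pmf (length w)"
  have "emeasure path_measure (path_cyl w) = emeasure (measure_pmf ?W) {v. word_to_seq {..<length w} v \<in> (\<Pi>\<^sub>E i\<in>{..<length w}. {b (w ! i)})}"
    unfolding path_cyl_eq by (rule path_measure_prefix(2)[OF box_sets])
  also have "{v. word_to_seq {..<length w} v \<in> (\<Pi>\<^sub>E i\<in>{..<length w}. {b (w ! i)})} = {v. \<forall>i<length w. v ! i = w ! i}"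
    using b_inj by (auto simp: word_to_seq_def PiE_iff inj_eq)
  also have "emeasure (measure_pmf ?W) {v. \<forall>i<length w. v ! i = w ! i} = emeasure (measure_pmf ?W) {w}"
  proof (rule emeasure_eq_AE)
    show "AE v in measure_pmf ?W. (v \<in> {v. \<forall>i<length w. v ! i = w ! i}) = (v \<in> {w})"
      unfolding AE_measure_pmf_iff using length_word_pmf by (auto simp: list_eq_iff_nth_eq)
  qed simp_all
  also have "\<dots> = ennreal (mass w)"
    by (simp add: emeasure_pmf_single pmf_word)
  finally show ?thesis .
qed

text \<open>
The sequences whose first \<open>n\<close> symbols spell a word of positive mass.
\<close>

definition charged :: "nat \<Rightarrow> (nat \<Rightarrow> real) set" where
  "charged n = (\<Union>w\<in>{w. length w = n \<and> 0 < mass w}. path_cyl w)"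

lemma charged_sets: "charged n \<in> sets path_measure"
  unfolding charged_def by (intro sets.countable_UN' image_subsetI path_cyl_sets countableI_type)

lemma AE_charged: "AE x in path_measure. x \<in> charged n"
proof -
  interpret prob_space path_measure
    by (rule prob_space_path_measure)
  define Y where "Y = (\<Union>w\<in>{w. length w = n \<and> 0 < mass w}. \<Pi>\<^sub>E i\<in>{..<n}. {b (w ! i)})"
  have Y: "Y \<in> sets (PiM {..<n} (\<lambda>_. borel))"
    unfolding Y_def by (intro sets.countable_UN' image_subsetI box_sets countableI_type)
  have eq: "charged n = {x. restrict x {..<n} \<in> Y}"
    by (auto simp: charged_def Y_def path_cyl_eq)
  have "emeasure path_measure (charged n) = emeasure (measure_pmf (word_pmf n)) {v. word_to_seq {..<n} v \<in> Y}"
    unfolding eq by (rule path_measure_prefix(2)[OF Y])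
  also have "\<dots> = 1"
  proof -
    have "word_to_seq {..<n} v \<in> Y" if v: "v \<in> set_pmf (word_pmf n)" for v
    proof -
      have "length v = n"
        by (rule length_word_pmf[OF v])
      moreover have "0 < mass v"
        using v pmf_word[OF \<open>length v = n\<close>] by (metis pmf_positive)
      ultimately show ?thesis
        unfolding Y_def word_to_seq_def by (intro UN_I[of v]) auto
    qed
    then have "AE v in measure_pmf (word_pmf n). v \<in> {v. word_to_seq {..<n} v \<in> Y}"
      unfolding AE_measure_pmf_iff by simp
    then show ?thesis
      by (intro measure_pmf.emeasure_eq_1_AE) simp_all
  qed
  finally have "prob (charged n) = 1"
    by (simp add: measure_def)
  then show ?thesis
    by (rule AE_prob_1)
qed

text \<open>
A word of positive mass has a nonempty cylinder, hence is admissible. So a sequence all of whose prefixes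
have positive mass obeys the transition rules.
\<close>

lemma charged_in_X:
  assumes "\<And>n. x \<in> charged n"
  shows "x \<in> X"
proof -
  have "x n \<in> range b \<and> A (x n) (x (Suc n)) = 1" for n
  proof -
    obtain w where w: "length w = Suc (Suc n)" "0 < mass w" "x \<in> path_cyl w"
      using assms[of "Suc (Suc n)"] by (auto simp: charged_def)
    obtain y where y: "y \<in> cyl w"
      using cyl_nonempty[OF w(2)] by blast
    then have yX: "y \<in> X"
      by (simp add: cyl_def)
    have "x i = y i" if "i < Suc (Suc n)" for i
    proof -
      have "x i = b (w ! i)"
        using w(1,3) that by (simp add: path_cyl_def)
      also have "\<dots> = b (index y i)"
        using y w(1) that by (simp add: cyl_def)
      also have "\<dots> = y i"
        by (rule b_index[OF yX])
      finally show ?thesis .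
    qed
    then have "x n = y n" "x (Suc n) = y (Suc n)"
      by simp_all
    with X_symbol[OF yX, of n] X_step[OF yX, of n] show ?thesis
      by simp
  qed
  then show ?thesis
    unfolding shift_space_def by blast
qed

definition core :: "(nat \<Rightarrow> real) set" where
  "core = (\<Inter>n. charged n)"

lemma core_subset: "core \<subseteq> X"
  using charged_in_X by (auto simp: core_def)

lemma core_sets: "core \<in> sets path_measure"
  unfolding core_def by (intro sets.countable_INT' image_subsetI charged_sets countableI_type) simp

lemma AE_core: "AE x in path_measure. x \<in> core"
  unfolding core_def INT_iff ball_UNIV AE_all_countable using AE_charged by blast

lemma path_cyl_Int_X: "x \<in> X \<Longrightarrow> x \<in> path_cyl w \<longleftrightarrow> x \<in> cyl w"
proof -
  assume x: "x \<in> X"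
  have "x i = b k \<longleftrightarrow> index x i = k" for i k
    using index_eqI[of x i k] b_index[OF x, of i] by auto
  with x show ?thesis
    by (simp add: path_cyl_def cyl_def)
qed

text \<open>
The extension lives on all real sequences. This map, the identity up to a null set, pushes it to \<open>X\<close>; its value
outside \<open>core\<close> is arbitrary.
\<close>

definition retract_core :: "(nat \<Rightarrow> real) \<Rightarrow> nat \<Rightarrow> real" where
  "retract_core x = (if x \<in> core then x else SOME z. z \<in> X)"

lemma retract_core_in_X: "retract_core x \<in> X"
  using core_subset some_in_eq[of X] X_nonempty by (auto simp: retract_core_def)

lemma retract_core_measurable: "retract_core \<in> measurable path_measure (shift_borel (range b) A)"
proof -
  have "retract_core \<in> measurable path_measure (sigma X (range cyl))"
  proof (rule measurable_measure_of)
    show "range cyl \<subseteq> Pow X"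
      using cyl_subset by auto
    show "retract_core \<in> space path_measure \<rightarrow> X"
      using retract_core_in_X by auto
    fix Y assume "Y \<in> range cyl"
    then obtain w where Y: "Y = cyl w"
      by blast
    have "retract_core -` Y \<inter> space path_measure =
      (core \<inter> path_cyl w) \<union> (if (SOME z. z \<in> X) \<in> cyl w then space path_measure - core else {})"
      using path_cyl_Int_X core_subset by (auto simp: Y retract_core_def space_path_measure split: if_splits)
    also have "\<dots> \<in> sets path_measure"
      using core_sets path_cyl_sets by (auto intro!: sets.Un sets.Int)
    finally show "retract_core -` Y \<inter> space path_measure \<in> sets path_measure" .
  qed
  moreover have "sets (sigma X (range cyl)) = sets (shift_borel (range b) A)"
    unfolding sets_shift_borel by (rule sets_measure_of) (use cyl_subset in auto)
  ultimately show ?thesis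
    using measurable_cong_sets[OF refl, of "sigma X (range cyl)" "shift_borel (range b) A" path_measure] by simp
qed

definition eigenmeasure :: "(nat \<Rightarrow> real) measure" where
  "eigenmeasure = distr path_measure (shift_borel (range b) A) retract_core"

lemma eigenmeasure_probability: "borel_probability (range b) A eigenmeasure"
  unfolding borel_probability_def eigenmeasure_def
  using prob_space.prob_space_distr[OF prob_space_path_measure retract_core_measurable] by simp

lemma emeasure_eigenmeasure_cyl: "emeasure eigenmeasure (cyl w) = ennreal (mass w)"
proof -
  have "emeasure eigenmeasure (cyl w) = emeasure path_measure (retract_core -` cyl w \<inter> space path_measure)"
    unfolding eigenmeasure_def by (rule emeasure_distr[OF retract_core_measurable cyl_sets])
  also have "\<dots> = emeasure path_measure (path_cyl w)"
  proof (rule emeasure_eq_AE)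
    show "AE x in path_measure. (x \<in> retract_core -` cyl w \<inter> space path_measure) = (x \<in> path_cyl w)"
      using AE_core
    proof (rule AE_mp, intro AE_I2 impI)
      fix x assume "x \<in> core"
      then show "(x \<in> retract_core -` cyl w \<inter> space path_measure) = (x \<in> path_cyl w)"
        using path_cyl_Int_X[of x w] core_subset by (auto simp: retract_core_def space_path_measure)
    qed
    show "retract_core -` cyl w \<inter> space path_measure \<in> sets path_measure"
      by (rule measurable_sets[OF retract_core_measurable cyl_sets])
  qed (rule path_cyl_sets)
  also have "\<dots> = ennreal (mass w)"
    by (rule emeasure_path_cyl)
  finally show ?thesis .
qed

end

section \<open>Positive functionals on Hoelder functions\<close>

context ruelle_potential
begin

text \<open>
Integration against a finite Borel measure is the main example, \<open>c\<close> another.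
\<close>

definition positive_functional :: "(((nat \<Rightarrow> real) \<Rightarrow> real) \<Rightarrow> real) \<Rightarrow> bool" where
  "positive_functional J \<longleftrightarrow>
     (\<forall>g\<in>H. \<forall>h\<in>H. J (\<lambda>x. g x + h x) = J g + J h) \<and>
     (\<forall>h\<in>H. \<forall>k. J (\<lambda>x. k * h x) = k * J h) \<and>
     (\<forall>h\<in>H. (\<forall>x\<in>X. 0 \<le> h x) \<longrightarrow> 0 \<le> J h)"

lemma positive_functionalD:
  assumes J: "positive_functional J"
  shows "g \<in> H \<Longrightarrow> h \<in> H \<Longrightarrow> J (\<lambda>x. g x + h x) = J g + J h"
    and "h \<in> H \<Longrightarrow> J (\<lambda>x. k * h x) = k * J h"
    and "h \<in> H \<Longrightarrow> (\<And>x. x \<in> X \<Longrightarrow> 0 \<le> h x) \<Longrightarrow> 0 \<le> J h"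
    and "g \<in> H \<Longrightarrow> h \<in> H \<Longrightarrow> J (\<lambda>x. g x - h x) = J g - J h"
proof -
  show add: "J (\<lambda>x. g x + h x) = J g + J h" if "g \<in> H" "h \<in> H" for g h
    using J that unfolding positive_functional_def by simp
  show scale: "J (\<lambda>x. k * h x) = k * J h" if "h \<in> H" for k h
    using J that unfolding positive_functional_def by simp
  show "h \<in> H \<Longrightarrow> (\<And>x. x \<in> X \<Longrightarrow> 0 \<le> h x) \<Longrightarrow> 0 \<le> J h"
    using J unfolding positive_functional_def by simp
  show "J (\<lambda>x. g x - h x) = J g - J h" if "g \<in> H" "h \<in> H"
    using add[OF that(1) H_scale[OF that(2), of "-1"]] scale[OF that(2), of "-1"] by simp
qed

lemma positive_functional_mono:
  assumes J: "positive_functional J" and "g \<in> H" "h \<in> H" "\<And>x. x \<in> X \<Longrightarrow> g x \<le> h x"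
  shows "J g \<le> J h"
proof -
  have "0 \<le> J (\<lambda>x. h x - g x)"
    using assms by (intro positive_functionalD(3)[OF J] H_diff) simp_all
  with positive_functionalD(4)[OF J assms(3,2)] show ?thesis
    by simp
qed

lemma positive_functional_abs:
  assumes J: "positive_functional J" and h: "h \<in> H" and d: "d \<in> H" "\<And>x. x \<in> X \<Longrightarrow> \<bar>h x\<bar> \<le> d x"
  shows "\<bar>J h\<bar> \<le> J d"
proof -
  have "h x \<le> d x" "- d x \<le> h x" if "x \<in> X" for x
    using d(2)[OF that] by (simp_all add: abs_le_iff)
  then have "J h \<le> J d" "J (\<lambda>x. (-1) * d x) \<le> J h"
    by (intro positive_functional_mono[OF J] h d H_scale; simp)+
  with positive_functionalD(2)[OF J d(1), of "-1"] show ?thesis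
    by (simp add: abs_le_iff)
qed

lemma positive_functional_sum:
  assumes J: "positive_functional J" and "finite T" "\<And>k. k \<in> T \<Longrightarrow> g k \<in> H"
  shows "J (\<lambda>x. \<Sum>k\<in>T. g k x) = (\<Sum>k\<in>T. J (g k))"
  using assms(2,3)
proof (induction T rule: finite_induct)
  case empty
  show ?case
    using positive_functionalD(2)[OF J zero_in_H, of 0] by simp
next
  case (insert k T)
  then show ?case
    using positive_functionalD(1)[OF J, of "g k" "\<lambda>x. \<Sum>k\<in>T. g k x"] H_sum[of T g] by simp
qed

lemma H_mult:
  assumes g: "g \<in> H" and h: "h \<in> H"
  shows "(\<lambda>x. g x * h x) \<in> H"
proof -
  obtain C where C: "0 \<le> C" "\<And>x. x \<notin> X \<Longrightarrow> g x = 0" "\<And>x y. x \<in> X \<Longrightarrow> y \<in> X \<Longrightarrow> norm (g x - g y) \<le> C * hdist x y" "\<And>x. x \<in> X \<Longrightarrow> norm (g x) \<le> C"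
    by (rule holder_spaceE[OF g]) blast
  obtain C' where C': "0 \<le> C'" "\<And>x y. x \<in> X \<Longrightarrow> y \<in> X \<Longrightarrow> norm (h x - h y) \<le> C' * hdist x y" "\<And>x. x \<in> X \<Longrightarrow> norm (h x) \<le> C'"
    by (rule holder_spaceE[OF h]) blast
  have "norm (g x * h x - g y * h y) \<le> (2 * (C * C')) * hdist x y" if x: "x \<in> X" and y: "y \<in> X" for x y
  proof -
    have "g x * h x - g y * h y = (g x - g y) * h x + g y * (h x - h y)"
      by (simp add: algebra_simps)
    then have "norm (g x * h x - g y * h y) \<le> norm (g x - g y) * norm (h x) + norm (g y) * norm (h x - h y)"
      using norm_triangle_ineq[of "(g x - g y) * h x" "g y * (h x - h y)"] by (simp only: norm_mult)
    also have "\<dots> \<le> (C * hdist x y) * C' + C * (C' * hdist x y)"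
      using C C' x y hdist_nonneg[of x y] by (intro add_mono mult_mono) simp_all
    finally show ?thesis
      by (simp add: mult_ac)
  qed
  then show ?thesis
    by (rule holder_spaceI[rotated]) (simp_all add: C(2))
qed

lemma H_inverse:
  assumes g: "g \<in> H" and m: "0 < m" "\<And>x. x \<in> X \<Longrightarrow> m \<le> g x"
  shows "(\<lambda>x. inverse (g x)) \<in> H"
proof -
  obtain C where C: "0 \<le> C" "\<And>x. x \<notin> X \<Longrightarrow> g x = 0" "\<And>x y. x \<in> X \<Longrightarrow> y \<in> X \<Longrightarrow> norm (g x - g y) \<le> C * hdist x y"
    by (rule holder_spaceE[OF g]) blast
  have "norm (inverse (g x) - inverse (g y)) \<le> (C / (m * m)) * hdist x y" if x: "x \<in> X" and y: "y \<in> X" for x y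
  proof -
    have gx: "0 < g x" "0 < g y"
      using m(1) m(2)[OF x] m(2)[OF y] by simp_all
    have "inverse (g x) - inverse (g y) = (g y - g x) / (g x * g y)"
      using gx by (simp add: field_simps)
    then have "norm (inverse (g x) - inverse (g y)) = norm (g y - g x) / (g x * g y)"
      using gx by (simp add: abs_mult)
    also have "\<dots> \<le> (C * hdist x y) / (m * m)"
      using C(3)[OF y x] m(1) m(2)[OF x] m(2)[OF y] gx hdist_sym[of x y] by (intro frac_le mult_mono mult_pos_pos) auto
    finally show ?thesis
      by simp
  qed
  then show ?thesis
    by (rule holder_spaceI[rotated]) (simp_all add: C(2))
qed

lemma H_integrable:
  assumes "finite_measure \<nu>" "sets \<nu> = sets (shift_borel (range b) A)" and h: "h \<in> H"
  shows "integrable \<nu> h"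
proof -
  obtain C where C: "\<And>x. x \<in> X \<Longrightarrow> norm (h x) \<le> C"
    by (rule holder_spaceE[OF h]) blast
  have space: "space \<nu> = X"
    using sets_eq_imp_space_eq[OF assms(2)] space_shift_borel by simp
  have meas: "h \<in> borel_measurable \<nu>"
    unfolding measurable_cong_sets[OF assms(2) refl] by (rule H_measurable[OF h])
  show ?thesis
    by (rule finite_measure.integrable_const_bound[OF assms(1) _ meas, of C]) (use C space in \<open>auto intro!: AE_I2\<close>)
qed

lemma integral_positive_functional:
  assumes "finite_measure \<nu>" "sets \<nu> = sets (shift_borel (range b) A)"
  shows "positive_functional (\<lambda>h. \<integral>x. h x \<partial>\<nu>)"
proof -
  have space: "space \<nu> = X"
    using sets_eq_imp_space_eq[OF assms(2)] space_shift_borel by simp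
  show ?thesis
    unfolding positive_functional_def
  proof (intro conjI ballI allI impI)
    fix h assume "h \<in> H" "\<forall>x\<in>X. 0 \<le> h x"
    then show "0 \<le> (\<integral>x. h x \<partial>\<nu>)"
      using space by (intro Bochner_Integration.integral_nonneg) simp
  qed (simp_all add: H_integrable[OF assms])
qed

end

context ruelle_spectral
begin

lemma positive_functional_c: "positive_functional c"
  unfolding positive_functional_def using c_add c_scale c_nonneg by blast

text \<open>
\<open>J\<close> is bounded with respect to the supremum norm by positivity, so it may be applied to the asymptotics
\<open>Q^n h = c h * W^n * f + O(r^n W^n)\<close>, whose left side it maps to \<open>W^n * J h\<close>.
\<close>

lemma eigenfunctional_eq_c:
  assumes J: "positive_functional J" and JL: "\<And>h. h \<in> H \<Longrightarrow> J (L h) = l * J h" and h: "h \<in> H"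
  shows "J h = c h * J f"
proof -
  have JLiter: "J ((L ^^ k) h) = l ^ k * J h" if "h \<in> H" for k h
    by (induction k) (simp_all add: JL H_Liter[OF that])
  have QH: "Q S h \<in> H" if "h \<in> H" for h
    unfolding Q_def[abs_def] by (intro H_sum finite_S H_Liter that)
  have JQ: "J (Q S h) = W * J h" if "h \<in> H" for h
    unfolding Q_def[abs_def] by (simp add: positive_functional_sum[OF J finite_S] H_Liter that JLiter W_def sum_distrib_right)
  have QiterH: "(Q S ^^ n) h \<in> H" for n
    by (induction n) (simp_all add: QH h)
  have JQiter: "J ((Q S ^^ n) h) = W ^ n * J h" for n
    by (induction n) (simp_all add: JQ QiterH)
  obtain \<epsilon> where e: "cbound h \<epsilon>"
    using h H_iff_cbound by blast
  have "\<forall>n. norm (J h - c h * J f) \<le> C * \<epsilon> * J (indicat_real X) * r ^ n"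
  proof
    fix n
    let ?d = "\<lambda>x. (Q S ^^ n) h x - c h * W ^ n * f x"
    have "\<bar>J ?d\<bar> \<le> J (\<lambda>x. (C * \<epsilon> * r ^ n * W ^ n) * indicat_real X x)"
      using cbound_abs[OF cone_gap[OF e, folded W_def], of _ n]
      by (intro positive_functional_abs[OF J] H_diff QiterH H_scale f_H H_indicator) simp
    also have "J (\<lambda>x. (C * \<epsilon> * r ^ n * W ^ n) * indicat_real X x) = (C * \<epsilon> * r ^ n * W ^ n) * J (indicat_real X)"
      by (rule positive_functionalD(2)[OF J H_indicator])
    also have "J ?d = J ((Q S ^^ n) h) - J (\<lambda>x. c h * W ^ n * f x)"
      by (rule positive_functionalD(4)[OF J QiterH H_scale[OF f_H]])
    also have "\<dots> = W ^ n * (J h - c h * J f)"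
      unfolding JQiter positive_functionalD(2)[OF J f_H] by (simp add: algebra_simps)
    finally have "W ^ n * \<bar>J h - c h * J f\<bar> \<le> W ^ n * (C * \<epsilon> * J (indicat_real X) * r ^ n)"
      using W_pos by (simp add: abs_mult mult_ac)
    then show "norm (J h - c h * J f) \<le> C * \<epsilon> * J (indicat_real X) * r ^ n"
      using W_pos by simp
  qed
  moreover have "(\<lambda>n. C * \<epsilon> * J (indicat_real X) * r ^ n) \<longlonglongrightarrow> 0"
    by (intro tendsto_mult_right_zero LIMSEQ_power_zero) (use r in simp)
  ultimately have "(\<lambda>n. J h - c h * J f) \<longlonglongrightarrow> 0"
    by (rule Lim_null_comparison[OF always_eventually])
  then show ?thesis
    by (simp add: LIMSEQ_const_iff)
qed

lemma finite_words: "finite {w :: nat list. set w \<subseteq> {..<N} \<and> length w = n}"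
  by (rule finite_lists_length_eq) simp

text \<open>
Approximate \<open>h\<close> by a function that is constant on the cylinders of words of length \<open>n\<close> with letters below \<open>N\<close>. On
these cylinders \<open>h\<close> varies by at most \<open>M * theta^n\<close>; the other points lie in one of the first \<open>n\<close> tails.
\<close>

lemma functional_cylinder_approximation:
  fixes n N :: nat
  assumes J: "positive_functional J" and Jcyl: "\<And>w. J (indicat_real (cyl w)) = mass w" and h: "h \<in> H"
    and M: "0 \<le> M" "\<And>x y. x \<in> X \<Longrightarrow> y \<in> X \<Longrightarrow> norm (h x - h y) \<le> M * hdist x y" "\<And>x. x \<in> X \<Longrightarrow> norm (h x) \<le> M"
  defines "F \<equiv> {w. set w \<subseteq> {..<N} \<and> length w = n}"
  shows "\<bar>J h - (\<Sum>w\<in>F. (if cyl w = {} then 0 else h (SOME x. x \<in> cyl w)) * mass w)\<bar>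
    \<le> M * theta ^ n + M * (\<Sum>i<n. J (indicat_real (tail i N)))"
proof -
  have F: "finite F"
    unfolding F_def by (rule finite_words)
  define a where "a w = (if cyl w = {} then 0 else h (SOME x. x \<in> cyl w))" for w
  let ?g = "\<lambda>x. \<Sum>w\<in>F. a w * indicat_real (cyl w) x"
  let ?d = "\<lambda>x. (M * theta ^ n) * indicat_real X x + M * (\<Sum>i<n. indicat_real (tail i N) x)"
  have gH: "?g \<in> H"
    by (intro H_sum F H_scale indicator_cyl_H)
  have tH: "(\<lambda>x. \<Sum>i<n. indicat_real (tail i N) x) \<in> H"
    by (intro H_sum indicator_tail_H) simp
  have dH: "?d \<in> H"
    by (intro H_add H_scale H_indicator tH)
  have "\<bar>h x - ?g x\<bar> \<le> ?d x" if x: "x \<in> X" for x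
  proof -
    let ?v = "prefix x n"
    have "?g x = (\<Sum>w\<in>F. if w = ?v then a ?v else 0)"
      using x by (intro sum.cong) (auto simp: indicator_def mem_cyl_iff F_def)
    also have "\<dots> = (if ?v \<in> F then a ?v else 0)"
      using F by simp
    finally have gx: "?g x = (if ?v \<in> F then a ?v else 0)" .
    have t0: "0 \<le> (\<Sum>i<n. indicat_real (tail i N) x)"
      by (intro sum_nonneg) simp
    show ?thesis
    proof (cases "?v \<in> F")
      case True
      have xc: "x \<in> cyl ?v"
        by (rule mem_cyl_prefix[OF x])
      define z where "z = (SOME x. x \<in> cyl ?v)"
      have z: "z \<in> cyl ?v"
        unfolding z_def by (rule someI[of "\<lambda>x. x \<in> cyl ?v", OF xc])
      have "a ?v = h z"
        using xc by (auto simp: a_def z_def)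
      moreover have "norm (h x - h z) \<le> M * hdist x z"
        using z x by (intro M(2)) (simp_all add: cyl_def)
      moreover have "M * hdist x z \<le> M * theta ^ n"
        using hdist_cyl[OF xc z] M(1) by (intro mult_left_mono) (simp_all add: length_prefix)
      ultimately have "\<bar>h x - ?g x\<bar> \<le> M * theta ^ n"
        unfolding gx using True by simp
      with x M(1) t0 show ?thesis
        by (simp add: add_increasing2)
    next
      case False
      have "\<not> (\<forall>i<n. index x i < N)"
      proof
        assume "\<forall>i<n. index x i < N"
        then have "?v \<in> F"
          by (auto simp: F_def length_prefix prefix_def)
        with False show False ..
      qed
      then obtain i where i: "i < n" "N \<le> index x i"
        by (auto simp: not_less)
      have "1 \<le> (\<Sum>i<n. indicat_real (tail i N) x)"
      proof -
        have "indicat_real (tail i N) x \<le> (\<Sum>i<n. indicat_real (tail i N) x)"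
          using i(1) by (intro member_le_sum) simp_all
        then show ?thesis
          using i(2) x by (simp add: tail_def)
      qed
      then have "M * 1 \<le> M * (\<Sum>i<n. indicat_real (tail i N) x)"
        using M(1) by (rule mult_left_mono)
      moreover have "\<bar>h x - ?g x\<bar> \<le> M"
        unfolding gx using False M(3)[OF x] by simp
      moreover have "0 \<le> M * theta ^ n * indicat_real X x"
        using M(1) theta by simp
      ultimately show ?thesis
        by linarith
    qed
  qed
  then have "\<bar>J (\<lambda>x. h x - ?g x)\<bar> \<le> J ?d"
    by (intro positive_functional_abs[OF J] H_diff h gH dH)
  moreover have "J (\<lambda>x. h x - ?g x) = J h - (\<Sum>w\<in>F. a w * mass w)"
  proof -
    have "J ?g = (\<Sum>w\<in>F. J (\<lambda>x. a w * indicat_real (cyl w) x))"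
      by (rule positive_functional_sum[OF J F]) (rule H_scale[OF indicator_cyl_H])
    then show ?thesis
      using positive_functionalD(4)[OF J h gH] by (simp add: positive_functionalD(2)[OF J indicator_cyl_H] Jcyl)
  qed
  moreover have "J ?d = M * theta ^ n + M * (\<Sum>i<n. J (indicat_real (tail i N)))"
  proof -
    have "J ?d = (M * theta ^ n) * J (indicat_real X) + M * J (\<lambda>x. \<Sum>i<n. indicat_real (tail i N) x)"
      using positive_functionalD(1)[OF J H_scale[OF H_indicator] H_scale[OF tH]]
      by (simp only: positive_functionalD(2)[OF J H_indicator] positive_functionalD(2)[OF J tH])
    moreover have "J (indicat_real X) = 1"
      using Jcyl[of "[]"] by (simp add: cyl_Nil mass_Nil)
    moreover have "J (\<lambda>x. \<Sum>i<n. indicat_real (tail i N) x) = (\<Sum>i<n. J (indicat_real (tail i N)))"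
      by (rule positive_functional_sum[OF J]) (simp_all add: indicator_tail_H)
    ultimately show ?thesis
      by simp
  qed
  ultimately show ?thesis
    by (simp add: a_def)
qed

text \<open>
The approximations of \<open>functional_cylinder_approximation\<close> depend on the masses of cylinders only, hence are the same
for \<open>J\<close> and for \<open>c\<close>. First \<open>N\<close> and then \<open>n\<close> tends to infinity.
\<close>

lemma functional_eq_c:
  assumes J: "positive_functional J" and Jcyl: "\<And>w. J (indicat_real (cyl w)) = mass w"
    and Jtail: "\<And>i. (\<lambda>N. J (indicat_real (tail i N))) \<longlonglongrightarrow> 0" and h: "h \<in> H"
  shows "J h = c h"
proof -
  obtain M where M: "0 \<le> M" "\<And>x y. x \<in> X \<Longrightarrow> y \<in> X \<Longrightarrow> norm (h x - h y) \<le> M * hdist x y" "\<And>x. x \<in> X \<Longrightarrow> norm (h x) \<le> M"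
    by (rule holder_spaceE[OF h]) blast
  have le: "\<bar>J h - c h\<bar> \<le> 2 * M * theta ^ n" for n
  proof -
    let ?R = "\<lambda>N. (M * theta ^ n + M * (\<Sum>i<n. J (indicat_real (tail i N)))) + (M * theta ^ n + M * (\<Sum>i<n. c (indicat_real (tail i N))))"
    have "\<bar>J h - c h\<bar> \<le> ?R N" for N
      using functional_cylinder_approximation[where N = N and n = n, OF J Jcyl h M]
        functional_cylinder_approximation[where N = N and n = n, OF positive_functional_c mass_def[symmetric] h M] by linarith
    moreover have "?R \<longlonglongrightarrow> (M * theta ^ n + M * (\<Sum>i<n. 0)) + (M * theta ^ n + M * (\<Sum>i<n. 0))"
      by (intro tendsto_add tendsto_mult tendsto_const tendsto_sum Jtail tail_limit)
    ultimately show ?thesis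
      using LIMSEQ_le_const[of ?R "(M * theta ^ n + M * (\<Sum>i<n. 0)) + (M * theta ^ n + M * (\<Sum>i<n. 0))" "\<bar>J h - c h\<bar>"] by simp
  qed
  have lim: "(\<lambda>n. 2 * M * theta ^ n) \<longlonglongrightarrow> 0"
    by (intro tendsto_mult_right_zero LIMSEQ_power_zero) (use theta in simp)
  have "\<bar>J h - c h\<bar> \<le> 0"
    using LIMSEQ_le_const[OF lim, of "\<bar>J h - c h\<bar>"] le by blast
  then show ?thesis
    by simp
qed

end

section \<open>The equilibrium measure\<close>

context ruelle_spectral
begin

lemma sets_eigenmeasure: "sets eigenmeasure = sets (shift_borel (range b) A)"
  and prob_space_eigenmeasure: "prob_space eigenmeasure"
  using eigenmeasure_probability by (simp_all add: borel_probability_def)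

lemma space_eigenmeasure: "space eigenmeasure = X"
  using sets_eq_imp_space_eq[OF sets_eigenmeasure] space_shift_borel by simp

lemma finite_eigenmeasure: "finite_measure eigenmeasure"
  using prob_space_eigenmeasure by (rule prob_space.finite_measure)

lemma tail_sets: "tail i n \<in> sets (shift_borel (range b) A)"
proof -
  have "tail i n \<inter> space (shift_borel (range b) A) \<in> sets (shift_borel (range b) A)"
    using H_measurable[OF indicator_tail_H[of i n]] by (simp only: borel_measurable_indicator_iff)
  then show ?thesis
    by (simp add: space_shift_borel tail_def Int_absorb2 subset_iff)
qed

text \<open>
For a measure the tails decrease to the empty set, so \<open>functional_eq_c\<close> applies.
\<close>

lemma integral_eigenmeasure:
  assumes h: "h \<in> H"
  shows "(\<integral>x. h x \<partial>eigenmeasure) = c h"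
proof (rule functional_eq_c[where J = "\<lambda>h. \<integral>x. h x \<partial>eigenmeasure", OF _ _ _ h])
  interpret prob_space eigenmeasure
    by (rule prob_space_eigenmeasure)
  show "positive_functional (\<lambda>h. \<integral>x. h x \<partial>eigenmeasure)"
    by (rule integral_positive_functional[OF finite_eigenmeasure sets_eigenmeasure])
  show "(\<integral>x. indicat_real (cyl w) x \<partial>eigenmeasure) = mass w" for w
    using emeasure_eigenmeasure_cyl[of w] cyl_subset[of w] mass_nonneg[of w]
    by (simp add: space_eigenmeasure Int_absorb2 measure_def)
  show "(\<lambda>N. \<integral>x. indicat_real (tail i N) x \<partial>eigenmeasure) \<longlonglongrightarrow> 0" for i
  proof -
    have "(\<lambda>N. measure eigenmeasure (tail i N)) \<longlonglongrightarrow> measure eigenmeasure (\<Inter>N. tail i N)"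
    proof (rule finite_Lim_measure_decseq)
      show "range (tail i) \<subseteq> sets eigenmeasure"
        unfolding sets_eigenmeasure using tail_sets by blast
      show "decseq (tail i)"
        by (auto simp: decseq_def tail_def)
    qed
    moreover have "(\<Inter>N. tail i N) = {}"
      by (auto simp: tail_def) (meson not_less_eq_eq)
    moreover have "(\<integral>x. indicat_real (tail i N) x \<partial>eigenmeasure) = measure eigenmeasure (tail i N)" for N
      by (simp add: space_eigenmeasure tail_def Int_absorb2 subset_iff)
    ultimately show ?thesis
      by simp
  qed
qed

lemma scale_eq_density: "scale_measure (ennreal l) eigenmeasure = density eigenmeasure (\<lambda>_. ennreal l)"
  by (rule measure_eqI) (simp_all add: emeasure_density_const)

lemma dual_eigenmeasure:
  "dual_ruelle_rel (range b) A \<alpha> \<phi> eigenmeasure (scale_measure (ennreal l) eigenmeasure)"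
  unfolding dual_ruelle_rel_def
proof (intro ballI conjI)
  fix h assume h: "h \<in> H"
  have int: "integrable eigenmeasure h"
    by (rule H_integrable[OF finite_eigenmeasure sets_eigenmeasure h])
  then have meas: "h \<in> borel_measurable eigenmeasure"
    by (rule borel_measurable_integrable)
  show "integrable (scale_measure (ennreal l) eigenmeasure) h"
    unfolding scale_eq_density using int l_pos by (subst integrable_density[OF meas]) simp_all
  show "integrable eigenmeasure (L h)"
    by (rule H_integrable[OF finite_eigenmeasure sets_eigenmeasure H_L[OF h]])
  have "(\<integral>x. h x \<partial>scale_measure (ennreal l) eigenmeasure) = (\<integral>x. l * h x \<partial>eigenmeasure)"
    unfolding scale_eq_density using l_pos by (subst integral_density[OF meas]) simp_all
  also have "\<dots> = l * c h"
    by (simp add: integral_eigenmeasure[OF h])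
  finally show "(\<integral>x. h x \<partial>scale_measure (ennreal l) eigenmeasure) = (\<integral>x. L h x \<partial>eigenmeasure)"
    by (simp add: integral_eigenmeasure[OF H_L[OF h]] c_L[OF h])
qed

definition equilibrium :: "(nat \<Rightarrow> real) measure" where
  "equilibrium = density eigenmeasure (\<lambda>x. ennreal (f x))"

lemma f_measurable: "f \<in> borel_measurable eigenmeasure"
  using H_integrable[OF finite_eigenmeasure sets_eigenmeasure f_H] by (rule borel_measurable_integrable)

lemma f_nonneg: "0 \<le> f x"
  using f_pos[of x] f_off[of x] by (cases "x \<in> X") simp_all

lemma sets_equilibrium: "sets equilibrium = sets (shift_borel (range b) A)"
  by (simp add: equilibrium_def sets_eigenmeasure)

lemma space_equilibrium: "space equilibrium = X"
  by (simp add: equilibrium_def space_eigenmeasure)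

lemma prob_space_equilibrium: "prob_space equilibrium"
proof
  have "emeasure equilibrium (space equilibrium) = (\<integral>\<^sup>+x. ennreal (f x) \<partial>eigenmeasure)"
    using f_measurable by (simp add: equilibrium_def emeasure_density cong: nn_integral_cong)
  also have "\<dots> = ennreal (\<integral>x. f x \<partial>eigenmeasure)"
    by (rule nn_integral_eq_integral[OF H_integrable[OF finite_eigenmeasure sets_eigenmeasure f_H]]) (simp add: f_nonneg)
  finally show "emeasure equilibrium (space equilibrium) = 1"
    by (simp add: integral_eigenmeasure[OF f_H] c_f)
qed

lemma finite_equilibrium: "finite_measure equilibrium"
  using prob_space_equilibrium by (rule prob_space.finite_measure)

lemma equilibrium_probability: "borel_probability (range b) A equilibrium"
  by (simp add: borel_probability_def prob_space_equilibrium sets_equilibrium)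

lemma integral_equilibrium:
  assumes h: "h \<in> H"
  shows "(\<integral>x. h x \<partial>equilibrium) = c (\<lambda>x. f x * h x)"
proof -
  have meas: "h \<in> borel_measurable eigenmeasure"
    using H_integrable[OF finite_eigenmeasure sets_eigenmeasure h] by (rule borel_measurable_integrable)
  have "(\<integral>x. h x \<partial>equilibrium) = (\<integral>x. f x * h x \<partial>eigenmeasure)"
    unfolding equilibrium_def by (subst integral_density[OF meas f_measurable]) (simp_all add: f_nonneg)
  then show ?thesis
    by (simp add: integral_eigenmeasure[OF H_mult[OF f_H h]])
qed

abbreviation "Lhat \<equiv> ruelle (range b) A (normalized_potential \<phi> l f)"

text \<open>
The added coboundary conjugates \<open>L / l\<close> by multiplication with \<open>f\<close>.
\<close>

lemma Lhat_eq:
  fixes \<psi> :: "(nat \<Rightarrow> real) \<Rightarrow> real"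
  shows "Lhat \<psi> x = L (\<lambda>y. f y * \<psi> y) x * inverse (f x) / l"
proof (cases "x \<in> X")
  case True
  have "Lhat \<psi> x = (\<Sum>\<^sub>\<infinity>a\<in>pred (x 0). exp (normalized_potential \<phi> l f (prepend a x)) * \<psi> (prepend a x))"
    using True by (simp add: ruelle_def pred_def)
  also have "\<dots> = (\<Sum>\<^sub>\<infinity>a\<in>pred (x 0). (inverse (f x) / l) * (exp (\<phi> (prepend a x)) * (f (prepend a x) * \<psi> (prepend a x))))"
  proof (rule infsum_cong)
    fix a assume "a \<in> pred (x 0)"
    then have "0 < f (prepend a x)" "0 < f x"
      using prepend_in_X[OF True] True by (auto intro: f_pos)
    then show "exp (normalized_potential \<phi> l f (prepend a x)) * \<psi> (prepend a x) =
      (inverse (f x) / l) * (exp (\<phi> (prepend a x)) * (f (prepend a x) * \<psi> (prepend a x)))"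
      using l_pos by (simp add: normalized_potential_def exp_add exp_diff exp_ln divide_simps)
  qed
  also have "\<dots> = (inverse (f x) / l) * L (\<lambda>y. f y * \<psi> y) x"
    unfolding L_real_eq[OF True] by (rule infsum_cmult_right')
  finally show ?thesis
    by simp
next
  case False
  then show ?thesis
    by (simp add: ruelle_def)
qed

lemma f_Ln: "f x * Lhat \<psi> x = L (\<lambda>y. f y * \<psi> y) x / l"
  using f_pos[of x] by (cases "x \<in> X") (simp_all add: Lhat_eq L_off)

lemma H_inverse_f: "(\<lambda>x. inverse (f x)) \<in> H"
  by (rule H_inverse[OF f_H m_pos f_ge])

lemma Lhat_H: "\<psi> \<in> H \<Longrightarrow> Lhat \<psi> \<in> H"
proof -
  assume "\<psi> \<in> H"
  then have "(\<lambda>x. 1 / l * (L (\<lambda>y. f y * \<psi> y) x * inverse (f x))) \<in> H"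
    by (intro H_scale H_mult H_L H_inverse_f f_H)
  then show ?thesis
    by (simp add: Lhat_eq[abs_def])
qed

lemma dual_equilibrium: "dual_ruelle_rel (range b) A \<alpha> (normalized_potential \<phi> l f) equilibrium equilibrium"
  unfolding dual_ruelle_rel_def
proof (intro ballI conjI)
  fix \<psi> assume psi: "\<psi> \<in> H"
  show "integrable equilibrium \<psi>" "integrable equilibrium (Lhat \<psi>)"
    by (intro H_integrable finite_equilibrium sets_equilibrium Lhat_H psi)+
  have "(\<integral>x. Lhat \<psi> x \<partial>equilibrium) = c (\<lambda>x. 1 / l * L (\<lambda>y. f y * \<psi> y) x)"
    by (simp add: integral_equilibrium[OF Lhat_H[OF psi]] f_Ln)
  also have "\<dots> = c (\<lambda>y. f y * \<psi> y)"
    using l_pos by (subst c_scale[OF H_L[OF H_mult[OF f_H psi]]]) (simp add: c_L[OF H_mult[OF f_H psi]])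
  finally show "(\<integral>x. \<psi> x \<partial>equilibrium) = (\<integral>x. Lhat \<psi> x \<partial>equilibrium)"
    by (simp add: integral_equilibrium[OF psi])
qed

lemma measure_eq_equilibriumI:
  assumes fin: "finite_measure \<nu>" and sets: "sets \<nu> = sets (shift_borel (range b) A)"
    and eq: "\<And>w. (\<integral>x. indicat_real (cyl w) x \<partial>\<nu>) = (\<integral>x. indicat_real (cyl w) x \<partial>equilibrium)"
  shows "\<nu> = equilibrium"
proof (rule borel_measure_eqI[OF sets sets_equilibrium fin])
  have space: "space \<nu> = X"
    using sets_eq_imp_space_eq[OF sets] space_shift_borel by simp
  show "emeasure \<nu> (cyl w) = emeasure equilibrium (cyl w)" for w
    using eq[of w] cyl_subset[of w]
    by (simp add: space space_equilibrium Int_absorb2 finite_measure.emeasure_eq_measure[OF fin]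
        finite_measure.emeasure_eq_measure[OF finite_equilibrium])
qed

text \<open>
Dividing by \<open>f\<close> undoes the conjugation: \<open>h \<mapsto> \<integral> h / f d\<nu>\<close> satisfies the eigenvalue equation of \<open>c\<close> and
takes the value \<open>1\<close> at \<open>f\<close>.
\<close>

lemma equilibrium_unique:
  assumes nu: "borel_probability (range b) A \<nu>"
    and dual: "dual_ruelle_rel (range b) A \<alpha> (normalized_potential \<phi> l f) \<nu> \<nu>"
  shows "\<nu> = equilibrium"
proof -
  have prob: "prob_space \<nu>" and sets: "sets \<nu> = sets (shift_borel (range b) A)"
    using nu by (simp_all add: borel_probability_def)
  have fin: "finite_measure \<nu>"
    using prob by (rule prob_space.finite_measure)
  have space: "space \<nu> = X"
    using sets_eq_imp_space_eq[OF sets] space_shift_borel by simp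
  define J where "J h = (\<integral>x. inverse (f x) * h x \<partial>\<nu>)" for h
  have int: "integrable \<nu> (\<lambda>x. inverse (f x) * h x)" if "h \<in> H" for h
    by (intro H_integrable[OF fin sets] H_mult H_inverse_f that)
  have J: "positive_functional J"
    unfolding positive_functional_def
  proof (intro conjI ballI allI impI)
    show "J (\<lambda>x. g x + h x) = J g + J h" if "g \<in> H" "h \<in> H" for g h
      using int[OF that(1)] int[OF that(2)] by (simp add: J_def distrib_left)
    show "J (\<lambda>x. k * h x) = k * J h" if "h \<in> H" for h k
      by (simp add: J_def mult.left_commute)
    show "0 \<le> J h" if "h \<in> H" "\<forall>x\<in>X. 0 \<le> h x" for h
      unfolding J_def using that(2) f_nonneg space by (intro Bochner_Integration.integral_nonneg mult_nonneg_nonneg) simp_all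
  qed
  have JL: "J (L h) = l * J h" if h: "h \<in> H" for h
  proof -
    have hf: "(\<lambda>x. inverse (f x) * h x) \<in> H"
      by (intro H_mult H_inverse_f h)
    have h_off: "h x = 0" if "x \<notin> X" for x
      using h that by (simp add: holder_space_def)
    have cancel: "(\<lambda>y. f y * (inverse (f y) * h y)) = h"
    proof (rule ext)
      show "f y * (inverse (f y) * h y) = h y" for y
        using f_pos[of y] h_off[of y] by (cases "y \<in> X") simp_all
    qed
    have "J h = (\<integral>x. Lhat (\<lambda>x. inverse (f x) * h x) x \<partial>\<nu>)"
      using dual hf unfolding dual_ruelle_rel_def J_def by blast
    also have "\<dots> = (\<integral>x. 1 / l * (inverse (f x) * L h x) \<partial>\<nu>)"
      unfolding Lhat_eq cancel by (simp add: mult_ac)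
    also have "\<dots> = 1 / l * J (L h)"
      unfolding J_def by (rule integral_mult_right_zero)
    finally show ?thesis
      using l_pos by simp
  qed
  have Jf: "J f = 1"
  proof -
    have "J f = (\<integral>x. 1 \<partial>\<nu>)"
      unfolding J_def using space f_pos by (intro Bochner_Integration.integral_cong) (simp_all add: less_imp_neq[THEN not_sym])
    then show ?thesis
      using prob_space.prob_space[OF prob] by simp
  qed
  show ?thesis
  proof (rule measure_eq_equilibriumI[OF fin sets])
    fix w
    let ?u = "indicat_real (cyl w)"
    have fu: "(\<lambda>x. f x * ?u x) \<in> H"
      by (intro H_mult f_H indicator_cyl_H)
    have "(\<integral>x. ?u x \<partial>\<nu>) = J (\<lambda>x. f x * ?u x)"
      unfolding J_def
    proof (rule Bochner_Integration.integral_cong[OF refl])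
      fix x assume "x \<in> space \<nu>"
      then show "?u x = inverse (f x) * (f x * ?u x)"
        using f_pos[of x] space by simp
    qed
    also have "\<dots> = c (\<lambda>x. f x * ?u x)"
      using eigenfunctional_eq_c[OF J JL fu] Jf by simp
    finally show "(\<integral>x. ?u x \<partial>\<nu>) = (\<integral>x. ?u x \<partial>equilibrium)"
      unfolding integral_equilibrium[OF indicator_cyl_H] .
  qed
qed

definition preimage :: "nat list \<Rightarrow> (nat \<Rightarrow> real) set" where
  "preimage w = shift -` cyl w \<inter> X"

lemma indicator_preimage_H: "indicat_real (preimage w) \<in> H"
proof -
  obtain g where g: "0 < g" "\<And>x y. x \<in> cyl w \<Longrightarrow> y \<in> X \<Longrightarrow> y \<notin> cyl w \<Longrightarrow> g \<le> seq_dist x y"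
    using cyl_separated by blast
  have sep: "g / 2 \<le> seq_dist x y" if "x \<in> preimage w" "y \<in> X" "y \<notin> preimage w" for x y
  proof -
    have "x \<in> X" "shift x \<in> cyl w" "shift y \<notin> cyl w"
      using that by (auto simp: preimage_def)
    then have "g \<le> seq_dist (shift x) (shift y)"
      using shift_in_X[OF that(2)] by (intro g(2))
    also have "\<dots> \<le> 2 * seq_dist x y"
      by (rule seq_dist_shift[OF \<open>x \<in> X\<close> that(2)])
    finally show ?thesis
      by simp
  qed
  show ?thesis
  proof (rule holder_of_separated[of _ 1 "g / 2"])
    show "indicat_real (preimage w) x = 0" if "x \<notin> X" for x
      using that by (auto simp: indicator_def preimage_def)
    show "\<bar>indicat_real (preimage w) x\<bar> \<le> 1" for x
      by (simp add: indicator_def)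
    show "0 < g / 2"
      using g(1) by simp
    show "g / 2 \<le> seq_dist x y" if "x \<in> X" "y \<in> X" "indicat_real (preimage w) x \<noteq> indicat_real (preimage w) y" for x y
    proof (cases "x \<in> preimage w")
      case True
      with that sep[OF True that(2)] show ?thesis
        by (simp add: indicator_def split: if_splits)
    next
      case False
      with that have "y \<in> preimage w"
        by (simp add: indicator_def split: if_splits)
      from sep[OF this that(1) False] show ?thesis
        by (subst seq_dist_sym)
    qed
  qed
qed

lemma preimage_sets: "preimage w \<in> sets (shift_borel (range b) A)"
proof -
  have "preimage w \<inter> space (shift_borel (range b) A) \<in> sets (shift_borel (range b) A)"
    using H_measurable[OF indicator_preimage_H[of w]] by (simp only: borel_measurable_indicator_iff)
  then show ?thesis
    by (simp add: space_shift_borel preimage_def)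
qed

text \<open>
A function composed with the shift is constant along preimages, so it can be pulled out of the sum, and the
normalized operator fixes the constants.
\<close>

lemma Lhat_preimage: "Lhat (indicat_real (preimage w)) = indicat_real (cyl w)"
proof (rule ext)
  fix x
  show "Lhat (indicat_real (preimage w)) x = indicat_real (cyl w) x"
  proof (cases "x \<in> X")
    case True
    have "L (\<lambda>y. f y * indicat_real (preimage w) y) x =
      (\<Sum>\<^sub>\<infinity>a\<in>pred (x 0). indicat_real (cyl w) x * (exp (\<phi> (prepend a x)) * f (prepend a x)))"
      unfolding L_real_eq[OF True]
    proof (rule infsum_cong)
      fix a assume "a \<in> pred (x 0)"
      then have "prepend a x \<in> X"
        by (rule prepend_in_X[OF True])
      then show "exp (\<phi> (prepend a x)) * (f (prepend a x) * indicat_real (preimage w) (prepend a x)) =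
          indicat_real (cyl w) x * (exp (\<phi> (prepend a x)) * f (prepend a x))"
        by (simp add: indicator_def preimage_def)
    qed
    also have "\<dots> = indicat_real (cyl w) x * L f x"
      unfolding L_real_eq[OF True] by (rule infsum_cmult_right')
    finally show ?thesis
      using f_pos[OF True] l_pos by (simp add: Lhat_eq Lf)
  next
    case False
    then show ?thesis
      using cyl_subset[of w] by (auto simp: ruelle_def indicator_def)
  qed
qed

lemma shift_measurable: "shift \<in> measurable equilibrium equilibrium"
proof -
  have "shift \<in> measurable equilibrium (sigma X (range cyl))"
  proof (rule measurable_measure_of)
    show "range cyl \<subseteq> Pow X"
      using cyl_subset by auto
    show "shift \<in> space equilibrium \<rightarrow> X"
      by (auto simp: space_equilibrium shift_in_X)
    fix Y assume "Y \<in> range cyl"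
    then obtain w where Y: "Y = cyl w"
      by blast
    show "shift -` Y \<inter> space equilibrium \<in> sets equilibrium"
      using preimage_sets[of w] by (simp add: Y preimage_def space_equilibrium sets_equilibrium)
  qed
  moreover have "sets (sigma X (range cyl)) = sets equilibrium"
    unfolding sets_shift_borel sets_equilibrium by (rule sets_measure_of) (use cyl_subset in auto)
  ultimately show ?thesis
    using measurable_cong_sets[OF refl, of "sigma X (range cyl)" equilibrium equilibrium] by simp
qed

lemma equilibrium_invariant: "shift_invariant equilibrium"
  unfolding shift_invariant_def
proof (intro conjI ballI shift_measurable)
  have "distr equilibrium equilibrium shift = equilibrium"
  proof (rule measure_eq_equilibriumI)
    show "finite_measure (distr equilibrium equilibrium shift)"
      by (rule finite_measure.finite_measure_distr[OF finite_equilibrium shift_measurable])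
    show "sets (distr equilibrium equilibrium shift) = sets (shift_borel (range b) A)"
      by (simp add: sets_equilibrium)
    fix w
    have cylm: "indicat_real (cyl w) \<in> borel_measurable equilibrium"
      using H_integrable[OF finite_equilibrium sets_equilibrium indicator_cyl_H] by (rule borel_measurable_integrable)
    have "(\<integral>x. indicat_real (cyl w) x \<partial>distr equilibrium equilibrium shift) = (\<integral>x. indicat_real (cyl w) (shift x) \<partial>equilibrium)"
      by (rule integral_distr[OF shift_measurable cylm])
    also have "\<dots> = (\<integral>x. indicat_real (preimage w) x \<partial>equilibrium)"
      by (rule Bochner_Integration.integral_cong[OF refl]) (simp add: space_equilibrium preimage_def indicator_def)
    also have "\<dots> = (\<integral>x. Lhat (indicat_real (preimage w)) x \<partial>equilibrium)"
      using dual_equilibrium indicator_preimage_H[of w] unfolding dual_ruelle_rel_def by blast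
    finally show "(\<integral>x. indicat_real (cyl w) x \<partial>distr equilibrium equilibrium shift) = (\<integral>x. indicat_real (cyl w) x \<partial>equilibrium)"
      unfolding Lhat_preimage .
  qed
  then show "emeasure equilibrium (shift -` B \<inter> space equilibrium) = emeasure equilibrium B" if "B \<in> sets equilibrium" for B
    using emeasure_distr[OF shift_measurable that] by simp
qed

lemma f_Lhat_iterate:
  assumes "\<psi> \<in> H"
  shows "(\<lambda>y. f y * (Lhat ^^ n) \<psi> y) = (\<lambda>y. (1 / l ^ n) * (L ^^ n) (\<lambda>y. f y * \<psi> y) y)"
proof (induction n)
  case (Suc n)
  have "f x * Lhat ((Lhat ^^ n) \<psi>) x = (1 / l ^ Suc n) * L ((L ^^ n) (\<lambda>y. f y * \<psi> y)) x" for x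
    unfolding f_Ln Suc L_scale by (simp add: mult_ac)
  then show ?case
    by simp
qed simp

text \<open>
The iterates of the normalized operator are those of \<open>L\<close> on \<open>f \<psi>\<close>, divided by \<open>l^n * f\<close>.
\<close>

lemma convergence_to_equilibrium:
  assumes Sk: "S = {k}" and psi: "\<psi> \<in> H"
  shows "uniform_limit X (\<lambda>n. (Lhat ^^ n) \<psi>) (\<lambda>_. \<integral>x. \<psi> x \<partial>equilibrium) sequentially"
proof -
  obtain D \<rho> where D: "0 \<le> D" "0 < \<rho>" "\<rho> < 1"
    "\<And>h \<epsilon> n. cbound h \<epsilon> \<Longrightarrow> cbound (\<lambda>x. (L ^^ n) h x - c h * l ^ n * f x) (D * \<epsilon> * \<rho> ^ n * l ^ n)"
    by (rule aperiodic_gap[OF Sk]) blast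
  define h where "h = (\<lambda>y. f y * \<psi> y)"
  have hH: "h \<in> H"
    unfolding h_def by (rule H_mult[OF f_H psi])
  then obtain \<epsilon> where e: "cbound h \<epsilon>"
    using H_iff_cbound by blast
  have le: "dist ((Lhat ^^ n) \<psi> x) (\<integral>x. \<psi> x \<partial>equilibrium) \<le> D * \<epsilon> / m * \<rho> ^ n" if x: "x \<in> X" for n x
  proof -
    have fx: "0 < f x" "m \<le> f x"
      using f_pos[OF x] f_ge[OF x] by simp_all
    have ln: "0 < l ^ n"
      using l_pos by simp
    have "f x * (Lhat ^^ n) \<psi> x = (1 / l ^ n) * (L ^^ n) h x"
      using fun_cong[OF f_Lhat_iterate[OF psi, of n], of x] by (simp add: h_def)
    then have "(L ^^ n) h x - c h * l ^ n * f x = l ^ n * (f x * ((Lhat ^^ n) \<psi> x - c h))"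
      using l_pos by (simp add: algebra_simps)
    then have "l ^ n * (f x * \<bar>(Lhat ^^ n) \<psi> x - c h\<bar>) \<le> l ^ n * (D * \<epsilon> * \<rho> ^ n)"
      using cbound_abs[OF D(4)[OF e] x, of n] fx ln by (simp add: abs_mult mult_ac)
    then have "f x * \<bar>(Lhat ^^ n) \<psi> x - c h\<bar> \<le> D * \<epsilon> * \<rho> ^ n"
      using ln by simp
    moreover have "m * \<bar>(Lhat ^^ n) \<psi> x - c h\<bar> \<le> f x * \<bar>(Lhat ^^ n) \<psi> x - c h\<bar>"
      using fx by (intro mult_right_mono) simp_all
    ultimately have "m * \<bar>(Lhat ^^ n) \<psi> x - c h\<bar> \<le> D * \<epsilon> * \<rho> ^ n"
      by linarith
    then have "\<bar>(Lhat ^^ n) \<psi> x - c h\<bar> \<le> D * \<epsilon> * \<rho> ^ n / m"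
      using m_pos by (subst pos_le_divide_eq) (simp_all only: mult.commute)
    then show ?thesis
      unfolding integral_equilibrium[OF psi] h_def dist_real_def by simp
  qed
  show ?thesis
  proof (rule uniform_limitI)
    fix e :: real assume e0: "0 < e"
    have "(\<lambda>n. D * \<epsilon> / m * \<rho> ^ n) \<longlonglongrightarrow> 0"
      by (intro tendsto_mult_right_zero LIMSEQ_power_zero) (use D in simp)
    then have "\<forall>\<^sub>F n in sequentially. D * \<epsilon> / m * \<rho> ^ n < e"
      by (rule order_tendstoD(2)[OF _ e0])
    then show "\<forall>\<^sub>F n in sequentially. \<forall>x\<in>X. dist ((Lhat ^^ n) \<psi> x) (\<integral>x. \<psi> x \<partial>equilibrium) < e"
      by (rule eventually_mono) (use le in \<open>blast intro: le_less_trans\<close>)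
  qed
qed

end


section \<open>The Ruelle--Perron--Frobenius theorem\<close>

theorem proposition1:
  fixes b :: "nat \<Rightarrow> real" and A :: "real \<Rightarrow> real \<Rightarrow> nat" and \<alpha> :: real
    and \<phi> \<phi>0 :: "(nat \<Rightarrow> real) \<Rightarrow> real" and p :: "real \<Rightarrow> real"
  assumes "countable_markov_shift b A"
    and "\<alpha> > 0"
    and "\<phi>0 \<in> holder_space (shift_space (range b) A) \<alpha>"
    and "\<And>k. p (b k) \<in> {0..1}"
    and "\<And>k. p (b k) > 0"
    and "(\<lambda>k. p (b k)) sums 1"
    and "\<And>x. x \<in> shift_space (range b) A \<Longrightarrow> \<phi> x = \<phi>0 x + ln (p (x 0))"
  shows "ruelle_well_defined (range b) A \<alpha> \<phi>
    \<and> (\<forall>\<xi> \<in> holder_space (shift_space (range b) A) \<alpha> :: ((nat \<Rightarrow> real) \<Rightarrow> real) set.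
          ruelle (range b) A \<phi> \<xi> \<in> holder_space (shift_space (range b) A) \<alpha>)
    \<and> (\<exists>(l :: real) (f :: (nat \<Rightarrow> real) \<Rightarrow> real) \<rho> \<mu>.
        \<comment> \<open>(1)\<close>
        l > 0
      \<and> f \<in> holder_space (shift_space (range b) A) \<alpha>
      \<and> (\<forall>x \<in> shift_space (range b) A. f x > 0)
      \<and> ruelle (range b) A \<phi> f = (\<lambda>x. l * f x)
      \<and> simple_eigenvalue (range b) A \<alpha> \<phi> (complex_of_real l)
      \<and> (\<forall>z. is_eigenvalue (range b) A \<alpha> \<phi> z \<longrightarrow> cmod z \<le> l)
        \<comment> \<open>(2)\<close>
      \<and> borel_probability (range b) A \<rho>
      \<and> dual_ruelle_rel (range b) A \<alpha> \<phi> \<rho> (scale_measure (ennreal l) \<rho>)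
        \<comment> \<open>(3)\<close>
      \<and> borel_probability (range b) A \<mu>
      \<and> dual_ruelle_rel (range b) A \<alpha> (normalized_potential \<phi> l f) \<mu> \<mu>
      \<and> (\<forall>\<nu>. borel_probability (range b) A \<nu> \<and>
              dual_ruelle_rel (range b) A \<alpha> (normalized_potential \<phi> l f) \<nu> \<nu> \<longrightarrow> \<nu> = \<mu>)
      \<and> shift_invariant \<mu>
      \<and> \<mu> = density \<rho> (\<lambda>x. ennreal (f x))
        \<comment> \<open>(4)\<close>
      \<and> (aperiodic_matrix (range b) A \<longrightarrow>
            (\<forall>\<psi> \<in> holder_space (shift_space (range b) A) \<alpha> :: ((nat \<Rightarrow> real) \<Rightarrow> real) set.
               uniform_limit (shift_space (range b) A)
                 (\<lambda>n. (ruelle (range b) A (normalized_potential \<phi> l f) ^^ n) \<psi>)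
                 (\<lambda>_. \<integral>x. \<psi> x \<partial>\<mu>) sequentially)
          \<and> (\<exists>r<l. ruelle_spectrum (range b) A \<alpha> \<phi> - {complex_of_real l} \<subseteq> cball 0 r)))"
proof -
  interpret ruelle_potential b A \<alpha> \<phi> \<phi>0 p
    by (intro ruelle_potential.intro ruelle_potential_axioms.intro) (rule assms; assumption?)+
  \<comment> \<open>The choice of \<open>S\<close> is the only place where aperiodicity enters.\<close>
  obtain S where S: "communicating S" and aperiodic: "aperiodic_matrix (range b) A \<Longrightarrow> \<exists>k. S = {k}"
    by (rule communicating_exists) blast
  obtain l m C r f c where "ruelle_spectral b A \<alpha> \<phi> \<phi>0 p S l m C r f c"
    by (rule spectral_data[OF S]) blast
  then interpret ruelle_spectral b A \<alpha> \<phi> \<phi>0 p S l m C r f c .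
  have well_defined: "ruelle_well_defined (range b) A \<alpha> \<phi>"
    unfolding ruelle_well_defined_def using L_summable[OF _ H_bounded] by (simp add: pred_def)
  have spectrum: "\<exists>R<l. ruelle_spectrum (range b) A \<alpha> \<phi> - {complex_of_real l} \<subseteq> cball 0 R" if k: "S = {k}" for k
  proof -
    obtain D \<rho> where "0 \<le> D" "0 < \<rho>" "\<rho> < 1"
      "\<And>h \<epsilon> n. cbound h \<epsilon> \<Longrightarrow> cbound (\<lambda>x. (L ^^ n) h x - c h * l ^ n * f x) (D * \<epsilon> * \<rho> ^ n * l ^ n)"
      by (rule aperiodic_gap[OF k]) blast
    then interpret ruelle_gap b A \<alpha> \<phi> \<phi>0 p S l m C r f c D \<rho>
      by unfold_locales
    show ?thesis
      using spectrum_gap rho l_pos by (intro exI[of _ "\<rho> * l"]) simp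
  qed
  show ?thesis
  proof (rule conjI[OF well_defined], rule conjI[OF ballI[OF H_L]], assumption, rule exI[of _ l], rule exI[of _ f],
      rule exI[of _ eigenmeasure], rule exI[of _ equilibrium], intro conjI impI ballI allI)
    show "0 < l" "f \<in> H"
      by (rule l_pos, rule f_H)
    show "0 < f x" if "x \<in> X" for x
      by (rule f_pos[OF that])
    show "L f = (\<lambda>x. l * f x)"
      by (rule Lf)
    show "simple_eigenvalue (range b) A \<alpha> \<phi> (complex_of_real l)"
      by (rule simple)
    show "cmod z \<le> l" if "is_eigenvalue (range b) A \<alpha> \<phi> z" for z
      by (rule maximal[OF that])
    show "borel_probability (range b) A eigenmeasure"
      by (rule eigenmeasure_probability)
    show "dual_ruelle_rel (range b) A \<alpha> \<phi> eigenmeasure (scale_measure (ennreal l) eigenmeasure)"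
      by (rule dual_eigenmeasure)
    show "borel_probability (range b) A equilibrium"
      by (rule equilibrium_probability)
    show "dual_ruelle_rel (range b) A \<alpha> (normalized_potential \<phi> l f) equilibrium equilibrium"
      by (rule dual_equilibrium)
    show "\<nu> = equilibrium"
      if "borel_probability (range b) A \<nu> \<and> dual_ruelle_rel (range b) A \<alpha> (normalized_potential \<phi> l f) \<nu> \<nu>" for \<nu>
      using that by (elim conjE) (rule equilibrium_unique)
    show "shift_invariant equilibrium"
      by (rule equilibrium_invariant)
    show "equilibrium = density eigenmeasure (\<lambda>x. ennreal (f x))"
      by (rule equilibrium_def)
    show "uniform_limit X (\<lambda>n. (ruelle (range b) A (normalized_potential \<phi> l f) ^^ n) \<psi>)
        (\<lambda>_. \<integral>x. \<psi> x \<partial>equilibrium) sequentially"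
      if "aperiodic_matrix (range b) A" "\<psi> \<in> H" for \<psi>
      using aperiodic[OF that(1)] convergence_to_equilibrium[OF _ that(2)] by blast
    show "\<exists>R<l. ruelle_spectrum (range b) A \<alpha> \<phi> - {complex_of_real l} \<subseteq> cball 0 R"
      if "aperiodic_matrix (range b) A"
      using aperiodic[OF that] spectrum by blast
  qed
qed

end
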